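(* Let $V,\Psi:[0,\infty)\to[0,\infty)$ be doubling functions such that $\Psi$ is a scale function. Let $(X,d,m,\mathcal{E},\mathcal{F})$ be an MMD space that satisfies the full sub-Gaussian heat kernel estimate $\mathrm{HKE}_f(\Psi)$. Suppose furthermore that there exists $C_1>1$ such that $$C_1^{-1}V(r)\le m(B(x,r))\le C_1V(r)\qquad\text{for all }x\in X,\ 0<r<\operatorname{diam}(X,d).$$ Then there exists $C\in(1,\infty)$ such that $$C^{-1}\frac{R^2}{r^2}\le\frac{\Psi(R)}{\Psi(r)}\le C\,\frac{R\,V(R)}{r\,V(r)}\qquad\text{for all }0<r\le R<\operatorname{diam}(X,d).$$
   Context: A function $V:[0,\infty)\to[0,\infty)$ is doubling if it is a homeomorphism and there is $C>1$ with $V(2r)\le CV(r)$ for all $r>0$. An MMD (metric measure Dirichlet) space $(X,d,m,\mathcal{E},\mathcal{F})$ consists of a locally compact separable metric space $(X,d)$, a Radon measure $m$ on $X$ with full support, and a strongly local, regular, symmetric Dirichlet form $(\mathcal{E},\mathcal{F})$ on $L^2(X,m)$. Strongly local means $\mathcal{E}(f,g)=0$ whenever $f,g\in\mathcal{F}$ have compact supports and $\operatorname{supp}[f-a]\cap\operatorname{supp}[g]=\emptyset$ for some $a\in\mathbb{R}$. $(P_t)_{t>0}$ is the associated Markov semigroup on $L^2(X,m)$. $B(x,r)$ is the open ball and $\operatorname{diam}(X,d)=\sup_{x,y}d(x,y)$. A scale function is a homeomorphism $\Psi:[0,\infty)\to[0,\infty)$ for which there are $C>1$ and $1<\beta_1<\beta_2$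 with $C^{-1}(R/r)^{\beta_1}\le\Psi(R)/\Psi(r)\le C(R/r)^{\beta_2}$ for all $0<r\le R$. Put $\Phi(s)=\sup_{r>0}\left(\frac{s}{r}-\frac{1}{\Psi(r)}\right)$. A heat kernel is a family $\{p_t\}_{t>0}$ of non-negative Borel functions on $X\times X$ such that for all $t>0$, $f\in L^2(X,m)$, $P_tf(x)=\int_Xp_t(x,y)f(y)\,dm(y)$ for $m$-a.e. $x$. The full sub-Gaussian estimate $\mathrm{HKE}_f(\Psi)$ holds if there exist $C_1,c_1,c_2,c_3,C_4,C_5>0$ and a heat kernel such that for every $t>0$ and $m$-a.e. $x,y\in X$, $$\frac{c_3}{m(B(x,\Psi^{-1}(t)))}\exp\left(-C_4t\,\Phi\left(C_5\tfrac{d(x,y)}{t}\right)\right)\le p_t(x,y)\le\frac{C_1}{m(B(x,\Psi^{-1}(t)))}\exp\left(-c_1t\,\Phi\left(c_2\tfrac{d(x,y)}{t}\right)\right).$$ *)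

theory Defs
  imports "HOL-Analysis.Analysis"
begin

section \<open>Doubling functions and scale functions\<close>

text \<open>Functions on \<open>[0,\<infinity>)\<close> are represented by functions on the reals; their values at negative
  arguments are irrelevant.\<close>

definition self_homeo :: "(real \<Rightarrow> real) \<Rightarrow> bool" where
  "self_homeo V \<longleftrightarrow> (\<exists>W. homeomorphism {0..} {0..} V W)"

definition doubling_fun :: "(real \<Rightarrow> real) \<Rightarrow> bool" where
  "doubling_fun V \<longleftrightarrow> self_homeo V \<and> (\<exists>C>1. \<forall>r>0. V (2 * r) \<le> C * V r)"

definition scale_fun :: "(real \<Rightarrow> real) \<Rightarrow> bool" where
  "scale_fun \<Psi> \<longleftrightarrow> self_homeo \<Psi> \<and>
     (\<exists>C \<beta>1 \<beta>2. 1 < C \<and> 1 < \<beta>1 \<and> \<beta>1 < \<beta>2 \<and>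
       (\<forall>r R. 0 < r \<and> r \<le> R \<longrightarrow>
          inverse C * (R / r) powr \<beta>1 \<le> \<Psi> R / \<Psi> r \<and>
          \<Psi> R / \<Psi> r \<le> C * (R / r) powr \<beta>2))"

text \<open>For a scale function \<open>\<Psi>\<close> and \<open>s \<ge> 0\<close> the supremum is over a set that is bounded above,
  because \<open>\<beta>1 > 1\<close>.\<close>

definition scale_conj :: "(real \<Rightarrow> real) \<Rightarrow> real \<Rightarrow> real" where
  "scale_conj \<Psi> s = (SUP r\<in>{0<..}. s / r - 1 / \<Psi> r)"

definition scale_inv :: "(real \<Rightarrow> real) \<Rightarrow> real \<Rightarrow> real" where
  "scale_inv \<Psi> = the_inv_into {0..} \<Psi>"

text \<open>Unlike the library's \<^const>\<open>diameter\<close>, this is \<open>\<infinity>\<close> on unbounded sets.\<close>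

definition ediam :: "'a::metric_space set \<Rightarrow> ereal" where
  "ediam S = (SUP x\<in>S. SUP y\<in>S. ereal (dist x y))"


section \<open>Square integrable functions\<close>

text \<open>Elements of \<open>L\<^sup>2\<close> are represented by functions; identification of functions that agree almost
  everywhere is imposed on the notions built on top of this.\<close>

definition L2 :: "'a measure \<Rightarrow> ('a \<Rightarrow> real) set" where
  "L2 m = {f \<in> borel_measurable m. integrable m (\<lambda>x. (f x)\<^sup>2)}"

definition L2_inner :: "'a measure \<Rightarrow> ('a \<Rightarrow> real) \<Rightarrow> ('a \<Rightarrow> real) \<Rightarrow> real" where
  "L2_inner m f g = (\<integral>x. f x * g x \<partial>m)"

definition L2_norm :: "'a measure \<Rightarrow> ('a \<Rightarrow> real) \<Rightarrow> real" where
  "L2_norm m f = sqrt (L2_inner m f f)"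

definition Cc :: "('a::topological_space \<Rightarrow> real) set" where
  "Cc = {f. continuous_on UNIV f \<and> compact (closure {x. f x \<noteq> 0})}"

text \<open>The support of the measure \<open>|f| dm\<close>, which depends only on the almost everywhere class
  of \<open>f\<close>.\<close>

definition msupp :: "'a::topological_space measure \<Rightarrow> ('a \<Rightarrow> real) \<Rightarrow> 'a set" where
  "msupp m f = \<Inter>{K. closed K \<and> (AE x in m. x \<notin> K \<longrightarrow> f x = 0)}"


section \<open>Dirichlet forms\<close>

text \<open>A form is given by \<open>E\<close> together with its domain \<open>F\<close>; the values of \<open>E\<close> outside \<open>F \<times> F\<close> are
  irrelevant.\<close>

definition form_norm1 ::
  "'a measure \<Rightarrow> (('a \<Rightarrow> real) \<Rightarrow> ('a \<Rightarrow> real) \<Rightarrow> real) \<Rightarrow> ('a \<Rightarrow> real) \<Rightarrow> real" where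
  "form_norm1 m E f = sqrt (E f f + L2_inner m f f)"

text \<open>The first two clauses say that \<open>F\<close> and \<open>E\<close> live on almost everywhere classes.\<close>

definition symmetric_form ::
  "'a measure \<Rightarrow> (('a \<Rightarrow> real) \<Rightarrow> ('a \<Rightarrow> real) \<Rightarrow> real) \<Rightarrow> ('a \<Rightarrow> real) set \<Rightarrow> bool" where
  "symmetric_form m E F \<longleftrightarrow>
     F \<subseteq> L2 m \<and>
     (\<forall>f\<in>F. \<forall>g\<in>L2 m. (AE x in m. f x = g x) \<longrightarrow> g \<in> F) \<and>
     (\<forall>f\<in>F. \<forall>g\<in>F. \<forall>h\<in>F. (AE x in m. f x = g x) \<longrightarrow> E f h = E g h) \<and>
     (\<lambda>x. 0) \<in> F \<and>
     (\<forall>f\<in>F. \<forall>g\<in>F. (\<lambda>x. f x + g x) \<in> F) \<and>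
     (\<forall>c. \<forall>f\<in>F. (\<lambda>x. c * f x) \<in> F) \<and>
     (\<forall>f\<in>F. \<forall>g\<in>F. \<forall>h\<in>F. E (\<lambda>x. f x + g x) h = E f h + E g h) \<and>
     (\<forall>c. \<forall>f\<in>F. \<forall>g\<in>F. E (\<lambda>x. c * f x) g = c * E f g) \<and>
     (\<forall>f\<in>F. \<forall>g\<in>F. E f g = E g f) \<and>
     (\<forall>f\<in>F. 0 \<le> E f f)"

definition densely_defined :: "'a measure \<Rightarrow> ('a \<Rightarrow> real) set \<Rightarrow> bool" where
  "densely_defined m F \<longleftrightarrow>
     (\<forall>f\<in>L2 m. \<forall>\<epsilon>>0. \<exists>g\<in>F. L2_norm m (\<lambda>x. f x - g x) < \<epsilon>)"

definition closed_form ::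
  "'a measure \<Rightarrow> (('a \<Rightarrow> real) \<Rightarrow> ('a \<Rightarrow> real) \<Rightarrow> real) \<Rightarrow> ('a \<Rightarrow> real) set \<Rightarrow> bool" where
  "closed_form m E F \<longleftrightarrow>
     (\<forall>u :: nat \<Rightarrow> 'a \<Rightarrow> real.
        (\<forall>n. u n \<in> F) \<and>
        (\<forall>\<epsilon>>0. \<exists>N. \<forall>i\<ge>N. \<forall>j\<ge>N. form_norm1 m E (\<lambda>x. u i x - u j x) < \<epsilon>) \<longrightarrow>
        (\<exists>f\<in>F. (\<lambda>n. form_norm1 m E (\<lambda>x. u n x - f x)) \<longlonglongrightarrow> 0))"

definition markovian_form ::
  "(('a \<Rightarrow> real) \<Rightarrow> ('a \<Rightarrow> real) \<Rightarrow> real) \<Rightarrow> ('a \<Rightarrow> real) set \<Rightarrow> bool" where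
  "markovian_form E F \<longleftrightarrow>
     (\<forall>f\<in>F. (\<lambda>x. min (max (f x) 0) 1) \<in> F \<and>
        E (\<lambda>x. min (max (f x) 0) 1) (\<lambda>x. min (max (f x) 0) 1) \<le> E f f)"

definition symmetric_dirichlet_form ::
  "'a measure \<Rightarrow> (('a \<Rightarrow> real) \<Rightarrow> ('a \<Rightarrow> real) \<Rightarrow> real) \<Rightarrow> ('a \<Rightarrow> real) set \<Rightarrow> bool" where
  "symmetric_dirichlet_form m E F \<longleftrightarrow>
     symmetric_form m E F \<and> densely_defined m F \<and> closed_form m E F \<and> markovian_form E F"

definition regular_form ::
  "'a::topological_space measure \<Rightarrow> (('a \<Rightarrow> real) \<Rightarrow> ('a \<Rightarrow> real) \<Rightarrow> real) \<Rightarrow>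
   ('a \<Rightarrow> real) set \<Rightarrow> bool" where
  "regular_form m E F \<longleftrightarrow>
     (\<forall>f\<in>F. \<forall>\<epsilon>>0. \<exists>g\<in>F \<inter> Cc. form_norm1 m E (\<lambda>x. f x - g x) < \<epsilon>) \<and>
     (\<forall>f\<in>Cc. \<forall>\<epsilon>>0. \<exists>g\<in>F \<inter> Cc. \<forall>x. \<bar>f x - g x\<bar> < \<epsilon>)"

definition strongly_local_form ::
  "'a::topological_space measure \<Rightarrow> (('a \<Rightarrow> real) \<Rightarrow> ('a \<Rightarrow> real) \<Rightarrow> real) \<Rightarrow>
   ('a \<Rightarrow> real) set \<Rightarrow> bool" where
  "strongly_local_form m E F \<longleftrightarrow>
     (\<forall>f\<in>F. \<forall>g\<in>F. compact (msupp m f) \<and> compact (msupp m g) \<and>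
        (\<exists>a. msupp m (\<lambda>x. f x - a) \<inter> msupp m g = {}) \<longrightarrow> E f g = 0)"


section \<open>Metric measure Dirichlet spaces\<close>

definition radon_full_support :: "'a::topological_space measure \<Rightarrow> bool" where
  "radon_full_support m \<longleftrightarrow>
     sets m = sets borel \<and>
     (\<forall>K. compact K \<longrightarrow> emeasure m K < \<infinity>) \<and>
     (\<forall>U. open U \<and> U \<noteq> {} \<longrightarrow> 0 < emeasure m U)"

text \<open>The space \<open>X\<close> is the whole type. For metric spaces, separability is the same as the class
  \<^class>\<open>second_countable_topology\<close>. On a locally compact separable metric space every Borel measure
  that is finite on compact sets is inner and outer regular, so no further condition is needed for a
  Radon measure.\<close>

definition MMD_space ::
  "'a::{metric_space, second_countable_topology} measure \<Rightarrow>
   (('a \<Rightarrow> real) \<Rightarrow> ('a \<Rightarrow> real) \<Rightarrow> real) \<Rightarrow> ('a \<Rightarrow> real) set \<Rightarrow> bool" where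
  "MMD_space m E F \<longleftrightarrow>
     locally compact (UNIV :: 'a set) \<and>
     radon_full_support m \<and>
     symmetric_dirichlet_form m E F \<and>
     regular_form m E F \<and>
     strongly_local_form m E F"


section \<open>The associated Markov semigroup\<close>

text \<open>Each operator acts on representatives of almost everywhere classes.\<close>

definition markov_semigroup ::
  "'a measure \<Rightarrow> (real \<Rightarrow> ('a \<Rightarrow> real) \<Rightarrow> 'a \<Rightarrow> real) \<Rightarrow> bool" where
  "markov_semigroup m P \<longleftrightarrow>
     (\<forall>t>0. \<forall>f\<in>L2 m. P t f \<in> L2 m) \<and>
     (\<forall>t>0. \<forall>f\<in>L2 m. \<forall>g\<in>L2 m. (AE x in m. f x = g x) \<longrightarrow> (AE x in m. P t f x = P t g x)) \<and>
     (\<forall>t>0. \<forall>f\<in>L2 m. \<forall>g\<in>L2 m. AE x in m. P t (\<lambda>y. f y + g y) x = P t f x + P t g x) \<and>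
     (\<forall>t>0. \<forall>c. \<forall>f\<in>L2 m. AE x in m. P t (\<lambda>y. c * f y) x = c * P t f x) \<and>
     (\<forall>t>0. \<forall>f\<in>L2 m. \<forall>g\<in>L2 m. L2_inner m (P t f) g = L2_inner m f (P t g)) \<and>
     (\<forall>t>0. \<forall>f\<in>L2 m. L2_norm m (P t f) \<le> L2_norm m f) \<and>
     (\<forall>s>0. \<forall>t>0. \<forall>f\<in>L2 m. AE x in m. P s (P t f) x = P (s + t) f x) \<and>
     (\<forall>f\<in>L2 m. ((\<lambda>t. L2_norm m (\<lambda>x. P t f x - f x)) \<longlongrightarrow> 0) (at_right 0)) \<and>
     (\<forall>t>0. \<forall>f\<in>L2 m. (AE x in m. 0 \<le> f x \<and> f x \<le> 1) \<longrightarrow>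
        (AE x in m. 0 \<le> P t f x \<and> P t f x \<le> 1))"

text \<open>\<open>h\<close> is the value at \<open>f\<close> of the infinitesimal generator of \<open>P\<close>.\<close>

definition generator_at ::
  "'a measure \<Rightarrow> (real \<Rightarrow> ('a \<Rightarrow> real) \<Rightarrow> 'a \<Rightarrow> real) \<Rightarrow> ('a \<Rightarrow> real) \<Rightarrow> ('a \<Rightarrow> real) \<Rightarrow> bool" where
  "generator_at m P f h \<longleftrightarrow>
     ((\<lambda>t. L2_norm m (\<lambda>x. (P t f x - f x) / t - h x)) \<longlongrightarrow> 0) (at_right 0)"

text \<open>\<open>P\<close> is the semigroup whose generator is the self-adjoint operator \<open>A\<close> determined by the form:
  \<open>f\<close> lies in the domain of \<open>A\<close> with \<open>A f = h\<close> iff \<open>f \<in> F\<close> and \<open>E f g = - \<langle>h, g\<rangle>\<close> for all \<open>g \<in> F\<close>.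
  Up to almost everywhere equality, every Dirichlet form has exactly one such semigroup.\<close>

definition associated_semigroup ::
  "'a measure \<Rightarrow> (('a \<Rightarrow> real) \<Rightarrow> ('a \<Rightarrow> real) \<Rightarrow> real) \<Rightarrow> ('a \<Rightarrow> real) set \<Rightarrow>
   (real \<Rightarrow> ('a \<Rightarrow> real) \<Rightarrow> 'a \<Rightarrow> real) \<Rightarrow> bool" where
  "associated_semigroup m E F P \<longleftrightarrow>
     markov_semigroup m P \<and>
     (\<forall>f\<in>L2 m. \<forall>h\<in>L2 m. generator_at m P f h \<longleftrightarrow>
        f \<in> F \<and> (\<forall>g\<in>F. E f g = - L2_inner m h g))"


section \<open>Heat kernels and the full sub-Gaussian estimate\<close>

text \<open>Integrability is stated because the Bochner integral of a non-integrable function is \<open>0\<close>.\<close>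

definition heat_kernel ::
  "'a::topological_space measure \<Rightarrow> (real \<Rightarrow> ('a \<Rightarrow> real) \<Rightarrow> 'a \<Rightarrow> real) \<Rightarrow>
   (real \<Rightarrow> 'a \<Rightarrow> 'a \<Rightarrow> real) \<Rightarrow> bool" where
  "heat_kernel m P p \<longleftrightarrow>
     (\<forall>t>0. (\<lambda>(x, y). p t x y) \<in> borel_measurable borel \<and>
        (\<forall>x y. 0 \<le> p t x y) \<and>
        (\<forall>f\<in>L2 m. AE x in m. integrable m (\<lambda>y. p t x y * f y) \<and>
           P t f x = (\<integral>y. p t x y * f y \<partial>m)))"

text \<open>If a ball has infinite measure then \<^const>\<open>measure\<close> gives \<open>0\<close>, and division by \<open>0\<close> gives \<open>0\<close>,
  in agreement with the convention \<open>c / \<infinity> = 0\<close>. Balls of positive radius never have measure zero,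
  by full support.\<close>

definition HKE_full ::
  "(real \<Rightarrow> real) \<Rightarrow> 'a::metric_space measure \<Rightarrow>
   (('a \<Rightarrow> real) \<Rightarrow> ('a \<Rightarrow> real) \<Rightarrow> real) \<Rightarrow> ('a \<Rightarrow> real) set \<Rightarrow> bool" where
  "HKE_full \<Psi> m E F \<longleftrightarrow>
     (\<exists>P C1 c1 c2 c3 C4 C5 p.
        associated_semigroup m E F P \<and>
        0 < C1 \<and> 0 < c1 \<and> 0 < c2 \<and> 0 < c3 \<and> 0 < C4 \<and> 0 < C5 \<and>
        heat_kernel m P p \<and>
        (\<forall>t>0. AE x in m. AE y in m.
           c3 / measure m (ball x (scale_inv \<Psi> t)) *
             exp (- C4 * t * scale_conj \<Psi> (C5 * (dist x y / t))) \<le> p t x y \<and>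
           p t x y \<le> C1 / measure m (ball x (scale_inv \<Psi> t)) *
             exp (- c1 * t * scale_conj \<Psi> (c2 * (dist x y / t)))))"

end

theory Submission
  imports Defs
begin

text \<open>Everything is read off the nonlocal energies \<open>D\<^sub>t(f) = \<langle>f - P\<^sub>t f, f\<rangle>\<close>, which satisfy
  \<open>D\<^sub>n\<^sub>t(f) \<le> n D\<^sub>t(f)\<close> and \<open>D\<^sub>t(P\<^sub>T f) \<le> (t/T) \<parallel>f\<parallel>\<^sup>2\<close> because \<open>t \<mapsto> \<langle>P\<^sub>t f, f\<rangle>\<close> is convex.

  Lower bound: for \<open>h = lim P\<^sub>t 1\<close>, which is invariant and bounded below, \<open>2 D\<^sub>t(h u)\<close> is the
  double integral of \<open>p\<^sub>t(y,w) h(y) h(w) (u(y) - u(w))\<^sup>2\<close>. (Working with \<open>h\<close> instead of 1 avoids having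
  to prove conservativeness.) With \<open>u = (1 - d(x,\<cdot>)/R)\<^sub>+\<close> this is at least of order \<open>V(R)\<close> for
  \<open>t = \<Psi>(R)\<close> and at most of order \<open>(r/R)\<^sup>2 V(R)\<close> for \<open>t = \<Psi>(r)\<close>.

  Chain condition: if every chain from \<open>x\<close> to \<open>y\<close> with steps shorter than \<open>r\<close> needs \<open>N\<close> steps, then
  up to time \<open>n \<Psi>(r)\<close> the heat flow from the ball around \<open>x\<close> is at most \<open>exp(C n - c N)\<close> near \<open>y\<close>.
  For \<open>d(x,y) \<le> n r\<close> this contradicts the lower bound \<open>exp(-C' n)\<close> on the kernel unless \<open>N\<close> is at
  most of order \<open>n\<close>.

  Upper bound: \<open>f = P\<^sub>T 1\<^sub>B\<close> with \<open>T\<close> of order \<open>\<Psi>(R)\<close> has \<open>D\<^sub>t(f)\<close> at most of order \<open>t V(R)/\<Psi>(R)\<close>, and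
  its averages differ by a constant over two balls at distance of order \<open>R\<close>. Joining these by a shortest
  chain of order \<open>R/r\<close> balls of radius \<open>r\<close>, the Cauchy-Schwarz inequality and the lower bound on \<open>p\<^sub>t\<close>
  for \<open>t = \<Psi>(r)\<close> give the claim.\<close>

section \<open>Symmetric heat kernels\<close>

text \<open>The obstacle behind the use of \<open>h\<close> is that the semigroup may a priori lose
  mass. Then the double integral of \<open>p t y w * (u y - u w)^2\<close> is at most
  \<open>2 * dissip t u\<close>, the lost mass being the defect. The estimate by the volume needs
  this direction only. The quadratic estimate compares two times: the integral bounds the
  dissipation from below at the long time and has to bound it from above at the short one, where a
  defect would be fatal. Multiplying by an invariant \<open>h\<close> removes it.

  Identities for the kernel hold almost everywhere. They are stated for the operator
  \<open>K\<close> on functions with values in \<open>ennreal\<close>, so that no integrability has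
  to be carried along, and \<open>AE_ball_witness\<close> picks actual points.

  The space is not assumed to be geodesic, and the chain condition stands in for geodesics: points
  at distance \<open>R\<close> must be joined by a number of balls of order \<open>R / r\<close>.
  The two exponentials compared there need rates linear in the same \<open>n\<close>. For the kernel
  this holds at times \<open>n * \<Psi> r\<close> and distances of order \<open>n * r\<close>, by
  the exponent \<open>\<beta>1 > 1\<close>.\<close>

lemma midconvex_seq_first_drop:
  fixes c :: "nat \<Rightarrow> real"
  assumes "\<And>k. 2 * c (Suc k) \<le> c k + c (Suc (Suc k))"
  shows "c 0 - c n \<le> n * (c 0 - c 1)"
proof -
  have step: "c n - c (Suc n) \<le> c 0 - c 1" for n
  proof (induction n)
    case (Suc n)
    then show ?case using assms[of n] by linarith
  qed simp
  show ?thesis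
  proof (induction n)
    case (Suc n)
    then show ?case using step[of n] by (simp add: algebra_simps)
  qed simp
qed

text \<open>In both lemmas the drops \<open>c k - c (Suc k)\<close> decrease with \<open>k\<close>,
  so the first one dominates each drop up to \<open>n\<close> and the last one is dominated by each
  of them.\<close>

lemma midconvex_seq_last_drop:
  fixes c :: "nat \<Rightarrow> real"
  assumes "\<And>k. 2 * c (Suc k) \<le> c k + c (Suc (Suc k))"
  shows "n * (c n - c (Suc n)) \<le> c 0 - c n"
proof (induction n)
  case (Suc n)
  have "real (Suc n) * (c (Suc n) - c (Suc (Suc n))) \<le> real (Suc n) * (c n - c (Suc n))"
    using assms[of n] by (intro mult_left_mono) auto
  then show ?case using Suc by (simp add: algebra_simps)
qed simp

section \<open>Square integrable functions and monotone limits in \<open>ennreal\<close>\<close>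

lemma L2_integrable_mult:
  assumes "f \<in> L2 m" "g \<in> L2 m"
  shows "integrable m (\<lambda>x. f x * g x)"
proof (rule Bochner_Integration.integrable_bound)
  show "integrable m (\<lambda>x. (f x)\<^sup>2 + (g x)\<^sup>2)"
    using assms by (auto simp: L2_def)
  show "(\<lambda>x. f x * g x) \<in> borel_measurable m"
    using assms by (auto simp: L2_def)
  show "AE x in m. norm (f x * g x) \<le> norm ((f x)\<^sup>2 + (g x)\<^sup>2)"
  proof (intro AE_I2)
    fix x
    have "0 \<le> (\<bar>f x\<bar> - \<bar>g x\<bar>)\<^sup>2" "0 \<le> \<bar>f x\<bar> * \<bar>g x\<bar>" by simp_all
    then have "\<bar>f x\<bar> * \<bar>g x\<bar> \<le> (f x)\<^sup>2 + (g x)\<^sup>2"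
      by (simp only: power2_diff power2_abs)
    then show "norm (f x * g x) \<le> norm ((f x)\<^sup>2 + (g x)\<^sup>2)"
      by (simp add: abs_mult)
  qed
qed

lemma L2_inner_commute: "L2_inner m f g = L2_inner m g f"
  by (simp add: L2_inner_def mult.commute)

lemma L2_inner_nonneg: "0 \<le> L2_inner m f f"
  by (simp add: L2_inner_def)

lemma L2_inner_diff_diff:
  assumes "f \<in> L2 m" "g \<in> L2 m"
  shows "L2_inner m (\<lambda>x. f x - g x) (\<lambda>x. f x - g x) =
    L2_inner m f f - 2 * L2_inner m f g + L2_inner m g g"
proof -
  note * = L2_integrable_mult[OF assms(1) assms(1)] L2_integrable_mult[OF assms(2) assms(2)]
    L2_integrable_mult[OF assms]
  have "L2_inner m (\<lambda>x. f x - g x) (\<lambda>x. f x - g x) =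
      (\<integral>x. f x * f x - 2 * (f x * g x) + g x * g x \<partial>m)"
    unfolding L2_inner_def by (rule arg_cong[where f="integral\<^sup>L m"]) (auto simp: algebra_simps)
  then show ?thesis using * by (simp add: L2_inner_def)
qed

lemma L2_inner_cong_AE:
  assumes "AE x in m. f x = f' x" "f \<in> L2 m" "f' \<in> L2 m" "g \<in> L2 m"
  shows "L2_inner m f g = L2_inner m f' g"
  unfolding L2_inner_def using assms
  by (intro integral_cong_AE) (auto simp: L2_def)

lemma L2_bounded:
  assumes [measurable]: "f \<in> borel_measurable m" "A \<in> sets m" and "emeasure m A < \<infinity>"
    and "\<And>x. x \<notin> A \<Longrightarrow> f x = 0" "\<And>x. \<bar>f x\<bar> \<le> B"
  shows "f \<in> L2 m"
proof -
  have "integrable m (\<lambda>x. (f x)\<^sup>2)"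
  proof (rule Bochner_Integration.integrable_bound)
    show "integrable m (\<lambda>x. B\<^sup>2 * indicator A x)"
      using assms by (intro integrable_mult_right integrable_real_indicator) auto
    show "AE x in m. norm ((f x)\<^sup>2) \<le> norm (B\<^sup>2 * indicator A x)"
    proof (intro AE_I2)
      fix x
      have "(f x)\<^sup>2 \<le> B\<^sup>2" using assms(5)[of x] by (simp add: abs_le_square_iff[symmetric])
      then show "norm ((f x)\<^sup>2) \<le> norm (B\<^sup>2 * indicator A x)"
        using assms(4)[of x] by (auto simp: indicator_def)
    qed
  qed simp
  then show ?thesis by (auto simp: L2_def)
qed

lemma SUP_mult_SUP_ennreal:
  fixes a b :: "nat \<Rightarrow> ennreal"
  assumes "incseq a" "incseq b"
  shows "(SUP n. a n) * (SUP n. b n) = (SUP n. a n * b n)"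
proof (rule antisym)
  have "a i * b j \<le> (SUP n. a n * b n)" for i j
    using assms by (intro SUP_upper2[of "max i j"] mult_mono) (auto simp: incseq_def)
  then show "(SUP n. a n) * (SUP n. b n) \<le> (SUP n. a n * b n)"
    by (auto simp: SUP_mult_left_ennreal SUP_mult_right_ennreal intro!: SUP_least)
qed (auto intro!: SUP_least mult_mono SUP_upper)

text \<open>The factor has to be finite: an infinite factor times the infimum 0 is 0, although all
  the products may be infinite.\<close>

lemma INF_mult_left_real_ennreal:
  fixes f :: "nat \<Rightarrow> ennreal"
  shows "ennreal a * (INF n. f n) = (INF n. ennreal a * f n)"
proof -
  have "continuous (at_right (INF n. f n)) (\<lambda>z. ennreal a * z)"
    unfolding continuous_within
    by (intro ennreal_tendsto_cmult tendsto_ident_at) auto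
  moreover have "mono (\<lambda>z. ennreal a * z)"
    by (auto simp: mono_def intro!: mult_left_mono)
  ultimately show ?thesis
    using continuous_at_Inf_mono[of "\<lambda>z. ennreal a * z" "range f"] by (simp add: image_image)
qed

text \<open>Symmetry and the semigroup law are laws of the operators \<open>P\<close>, not pointwise
  identities of \<open>p\<close>. For the kernel they are recovered below in integrated
  form.\<close>

locale symmetric_heat_kernel = sigma_finite_measure m
  for m :: "'a::{metric_space, second_countable_topology} measure" +
  fixes P :: "real \<Rightarrow> ('a \<Rightarrow> real) \<Rightarrow> 'a \<Rightarrow> real" and p :: "real \<Rightarrow> 'a \<Rightarrow> 'a \<Rightarrow> real"
  assumes sets_m [measurable_cong]: "sets m = sets borel"
    and semigroup: "markov_semigroup m P"
    and kernel: "heat_kernel m P p"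
begin

lemma space_m [simp]: "space m = UNIV"
  using sets_eq_imp_space_eq[OF sets_m] by simp

lemma p_nonneg: "0 < t \<Longrightarrow> 0 \<le> p t x y"
  using kernel by (simp add: heat_kernel_def)

lemma sets_pair: "sets (m \<Otimes>\<^sub>M m) = sets borel"
  by (metis borel_prod sets_m sets_pair_measure_cong)

lemma p_measurable_pair [measurable]:
  "0 < t \<Longrightarrow> (\<lambda>z. p t (fst z) (snd z)) \<in> borel_measurable (m \<Otimes>\<^sub>M m)"
  using kernel measurable_cong_sets[OF sets_pair refl, of "borel :: real measure"]
  by (simp add: heat_kernel_def case_prod_beta')

lemma p_measurable [measurable]:
  assumes [measurable]: "f \<in> measurable N m" "g \<in> measurable N m" and "0 < t"
  shows "(\<lambda>z. p t (f z) (g z)) \<in> borel_measurable N"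
  using measurable_compose[OF measurable_Pair[OF assms(1,2)] p_measurable_pair[OF assms(3)]] by simp

section \<open>Laws of the semigroup, convexity in time and dissipation\<close>

lemma P_L2: "0 < t \<Longrightarrow> f \<in> L2 m \<Longrightarrow> P t f \<in> L2 m"
  using semigroup by (simp add: markov_semigroup_def)

lemma P_cong: "0 < t \<Longrightarrow> f \<in> L2 m \<Longrightarrow> g \<in> L2 m \<Longrightarrow> AE x in m. f x = g x \<Longrightarrow>
    AE x in m. P t f x = P t g x"
  using semigroup by (simp add: markov_semigroup_def)

lemma P_sym: "0 < t \<Longrightarrow> f \<in> L2 m \<Longrightarrow> g \<in> L2 m \<Longrightarrow> L2_inner m (P t f) g = L2_inner m f (P t g)"
  using semigroup by (simp add: markov_semigroup_def)

lemma P_contract: "0 < t \<Longrightarrow> f \<in> L2 m \<Longrightarrow> L2_norm m (P t f) \<le> L2_norm m f"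
  using semigroup by (simp add: markov_semigroup_def)

lemma P_add: "0 < s \<Longrightarrow> 0 < t \<Longrightarrow> f \<in> L2 m \<Longrightarrow> AE x in m. P s (P t f) x = P (s + t) f x"
  using semigroup by (simp add: markov_semigroup_def)

lemma P_markov: "0 < t \<Longrightarrow> f \<in> L2 m \<Longrightarrow> AE x in m. 0 \<le> f x \<and> f x \<le> 1 \<Longrightarrow>
    AE x in m. 0 \<le> P t f x \<and> P t f x \<le> 1"
  using semigroup by (simp add: markov_semigroup_def)

text \<open>\<open>markov_semigroup\<close> speaks of positive times only; the identity at time 0
  supplies the left endpoint of the convexity argument.\<close>

definition P0 :: "real \<Rightarrow> ('a \<Rightarrow> real) \<Rightarrow> 'a \<Rightarrow> real" where
  "P0 t f = (if t = 0 then f else P t f)"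

definition autocorr :: "('a \<Rightarrow> real) \<Rightarrow> real \<Rightarrow> real" where
  "autocorr f t = L2_inner m (P0 t f) f"

lemma P0_L2: "0 \<le> t \<Longrightarrow> f \<in> L2 m \<Longrightarrow> P0 t f \<in> L2 m"
  by (auto simp: P0_def P_L2)

lemma inner_P0_P0:
  assumes "0 \<le> s" "0 \<le> t" "f \<in> L2 m"
  shows "L2_inner m (P0 s f) (P0 t f) = autocorr f (s + t)"
proof -
  consider "s = 0" | "t = 0" | "0 < s" "0 < t" using assms by linarith
  then show ?thesis
  proof cases
    case 1
    then show ?thesis by (simp add: autocorr_def P0_def[of 0] L2_inner_commute)
  next
    case 2
    then show ?thesis by (simp add: autocorr_def P0_def[of 0])
  next
    case 3
    have "L2_inner m (P s f) (P t f) = L2_inner m (P t (P s f)) f"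
      using P_sym[of t "P s f" f] P_L2[of s f] 3 assms by simp
    also have "\<dots> = L2_inner m (P (t + s) f) f"
      using 3 assms by (intro L2_inner_cong_AE P_add P_L2) auto
    finally show ?thesis using 3 by (simp add: autocorr_def P0_def add.commute)
  qed
qed

text \<open>Expand the square of the norm of \<open>P0 a f - P0 b f\<close>: by symmetry and the
  semigroup law each inner product depends only on the sum of the two times.\<close>

lemma autocorr_midconvex:
  assumes "0 \<le> a" "0 \<le> b" "f \<in> L2 m"
  shows "2 * autocorr f (a + b) \<le> autocorr f (2 * a) + autocorr f (2 * b)"
proof -
  have "0 \<le> L2_inner m (\<lambda>x. P0 a f x - P0 b f x) (\<lambda>x. P0 a f x - P0 b f x)"
    by (rule L2_inner_nonneg)
  also have "\<dots> = autocorr f (2 * a) - 2 * autocorr f (a + b) + autocorr f (2 * b)"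
    using assms by (simp add: L2_inner_diff_diff P0_L2 inner_P0_P0)
  finally show ?thesis by simp
qed

lemma autocorr_seq:
  assumes "0 \<le> s" "0 \<le> t" "f \<in> L2 m"
  shows "2 * autocorr f (s + real (Suc k) * t) \<le>
    autocorr f (s + real k * t) + autocorr f (s + real (Suc (Suc k)) * t)"
proof -
  define a where "a = (s + real k * t) / 2"
  define b where "b = (s + real (Suc (Suc k)) * t) / 2"
  have "s + real (Suc k) * t = a + b" "s + real k * t = 2 * a" "s + real (Suc (Suc k)) * t = 2 * b"
    by (simp_all add: a_def b_def field_simps)
  moreover have "0 \<le> a" "0 \<le> b" using assms by (auto simp: a_def b_def)
  ultimately show ?thesis using autocorr_midconvex[of a b f] assms(3) by simp
qed

lemma autocorr_le:
  assumes "0 \<le> t" "f \<in> L2 m"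
  shows "autocorr f t \<le> L2_inner m f f"
proof (cases "t = 0")
  case False
  then have t: "0 < t / 2" using assms by simp
  have "autocorr f t = L2_inner m (P (t/2) f) (P (t/2) f)"
    using inner_P0_P0[of "t/2" "t/2" f] assms t by (simp add: P0_def)
  also have "\<dots> \<le> L2_inner m f f"
    using P_contract[OF t assms(2)] by (simp add: L2_norm_def)
  finally show ?thesis .
qed (simp add: autocorr_def P0_def)

lemma autocorr_nonneg:
  assumes "0 \<le> t" "f \<in> L2 m"
  shows "0 \<le> autocorr f t"
  using inner_P0_P0[of "t/2" "t/2" f] assms L2_inner_nonneg[of m "P0 (t/2) f"] by simp

definition dissip :: "real \<Rightarrow> ('a \<Rightarrow> real) \<Rightarrow> real" where
  "dissip t f = L2_inner m f f - L2_inner m (P t f) f"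

lemma dissip_mult:
  assumes "0 < t" "0 < n" "f \<in> L2 m"
  shows "dissip (real n * t) f \<le> real n * dissip t f"
  using midconvex_seq_first_drop[of "\<lambda>k. autocorr f (real k * t)" n]
    autocorr_seq[of 0 t f] assms
  by (simp add: autocorr_def dissip_def P0_def)

text \<open>\<open>dissip t (P T f)\<close> is the drop of \<open>autocorr f\<close> between the
  times \<open>2 * T\<close> and \<open>2 * T + t\<close>. It is the last drop of a progression with
  step \<open>t\<close> that starts at the remainder \<open>s\<close>, hence at most the total drop
  divided by the number \<open>n\<close> of earlier steps. Rounding down loses less than one step,
  and \<open>1 \<le> T / t\<close> still leaves \<open>T / t \<le> n\<close>.\<close>

lemma dissip_smoothing:
  assumes "0 < t" "t \<le> T" "f \<in> L2 m"
  shows "dissip t (P T f) \<le> t / T * L2_inner m f f"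
proof -
  define n where "n = nat \<lfloor>2 * T / t\<rfloor>"
  define s where "s = 2 * T - real n * t"
  have "1 \<le> T / t" using assms by simp
  have n: "real n \<le> 2 * T / t" "2 * T / t - 1 \<le> real n"
    unfolding n_def using \<open>1 \<le> T / t\<close> by linarith+
  have nT: "T / t \<le> real n" using n(2) \<open>1 \<le> T / t\<close> by simp
  have "0 \<le> s" using n assms by (simp add: s_def field_simps)
  have PT: "P T f \<in> L2 m" using assms by (intro P_L2) auto
  have "dissip t (P T f) = autocorr f (s + real n * t) - autocorr f (s + real (Suc n) * t)"
  proof -
    have "L2_inner m (P T f) (P T f) = autocorr f (2 * T)"
      using inner_P0_P0[of T T f] assms by (simp add: P0_def)
    moreover have "L2_inner m (P t (P T f)) (P T f) = L2_inner m (P (t + T) f) (P T f)"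
      using assms PT by (intro L2_inner_cong_AE P_add P_L2) auto
    moreover have "L2_inner m (P (t + T) f) (P T f) = autocorr f (2 * T + t)"
      using inner_P0_P0[of "t + T" T f] assms by (simp add: P0_def algebra_simps)
    ultimately show ?thesis by (simp add: dissip_def s_def algebra_simps)
  qed
  moreover have "real n * (autocorr f (s + real n * t) - autocorr f (s + real (Suc n) * t))
      \<le> L2_inner m f f"
  proof -
    have "real n * (autocorr f (s + real n * t) - autocorr f (s + real (Suc n) * t))
        \<le> autocorr f (s + real 0 * t) - autocorr f (s + real n * t)"
      using \<open>0 \<le> s\<close> assms
      by (intro midconvex_seq_last_drop[of "\<lambda>k. autocorr f (s + real k * t)"] autocorr_seq) auto
    also have "\<dots> \<le> L2_inner m f f - 0"
      using \<open>0 \<le> s\<close> assms by (intro diff_mono autocorr_le autocorr_nonneg) auto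
    finally show ?thesis by simp
  qed
  ultimately have *: "real n * dissip t (P T f) \<le> L2_inner m f f" by simp
  show ?thesis
  proof (cases "0 \<le> dissip t (P T f)")
    case True
    have "T / t * dissip t (P T f) \<le> L2_inner m f f"
      using mult_right_mono[OF nT True] * by simp
    then show ?thesis using assms by (simp add: field_simps)
  next
    case False
    then show ?thesis using L2_inner_nonneg[of m f] assms
      by (smt (verit) divide_nonneg_pos mult_nonneg_nonneg)
  qed
qed

section \<open>The kernel as an operator on nonnegative functions\<close>

definition K :: "real \<Rightarrow> ('a \<Rightarrow> ennreal) \<Rightarrow> 'a \<Rightarrow> ennreal" where
  "K t f x = (\<integral>\<^sup>+ y. ennreal (p t x y) * f y \<partial>m)"

lemma K_measurable [measurable]:
  assumes [measurable]: "f \<in> borel_measurable m" and "0 < t"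
  shows "K t f \<in> borel_measurable m"
  unfolding K_def[abs_def] using \<open>0 < t\<close> by measurable

lemma K_mono: "(\<And>x. f x \<le> g x) \<Longrightarrow> K t f x \<le> K t g x"
  unfolding K_def by (intro nn_integral_mono mult_left_mono) auto

text \<open>The conclusion holds at every \<open>x\<close>, because the integration ignores null
  sets. This is what allows almost everywhere estimates to be iterated.\<close>

lemma K_mono_AE: "AE x in m. f x \<le> g x \<Longrightarrow> K t f x \<le> K t g x"
  unfolding K_def by (intro nn_integral_mono_AE) (auto elim!: eventually_mono intro: mult_left_mono)

lemma K_cong_AE: "AE x in m. f x = g x \<Longrightarrow> K t f x = K t g x"
  unfolding K_def by (intro nn_integral_cong_AE) (auto elim!: eventually_mono)

lemma K_add:
  assumes [measurable]: "f \<in> borel_measurable m" "g \<in> borel_measurable m" and "0 < t"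
  shows "K t (\<lambda>x. f x + g x) x = K t f x + K t g x"
  unfolding K_def using \<open>0 < t\<close> by (simp add: nn_integral_add distrib_left)

lemma K_cmult:
  assumes [measurable]: "f \<in> borel_measurable m" and "0 < t"
  shows "K t (\<lambda>x. c * f x) x = c * K t f x"
  unfolding K_def using \<open>0 < t\<close>
  by (subst nn_integral_cmult[symmetric]) (auto simp: algebra_simps)

lemma K_sum:
  assumes [measurable]: "\<And>i. i \<in> I \<Longrightarrow> f i \<in> borel_measurable m" and "0 < t"
  shows "K t (\<lambda>x. \<Sum>i\<in>I. f i x) x = (\<Sum>i\<in>I. K t (f i) x)"
  unfolding K_def using \<open>0 < t\<close>
  by (subst nn_integral_sum[symmetric]) (auto simp: sum_distrib_left)

lemma K_SUP:
  assumes [measurable]: "\<And>n. f n \<in> borel_measurable m" and "incseq f" and "0 < t"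
  shows "K t (\<lambda>x. SUP n. f n x) x = (SUP n. K t (f n) x)"
proof -
  have "K t (\<lambda>x. SUP n. f n x) x = (\<integral>\<^sup>+ y. (SUP n. ennreal (p t x y) * f n y) \<partial>m)"
    unfolding K_def by (simp add: SUP_mult_left_ennreal)
  also have "\<dots> = (SUP n. K t (f n) x)"
    unfolding K_def using assms
    by (intro nn_integral_monotone_convergence_SUP)
      (auto simp: incseq_def le_fun_def intro!: mult_left_mono)
  finally show ?thesis .
qed

lemma K_eq_P:
  assumes "0 < t" "f \<in> L2 m" "\<And>x. 0 \<le> f x"
  shows "AE x in m. K t (\<lambda>x. ennreal (f x)) x = ennreal (P t f x)"
proof -
  have "AE x in m. integrable m (\<lambda>y. p t x y * f y) \<and> P t f x = (\<integral>y. p t x y * f y \<partial>m)"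
    using kernel assms by (auto simp: heat_kernel_def)
  then show ?thesis
  proof eventually_elim
    case (elim x)
    have "K t (\<lambda>x. ennreal (f x)) x = (\<integral>\<^sup>+ y. ennreal (p t x y * f y) \<partial>m)"
      unfolding K_def using assms p_nonneg by (simp add: ennreal_mult)
    also have "\<dots> = ennreal (P t f x)"
      using elim assms p_nonneg by (subst nn_integral_eq_integral) auto
    finally show ?case .
  qed
qed

text \<open>Values are cut off at \<open>n\<close> and the domain at the \<open>n\<close>-th set of
  a sigma-finite exhaustion. Identities pass in this way from \<open>L2\<close> to all nonnegative
  measurable functions, constants included.\<close>

lemma L2_approx:
  assumes [measurable]: "f \<in> borel_measurable m"
  obtains g :: "nat \<Rightarrow> 'a \<Rightarrow> real" where "\<And>n. g n \<in> L2 m" "\<And>n x. 0 \<le> g n x"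
    "incseq (\<lambda>n x. ennreal (g n x))" "\<And>x. (SUP n. ennreal (g n x)) = f x"
proof -
  obtain S :: "nat \<Rightarrow> 'a set" where S: "range S \<subseteq> sets m" "(\<Union>i. S i) = space m"
    "\<And>i. emeasure m (S i) \<noteq> \<infinity>" "incseq S"
    using sigma_finite_incseq by metis
  have [measurable]: "S i \<in> sets m" for i using S by auto
  define g where "g n x = enn2real (min (f x) (of_nat n)) * indicator (S n) x" for n x
  have fin: "min (f x) (of_nat n) < \<infinity>" for x n
    by (metis ennreal_of_nat_neq_top infinity_ennreal_def min.strict_coboundedI2 top.not_eq_extremum)
  have eq: "ennreal (g n x) = min (f x) (of_nat n) * indicator (S n) x" for n x
    using fin[of x n] by (auto simp: g_def indicator_def)
  have "g n \<in> L2 m" for n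
  proof (rule L2_bounded[where A="S n" and B="real n"])
    show "g n \<in> borel_measurable m" unfolding g_def by measurable
    have "enn2real (min (f x) (of_nat n)) \<le> real n" for x
      by (rule enn2real_leI) (auto simp: ennreal_of_nat_eq_real_of_nat)
    then show "\<bar>g n x\<bar> \<le> real n" for x
      by (auto simp: g_def indicator_def)
  qed (use S in \<open>auto simp: g_def less_top\<close>)
  moreover have "incseq (\<lambda>n x. ennreal (g n x))"
    using S(4) unfolding eq incseq_def le_fun_def
    by (auto simp: indicator_def min.coboundedI2)
  moreover have "(SUP n. ennreal (g n x)) = f x" for x
  proof (rule antisym)
    show "(SUP n. ennreal (g n x)) \<le> f x"
      unfolding eq by (auto intro!: SUP_least simp: indicator_def)
    obtain k where k: "x \<in> S k" using S(2) by auto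
    have "f x = (SUP n. min (f x) (of_nat n))"
    proof -
      have "(SUP n. min (f x) (of_nat n)) = min (f x) (SUP n. of_nat n)"
        using inf_SUP[of "f x" "\<lambda>n. of_nat n :: ennreal" UNIV] by (simp add: inf_min)
      then show ?thesis by (simp add: ennreal_SUP_of_nat_eq_top)
    qed
    also have "\<dots> \<le> (SUP n. ennreal (g n x))"
    proof (rule SUP_mono)
      fix n :: nat
      have "x \<in> S (max n k)" using S(4) k monoD[of S k "max n k"] by auto
      then show "\<exists>l\<in>UNIV. min (f x) (of_nat n) \<le> ennreal (g l x)"
        unfolding eq by (intro bexI[of _ "max n k"]) (auto simp: min.coboundedI2)
    qed
    finally show "f x \<le> (SUP n. ennreal (g n x))" .
  qed
  ultimately show thesis using that[of g] by (auto simp: g_def)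
qed

lemma K_semigroup:
  assumes [measurable]: "f \<in> borel_measurable m" and s: "0 < s" and t: "0 < t"
  shows "AE x in m. K s (K t f) x = K (s + t) f x"
proof -
  obtain g :: "nat \<Rightarrow> 'a \<Rightarrow> real" where g: "\<And>n. g n \<in> L2 m" "\<And>n x. 0 \<le> g n x"
    "incseq (\<lambda>n x. ennreal (g n x))" "\<And>x. (SUP n. ennreal (g n x)) = f x"
    using L2_approx[OF assms(1)] by blast
  have [measurable]: "g n \<in> borel_measurable m" for n using g(1) by (auto simp: L2_def)
  have st: "0 < s + t" using s t by simp
  have step: "AE x in m. K s (K t (\<lambda>x. ennreal (g n x))) x = K (s + t) (\<lambda>x. ennreal (g n x)) x" for n
  proof -
    \<comment> \<open>\<open>P t (g n)\<close> is nonnegative only almost everywhere, while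
      \<open>K_eq_P\<close> asks for nonnegativity at every point.\<close>
    define q where "q x = max 0 (P t (g n) x)" for x
    have PL: "P t (g n) \<in> L2 m" using g t by (intro P_L2)
    then have [measurable]: "P t (g n) \<in> borel_measurable m" by (simp add: L2_def)
    have pos: "AE x in m. K t (\<lambda>x. ennreal (g n x)) x = ennreal (q x)"
      using K_eq_P[OF t g(1) g(2)] unfolding q_def by (simp add: ennreal_max_0)
    have qL: "q \<in> L2 m"
    proof -
      have "integrable m (\<lambda>x. (q x)\<^sup>2)"
        by (rule Bochner_Integration.integrable_bound[of m "\<lambda>x. (P t (g n) x)\<^sup>2"])
          (use PL in \<open>auto simp: L2_def q_def max_def\<close>)
      moreover have "q \<in> borel_measurable m" unfolding q_def by measurable
      ultimately show ?thesis by (simp add: L2_def)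
    qed
    have "AE x in m. 0 \<le> P t (g n) x"
    proof -
      have "AE x in m. P t (g n) x = (\<integral>y. p t x y * g n y \<partial>m)"
        using kernel g t by (auto simp: heat_kernel_def)
      then show ?thesis
        by eventually_elim (use p_nonneg[OF t] g in auto)
    qed
    then have "AE x in m. q x = P t (g n) x" by (auto simp: q_def)
    then have "AE x in m. P s q x = P s (P t (g n)) x" using s qL PL by (intro P_cong)
    moreover have "AE x in m. P s (P t (g n)) x = P (s + t) (g n) x"
      using P_add s t g by blast
    moreover have "AE x in m. K s (\<lambda>x. ennreal (q x)) x = ennreal (P s q x)"
      by (rule K_eq_P[OF s qL]) (simp add: q_def)
    moreover have "AE x in m. K (s + t) (\<lambda>x. ennreal (g n x)) x = ennreal (P (s + t) (g n) x)"
      using st g by (intro K_eq_P) auto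
    moreover have "K s (K t (\<lambda>x. ennreal (g n x))) x = K s (\<lambda>x. ennreal (q x)) x" for x
      using pos by (rule K_cong_AE)
    ultimately show ?thesis by (auto elim: eventually_elim2)
  qed
  have f: "f = (\<lambda>x. SUP n. ennreal (g n x))" using g by auto
  have "K s (K t f) x = (SUP n. K s (K t (\<lambda>x. ennreal (g n x))) x)" for x
  proof -
    have "K t f = (\<lambda>x. SUP n. K t (\<lambda>x. ennreal (g n x)) x)"
      unfolding f using g(3) t by (intro ext K_SUP) auto
    moreover have "incseq (\<lambda>n. K t (\<lambda>x. ennreal (g n x)))"
      using g(3) by (auto simp: incseq_def le_fun_def intro!: K_mono)
    ultimately show ?thesis using s t by (simp add: K_SUP)
  qed
  moreover have "K (s + t) f x = (SUP n. K (s + t) (\<lambda>x. ennreal (g n x)) x)" for x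
    unfolding f using g(3) st by (intro K_SUP) auto
  moreover have "AE x in m. \<forall>n. K s (K t (\<lambda>x. ennreal (g n x))) x = K (s + t) (\<lambda>x. ennreal (g n x)) x"
    using step by (simp add: AE_all_countable)
  ultimately show ?thesis by auto
qed

lemma inner_K:
  assumes t: "0 < t" and uv: "u \<in> L2 m" "v \<in> L2 m" "\<And>x. 0 \<le> u x" "\<And>x. 0 \<le> v x"
  shows "(\<integral>\<^sup>+ x. ennreal (v x) * K t (\<lambda>x. ennreal (u x)) x \<partial>m) = ennreal (L2_inner m (P t u) v)"
    and "0 \<le> L2_inner m (P t u) v"
proof -
  have *: "AE x in m. P t u x = (\<integral>y. p t x y * u y \<partial>m)"
    using kernel uv t by (auto simp: heat_kernel_def)
  have **: "AE x in m. 0 \<le> P t u x * v x"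
    using * by eventually_elim (use p_nonneg[OF t] uv in auto)
  show "0 \<le> L2_inner m (P t u) v"
    unfolding L2_inner_def using ** by (rule integral_nonneg_AE)
  have "AE x in m. ennreal (v x) * K t (\<lambda>x. ennreal (u x)) x = ennreal (P t u x * v x)"
    using K_eq_P[OF t uv(1) uv(3)] *
  proof eventually_elim
    case (elim x)
    have "0 \<le> P t u x" unfolding elim(2) using uv p_nonneg[OF t] by simp
    then show ?case unfolding elim(1) using uv by (simp add: ennreal_mult mult.commute)
  qed
  then have "(\<integral>\<^sup>+ x. ennreal (v x) * K t (\<lambda>x. ennreal (u x)) x \<partial>m) =
      (\<integral>\<^sup>+ x. ennreal (P t u x * v x) \<partial>m)"
    by (rule nn_integral_cong_AE)
  also have "\<dots> = ennreal (L2_inner m (P t u) v)"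
    unfolding L2_inner_def using ** uv t
    by (intro nn_integral_eq_integral L2_integrable_mult P_L2)
  finally show "(\<integral>\<^sup>+ x. ennreal (v x) * K t (\<lambda>x. ennreal (u x)) x \<partial>m) = ennreal (L2_inner m (P t u) v)" .
qed

text \<open>This is \<open>P_sym\<close> for approximations of both functions. Everything is
  monotone in both indices, so the limit may be taken along the diagonal.\<close>

lemma K_sym:
  assumes [measurable]: "f \<in> borel_measurable m" "g \<in> borel_measurable m" and t: "0 < t"
  shows "(\<integral>\<^sup>+ x. g x * K t f x \<partial>m) = (\<integral>\<^sup>+ x. f x * K t g x \<partial>m)"
proof -
  note L2 = inner_K[OF t]
  obtain u :: "nat \<Rightarrow> 'a \<Rightarrow> real" where u: "\<And>n. u n \<in> L2 m" "\<And>n x. 0 \<le> u n x"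
    "incseq (\<lambda>n x. ennreal (u n x))" "\<And>x. (SUP n. ennreal (u n x)) = f x"
    using L2_approx[OF assms(1)] by blast
  obtain v :: "nat \<Rightarrow> 'a \<Rightarrow> real" where v: "\<And>n. v n \<in> L2 m" "\<And>n x. 0 \<le> v n x"
    "incseq (\<lambda>n x. ennreal (v n x))" "\<And>x. (SUP n. ennreal (v n x)) = g x"
    using L2_approx[OF assms(2)] by blast
  have [measurable]: "u n \<in> borel_measurable m" "v n \<in> borel_measurable m" for n
    using u(1) v(1) by (auto simp: L2_def)
  have f: "f = (\<lambda>x. SUP n. ennreal (u n x))" and g: "g = (\<lambda>x. SUP n. ennreal (v n x))"
    using u v by auto
  have diag: "(\<integral>\<^sup>+ x. (SUP n. ennreal (b n x)) * K t (\<lambda>x. SUP n. ennreal (a n x)) x \<partial>m) =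
      (SUP n. \<integral>\<^sup>+ x. ennreal (b n x) * K t (\<lambda>x. ennreal (a n x)) x \<partial>m)"
    if ab: "incseq (\<lambda>n x. ennreal (a n x))" "incseq (\<lambda>n x. ennreal (b n x))"
      and [measurable]: "\<And>n. a n \<in> borel_measurable m" "\<And>n. b n \<in> borel_measurable m"
    for a b :: "nat \<Rightarrow> 'a \<Rightarrow> real"
  proof -
    have incK: "incseq (\<lambda>n. K t (\<lambda>x. ennreal (a n x)))"
      using ab(1) by (auto simp: incseq_def le_fun_def intro!: K_mono)
    have "(SUP n. ennreal (b n x)) * K t (\<lambda>x. SUP n. ennreal (a n x)) x =
        (SUP n. ennreal (b n x) * K t (\<lambda>x. ennreal (a n x)) x)" for x
    proof -
      have "(SUP n. ennreal (b n x) * K t (\<lambda>x. ennreal (a n x)) x) =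
          (SUP n. ennreal (b n x)) * (SUP n. K t (\<lambda>x. ennreal (a n x)) x)"
        using ab(2) incK by (intro SUP_mult_SUP_ennreal[symmetric]) (auto simp: incseq_def le_fun_def)
      then show ?thesis using ab t by (simp add: K_SUP)
    qed
    then have "(\<integral>\<^sup>+ x. (SUP n. ennreal (b n x)) * K t (\<lambda>x. SUP n. ennreal (a n x)) x \<partial>m) =
        (\<integral>\<^sup>+ x. (SUP n. ennreal (b n x) * K t (\<lambda>x. ennreal (a n x)) x) \<partial>m)"
      by simp
    also have "\<dots> = (SUP n. \<integral>\<^sup>+ x. ennreal (b n x) * K t (\<lambda>x. ennreal (a n x)) x \<partial>m)"
      using ab(2) incK t
      by (intro nn_integral_monotone_convergence_SUP)
        (auto simp: incseq_def le_fun_def intro!: mult_mono)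
    finally show ?thesis .
  qed
  have "(\<integral>\<^sup>+ x. g x * K t f x \<partial>m) = (SUP n. ennreal (L2_inner m (P t (u n)) (v n)))"
    using diag[OF u(3) v(3)] L2 u v unfolding f g by simp
  also have "\<dots> = (SUP n. ennreal (L2_inner m (P t (v n)) (u n)))"
    using P_sym[OF t] u v by (simp add: L2_inner_commute)
  also have "\<dots> = (\<integral>\<^sup>+ x. f x * K t g x \<partial>m)"
    using diag[OF v(3) u(3)] L2 u v unfolding f g by simp
  finally show ?thesis .
qed

section \<open>Loss of mass and the invariant density\<close>

lemma K_one_le:
  assumes t: "0 < t"
  shows "AE x in m. K t (\<lambda>_. 1) x \<le> 1"
proof -
  obtain S :: "nat \<Rightarrow> 'a set" where S: "range S \<subseteq> sets m" "(\<Union>i. S i) = space m"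
    "\<And>i. emeasure m (S i) \<noteq> \<infinity>" "incseq S"
    using sigma_finite_incseq by metis
  have [measurable]: "S i \<in> sets m" for i using S by auto
  have L: "(indicator (S n) :: 'a \<Rightarrow> real) \<in> L2 m" for n
    by (rule L2_bounded[where A="S n" and B=1]) (use S in \<open>auto simp: less_top indicator_def\<close>)
  have "AE x in m. K t (\<lambda>x. ennreal (indicator (S n) x)) x \<le> 1" for n
  proof -
    have "AE x in m. 0 \<le> P t (indicator (S n)) x \<and> P t (indicator (S n)) x \<le> 1"
      using t L by (intro P_markov) (auto simp: indicator_def)
    moreover have "AE x in m. K t (\<lambda>x. ennreal (indicator (S n) x)) x = ennreal (P t (indicator (S n)) x)"
      using t L by (intro K_eq_P) auto
    ultimately show ?thesis by eventually_elim auto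
  qed
  then have *: "AE x in m. \<forall>n. K t (\<lambda>x. ennreal (indicator (S n) x)) x \<le> 1"
    by (simp add: AE_all_countable)
  have one: "(SUP n. ennreal (indicator (S n) x)) = 1" for x
  proof (rule antisym)
    obtain k where "x \<in> S k" using S(2) by auto
    then show "1 \<le> (SUP n. ennreal (indicator (S n) x))"
      by (intro SUP_upper2[of k]) auto
  qed (auto intro!: SUP_least simp: indicator_def)
  have inc: "incseq (\<lambda>n x. ennreal (indicator (S n) x))"
    using S(4) by (auto simp: incseq_def le_fun_def indicator_def)
  have "K t (\<lambda>_. 1) x = (SUP n. K t (\<lambda>x. ennreal (indicator (S n) x)) x)" for x
    using K_SUP[OF _ inc t, of x] by (simp only: one) simp
  then show ?thesis using * by (auto intro!: SUP_least elim!: eventually_mono)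
qed

lemma K_one_antimono:
  assumes "0 < s" "0 < t"
  shows "AE x in m. K (s + t) (\<lambda>_. 1) x \<le> K s (\<lambda>_. 1) x"
proof -
  have "K s (K t (\<lambda>_. 1)) x \<le> K s (\<lambda>_. 1) x" for x
    using K_one_le[OF assms(2)] by (rule K_mono_AE)
  moreover have "AE x in m. K s (K t (\<lambda>_. 1)) x = K (s + t) (\<lambda>_. 1) x"
    using assms by (intro K_semigroup) auto
  ultimately show ?thesis by (auto elim!: eventually_mono) metis
qed

text \<open>\<open>h\<close> is the infimum of \<open>K t (\<lambda>_. 1)\<close> over integer
  times. Applying \<open>K t\<close> shifts these times, and since the family decreases in time the
  shifted infimum interleaves with the original one. The last clause prevents \<open>h\<close> from
  vanishing: it inherits every lower bound that is uniform in time.\<close>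

lemma invariant_density:
  obtains h :: "'a \<Rightarrow> real" where "h \<in> borel_measurable m" "\<And>x. 0 \<le> h x" "\<And>x. h x \<le> 1"
    "\<And>t. 0 < t \<Longrightarrow> AE x in m. K t (\<lambda>x. ennreal (h x)) x = ennreal (h x)"
    "\<And>c. (\<And>t. 0 < t \<Longrightarrow> AE x in m. ennreal c \<le> K t (\<lambda>_. 1) x) \<Longrightarrow> AE x in m. c \<le> h x"
proof -
  define k where "k n = K (real (Suc n)) (\<lambda>_. 1)" for n
  define H where "H x = (INF n. k n x)" for x
  define h where "h x = enn2real (min 1 (H x))" for x
  have k_meas [measurable]: "k n \<in> borel_measurable m" for n
    unfolding k_def by measurable
  have H_meas [measurable]: "H \<in> borel_measurable m"
    unfolding H_def by measurable
  have "AE x in m. k 0 x \<le> 1" unfolding k_def by (rule K_one_le) simp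
  then have H1: "AE x in m. H x \<le> 1"
    by eventually_elim (auto simp: H_def intro: INF_lower2[of 0])
  have hH: "AE x in m. ennreal (h x) = H x"
    using H1 by eventually_elim (auto simp: h_def min_def intro!: ennreal_enn2real le_less_trans[OF _ ennreal_one_less_top])
  have dec: "AE x in m. k (Suc n) x \<le> k n x" for n
    using K_one_antimono[of "real (Suc n)" 1] unfolding k_def by (simp add: add.commute)
  have inv: "AE x in m. K t H x = H x" if t: "0 < t" for t
  proof -
    \<comment> \<open>An integer beyond \<open>t\<close>, so that the integer time
      \<open>n + j + 1\<close> comes after \<open>t + n + 1\<close>.\<close>
    define j where "j = nat \<lceil>t\<rceil> + 1"
    have j: "t < real j" unfolding j_def using t by linarith
    have 1: "AE x in m. K t (\<lambda>_. 1) x \<le> 1" using K_one_le t by simp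
    have 2: "AE x in m. \<forall>n. K t (k n) x = K (t + real (Suc n)) (\<lambda>_. 1) x"
      unfolding AE_all_countable k_def using t by (intro allI K_semigroup) auto
    have 3: "AE x in m. \<forall>n. K (real (Suc n) + t) (\<lambda>_. 1) x \<le> k n x"
      unfolding AE_all_countable k_def using t by (intro allI K_one_antimono) auto
    have 4: "AE x in m. \<forall>n. K ((t + real (Suc n)) + (real j - t)) (\<lambda>_. 1) x
        \<le> K (t + real (Suc n)) (\<lambda>_. 1) x"
      unfolding AE_all_countable using t j by (intro allI K_one_antimono) auto
    show ?thesis using 1 2 3 4
    proof eventually_elim
      case (elim x)
      have "K t H x = (\<integral>\<^sup>+ y. (INF n. ennreal (p t x y) * k n y) \<partial>m)"
        unfolding K_def H_def
        by (simp add: INF_mult_left_real_ennreal)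
      also have "\<dots> = (INF n. \<integral>\<^sup>+ y. ennreal (p t x y) * k n y \<partial>m)"
      proof (rule nn_integral_monotone_convergence_INF_AE[where i=0])
        show "AE y in m. ennreal (p t x y) * k (Suc i) y \<le> ennreal (p t x y) * k i y" for i
          using dec[of i] by (auto elim!: eventually_mono intro: mult_left_mono)
        show "(\<lambda>y. ennreal (p t x y) * k i y) \<in> borel_measurable m" for i
          using t by measurable
        \<comment> \<open>Infimum and integral may be exchanged once one of the integrals is
          finite.\<close>
        have "K t (k 0) x \<le> K t (\<lambda>_. 1) x"
          using \<open>AE x in m. k 0 x \<le> 1\<close> by (rule K_mono_AE)
        also have "\<dots> < \<infinity>" using elim(1) by (simp add: le_less_trans)
        finally show "(\<integral>\<^sup>+ y. ennreal (p t x y) * k 0 y \<partial>m) < \<infinity>" by (simp add: K_def)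
      qed
      also have "\<dots> = (INF n. K (t + real (Suc n)) (\<lambda>_. 1) x)"
        using elim(2) by (simp add: K_def)
      also have "\<dots> = H x"
      proof (rule antisym)
        show "(INF n. K (t + real (Suc n)) (\<lambda>_. 1) x) \<le> H x"
          unfolding H_def using elim(3) by (intro INF_mono) (auto simp: add.commute)
        show "H x \<le> (INF n. K (t + real (Suc n)) (\<lambda>_. 1) x)"
        proof (rule INF_greatest)
          fix n
          have "H x \<le> k (n + j) x" unfolding H_def by (rule INF_lower) simp
          also have "\<dots> \<le> K (t + real (Suc n)) (\<lambda>_. 1) x"
            using elim(4)[rule_format, of n] unfolding k_def by (simp add: algebra_simps)
          finally show "H x \<le> K (t + real (Suc n)) (\<lambda>_. 1) x" .
        qed
      qed
      finally show ?case .
    qed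
  qed
  show thesis
  proof (rule that[of h])
    show "h \<in> borel_measurable m" unfolding h_def by measurable
    show "0 \<le> h x" for x by (simp add: h_def)
    show "h x \<le> 1" for x unfolding h_def by (rule enn2real_leI) auto
    show "AE x in m. K t (\<lambda>x. ennreal (h x)) x = ennreal (h x)" if "0 < t" for t
      using inv[OF that] hH K_cong_AE[OF hH, of t] by (auto elim: eventually_elim2)
    show "AE x in m. c \<le> h x" if c: "\<And>t. 0 < t \<Longrightarrow> AE x in m. ennreal c \<le> K t (\<lambda>_. 1) x" for c
    proof -
      have "AE x in m. \<forall>n. ennreal c \<le> k n x"
        unfolding AE_all_countable k_def by (intro allI c) simp
      then show ?thesis using hH
      proof eventually_elim
        case (elim x)
        then have "ennreal c \<le> ennreal (h x)" by (auto simp: H_def intro: INF_greatest)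
        then show ?case by (subst (asm) ennreal_le_iff) (auto simp: h_def)
      qed
    qed
  qed
qed

text \<open>Expanding the square gives two square terms, which agree by \<open>K_sym\<close>, and a
  cross term. The latter stays on the left, because subtraction in \<open>ennreal\<close>
  truncates.\<close>

lemma energy_identity:
  assumes t: "0 < t" and [measurable]: "h \<in> borel_measurable m" "u \<in> borel_measurable m"
    and h: "\<And>x. 0 \<le> h x" and u: "\<And>x. 0 \<le> u x"
  shows "(\<integral>\<^sup>+ y. \<integral>\<^sup>+ w. ennreal (p t y w * (h y * h w * (u y - u w)\<^sup>2)) \<partial>m \<partial>m) +
      2 * (\<integral>\<^sup>+ y. ennreal (h y * u y) * K t (\<lambda>w. ennreal (h w * u w)) y \<partial>m) =
    2 * (\<integral>\<^sup>+ y. ennreal (h y * (u y)\<^sup>2) * K t (\<lambda>w. ennreal (h w)) y \<partial>m)"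
proof -
  have pt: "0 \<le> p t y w" for y w using p_nonneg[OF t] .
  have pointwise: "(\<integral>\<^sup>+ w. ennreal (p t y w * (h y * h w * (u y - u w)\<^sup>2)) \<partial>m) +
      2 * (ennreal (h y * u y) * K t (\<lambda>w. ennreal (h w * u w)) y) =
      ennreal (h y * (u y)\<^sup>2) * K t (\<lambda>w. ennreal (h w)) y +
      ennreal (h y) * K t (\<lambda>w. ennreal (h w * (u w)\<^sup>2)) y" for y
  proof -
    have e: "ennreal (p t y w * (h y * h w * (u y - u w)\<^sup>2)) + ennreal (2 * h y * u y) * (ennreal (p t y w) * ennreal (h w * u w))
      = ennreal (h y * (u y)\<^sup>2) * (ennreal (p t y w) * ennreal (h w)) + ennreal (h y) * (ennreal (p t y w) * ennreal (h w * (u w)\<^sup>2))"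
      for w
      using h u pt by (simp add: ennreal_mult[symmetric] ennreal_plus[symmetric] del: ennreal_plus)
        (auto intro!: arg_cong[where f=ennreal] simp: algebra_simps power2_eq_square)
    have two: "2 * (ennreal (h y * u y) * K t (\<lambda>w. ennreal (h w * u w)) y) =
      ennreal (2 * h y * u y) * K t (\<lambda>w. ennreal (h w * u w)) y"
    proof -
      have "ennreal (2 * h y * u y) = 2 * ennreal (h y * u y)"
        using h u by (simp add: ennreal_mult mult.assoc)
      then show ?thesis by (simp add: mult.assoc)
    qed
    show ?thesis
      unfolding two unfolding K_def using t
      by (simp add: nn_integral_cmult[symmetric] nn_integral_add[symmetric] e)
  qed
  have "(\<integral>\<^sup>+ y. \<integral>\<^sup>+ w. ennreal (p t y w * (h y * h w * (u y - u w)\<^sup>2)) \<partial>m \<partial>m) +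
      2 * (\<integral>\<^sup>+ y. ennreal (h y * u y) * K t (\<lambda>w. ennreal (h w * u w)) y \<partial>m) =
    (\<integral>\<^sup>+ y. ennreal (h y * (u y)\<^sup>2) * K t (\<lambda>w. ennreal (h w)) y \<partial>m) +
    (\<integral>\<^sup>+ y. ennreal (h y) * K t (\<lambda>w. ennreal (h w * (u w)\<^sup>2)) y \<partial>m)"
    using t by (simp add: nn_integral_cmult[symmetric] nn_integral_add[symmetric] pointwise)
  also have "(\<integral>\<^sup>+ y. ennreal (h y) * K t (\<lambda>w. ennreal (h w * (u w)\<^sup>2)) y \<partial>m) =
      (\<integral>\<^sup>+ y. ennreal (h y * (u y)\<^sup>2) * K t (\<lambda>w. ennreal (h w)) y \<partial>m)"
    using t by (intro K_sym) auto
  finally show ?thesis by (simp add: mult_2)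
qed

text \<open>Invariance turns the square term into the squared norm of \<open>h * u\<close>. With 1
  in place of \<open>h\<close> it may be smaller than the squared norm, and only the inequality of
  \<open>energy_le_dissip\<close> remains.\<close>

lemma energy_eq_dissip:
  assumes t: "0 < t" and [measurable]: "h \<in> borel_measurable m" "u \<in> borel_measurable m"
    and h: "\<And>x. 0 \<le> h x" and u: "\<And>x. 0 \<le> u x" and L: "(\<lambda>x. h x * u x) \<in> L2 m"
    and inv: "AE x in m. K t (\<lambda>x. ennreal (h x)) x = ennreal (h x)"
  shows "(\<integral>\<^sup>+ y. \<integral>\<^sup>+ w. ennreal (p t y w * (h y * h w * (u y - u w)\<^sup>2)) \<partial>m \<partial>m) =
    ennreal (2 * dissip t (\<lambda>x. h x * u x))"
proof -
  let ?I = "\<integral>\<^sup>+ y. \<integral>\<^sup>+ w. ennreal (p t y w * (h y * h w * (u y - u w)\<^sup>2)) \<partial>m \<partial>m"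
  let ?f = "\<lambda>x. h x * u x"
  have f: "0 \<le> ?f x" for x using h u by simp
  have "AE y in m. ennreal (h y * (u y)\<^sup>2) * K t (\<lambda>w. ennreal (h w)) y = ennreal (?f y * ?f y)"
    using inv
  proof eventually_elim
    case (elim y)
    have "ennreal (h y * (u y)\<^sup>2) * ennreal (h y) = ennreal (h y * (u y)\<^sup>2 * h y)"
      using h u by (simp add: ennreal_mult)
    then show ?case unfolding elim by (simp add: power2_eq_square mult.commute mult.left_commute)
  qed
  then have "(\<integral>\<^sup>+ y. ennreal (h y * (u y)\<^sup>2) * K t (\<lambda>w. ennreal (h w)) y \<partial>m) =
      (\<integral>\<^sup>+ y. ennreal (?f y * ?f y) \<partial>m)"
    by (rule nn_integral_cong_AE)
  also have "\<dots> = ennreal (L2_inner m ?f ?f)"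
    unfolding L2_inner_def using L by (intro nn_integral_eq_integral L2_integrable_mult) auto
  finally have "?I + 2 * ennreal (L2_inner m (P t ?f) ?f) = 2 * ennreal (L2_inner m ?f ?f)"
    using energy_identity[OF t assms(2,3) h u] inner_K(1)[OF t L L f f] by simp
  then have "?I + ennreal (2 * L2_inner m (P t ?f) ?f) = ennreal (2 * L2_inner m ?f ?f)"
    using inner_K(2)[OF t L L f f] by (simp add: ennreal_mult L2_inner_nonneg)
  then have "?I = ennreal (2 * L2_inner m ?f ?f) - ennreal (2 * L2_inner m (P t ?f) ?f)"
    using ennreal_add_diff_cancel_right[of "ennreal (2 * L2_inner m (P t ?f) ?f)" ?I] by simp
  then show ?thesis
    using inner_K(2)[OF t L L f f] by (simp add: dissip_def ennreal_minus)
qed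

lemma energy_le_dissip:
  assumes t: "0 < t" and L: "u \<in> L2 m" and u: "\<And>x. 0 \<le> u x"
  shows "(\<integral>\<^sup>+ y. \<integral>\<^sup>+ w. ennreal (p t y w * (u y - u w)\<^sup>2) \<partial>m \<partial>m) \<le> ennreal (2 * dissip t u)"
proof -
  let ?I = "\<integral>\<^sup>+ y. \<integral>\<^sup>+ w. ennreal (p t y w * (u y - u w)\<^sup>2) \<partial>m \<partial>m"
  have [measurable]: "u \<in> borel_measurable m" using L by (simp add: L2_def)
  have "AE y in m. ennreal ((u y)\<^sup>2) * K t (\<lambda>w. 1) y \<le> ennreal (u y * u y)"
    using K_one_le[OF t]
  proof eventually_elim
    case (elim y)
    then show ?case using mult_left_mono[OF elim, of "ennreal ((u y)\<^sup>2)"]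
      by (simp add: power2_eq_square)
  qed
  then have "(\<integral>\<^sup>+ y. ennreal ((u y)\<^sup>2) * K t (\<lambda>w. 1) y \<partial>m) \<le> (\<integral>\<^sup>+ y. ennreal (u y * u y) \<partial>m)"
    by (rule nn_integral_mono_AE)
  also have "\<dots> = ennreal (L2_inner m u u)"
    unfolding L2_inner_def using L by (intro nn_integral_eq_integral L2_integrable_mult) auto
  finally have "?I + 2 * ennreal (L2_inner m (P t u) u) \<le> 2 * ennreal (L2_inner m u u)"
    using energy_identity[OF t, of "\<lambda>_. 1" u] u inner_K(1)[OF t L L u u]
    by (simp add: mult_left_mono)
  then have "?I + ennreal (2 * L2_inner m (P t u) u) \<le> ennreal (2 * L2_inner m u u)"
    using inner_K(2)[OF t L L u u] by (simp add: ennreal_mult L2_inner_nonneg)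
  then have "?I \<le> ennreal (2 * L2_inner m u u) - ennreal (2 * L2_inner m (P t u) u)"
    by (intro ennreal_le_minus_iff[THEN iffD2]) (auto simp: add.commute)
  then show ?thesis
    using inner_K(2)[OF t L L u u] by (simp add: dissip_def ennreal_minus)
qed

end

section \<open>Volume and kernel bounds\<close>

text \<open>A zero \<open>z > 0\<close> of \<open>V\<close> would be an interior point, where an
  injective continuous function takes a value strictly between those at 0 and at
  \<open>z + 1\<close>. One of these would then be negative.\<close>

lemma self_homeo_facts:
  assumes "self_homeo V"
  shows "V 0 = 0" "\<And>x y. 0 \<le> x \<Longrightarrow> x < y \<Longrightarrow> V x < V y" "V ` {0..} = {0..}"
proof -
  obtain W where W: "homeomorphism {0..} {0..} V W" using assms by (auto simp: self_homeo_def)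
  have cont: "continuous_on {0..} V" and im: "V ` {0..} = {0..}" and inj: "inj_on V {0..}"
    using W by (auto simp: homeomorphism_def intro: inj_on_inverseI[where g=W])
  have nonneg: "0 \<le> V x" if "0 \<le> x" for x using im that by auto
  have mono: "(V a < V x \<and> V x < V b) \<or> (V a > V x \<and> V x > V b)" if "0 \<le> a" "a < x" "x < b" for a x b
    using that continuous_inj_imp_mono[OF that(2,3), of V]
      continuous_on_subset[OF cont, of "{a..b}"] inj_on_subset[OF inj, of "{a..b}"] by auto
  obtain z where z: "0 \<le> z" "V z = 0" using im by (metis atLeast_iff imageE order_refl)
  have "z = 0"
  proof (rule ccontr)
    assume "z \<noteq> 0"
    then show False using mono[of 0 z "z + 1"] z nonneg[of 0] nonneg[of "z + 1"] by auto
  qed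
  then show V0: "V 0 = 0" using z by simp
  show "V x < V y" if "0 \<le> x" "x < y" for x y
  proof (cases "x = 0")
    case True
    have "V y \<noteq> V 0" using inj that True by (metis atLeast_iff inj_on_contraD less_eq_real_def less_irrefl)
    then show ?thesis using nonneg[of y] V0 that True by simp
  next
    case False
    then show ?thesis using mono[of 0 x y] that nonneg[of x] V0 by auto
  qed
  show "V ` {0..} = {0..}" by fact
qed

text \<open>The factor 2 pays for rounding \<open>l\<close> up to a power of two. The exponent is a
  natural number so that \<open>poly_exp_bound\<close> can absorb the growth into
  exponentials.\<close>

lemma doubling_fun_growth:
  assumes "doubling_fun V"
  obtains a :: nat where "\<And>l r. 1 \<le> l \<Longrightarrow> 0 < r \<Longrightarrow> V (l * r) \<le> (2 * l) ^ a * V r"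
proof -
  have homeo: "self_homeo V" using assms by (simp add: doubling_fun_def)
  note mono = self_homeo_facts(2)[OF homeo]
  have pos: "0 < V x" if "0 < x" for x using mono[of 0 x] self_homeo_facts(1)[OF homeo] that by simp
  obtain C where C: "1 < C" "\<And>r. 0 < r \<Longrightarrow> V (2 * r) \<le> C * V r"
    using assms by (auto simp: doubling_fun_def)
  obtain a :: nat where a: "C < 2 ^ a" using real_arch_pow[of 2 C] by auto
  have two: "V (2 * r) \<le> 2 ^ a * V r" if "0 < r" for r
    using C(2)[OF that] mult_right_mono[of C "2 ^ a" "V r"] a pos[OF that] by linarith
  have pow: "V (2 ^ j * r) \<le> (2 ^ j) ^ a * V r" if "0 < r" for j r
  proof (induction j)
    case (Suc j)
    have "V (2 ^ Suc j * r) \<le> 2 ^ a * V (2 ^ j * r)" using two[of "2 ^ j * r"] that by (simp add: mult.assoc)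
    also have "\<dots> \<le> 2 ^ a * ((2 ^ j) ^ a * V r)" using Suc by (intro mult_left_mono) auto
    finally show ?case by (simp add: power_mult_distrib)
  qed simp
  have "V (l * r) \<le> (2 * l) ^ a * V r" if l: "1 \<le> l" and r: "0 < r" for l r
  proof -
    obtain j where j: "l \<le> 2 ^ j" "2 ^ j \<le> 2 * l"
    proof (cases "l = 1")
      case True
      then show ?thesis using that[of 0] by simp
    next
      case False
      define j where "j = nat \<lceil>log 2 l\<rceil>"
      have "0 < log 2 l" using l False by simp
      then have j: "log 2 l \<le> real j" "real j \<le> log 2 l + 1" unfolding j_def by linarith+
      have "l \<le> 2 powr real j" using j(1) l by (simp add: log_le_iff)
      moreover have "2 powr real j \<le> 2 powr (log 2 l + 1)" using j(2) by simp
      moreover have "2 powr (log 2 l + 1) = 2 * l" using l by (simp add: powr_add)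
      ultimately show ?thesis using that[of j] by (simp add: powr_realpow)
    qed
    have "V (l * r) \<le> V (2 ^ j * r)"
    proof (cases "l = 2 ^ j")
      case False
      then show ?thesis using j r l by (intro less_imp_le mono) auto
    qed simp
    also have "\<dots> \<le> (2 ^ j) ^ a * V r" using r by (rule pow)
    also have "\<dots> \<le> (2 * l) ^ a * V r" using j pos[OF r] by (intro mult_right_mono power_mono) auto
    finally show ?thesis .
  qed
  then show thesis using that by blast
qed

lemma poly_exp_bound:
  fixes b :: real and a :: nat
  assumes "0 < b"
  obtains Q where "0 < Q" "\<And>x. 0 \<le> x \<Longrightarrow> x ^ a \<le> Q * exp (b * x)"
proof -
  \<comment> \<open>Raising \<open>x \<le> 1 / e * exp (e * x)\<close> to the power \<open>a\<close>
    gives the rate \<open>a * e\<close>, which must not exceed \<open>b\<close>; the added 1 covers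
    \<open>a = 0\<close>.\<close>
  define e where "e = b / (real a + 1)"
  have e: "0 < e" using assms by (simp add: e_def)
  have "x ^ a \<le> (1 / e) ^ a * exp (b * x)" if x: "0 \<le> x" for x
  proof -
    have "e * x \<le> exp (e * x)" using exp_ge_add_one_self[of "e * x"] by linarith
    then have "x \<le> 1 / e * exp (e * x)" using e by (simp add: field_simps)
    then have "x ^ a \<le> (1 / e * exp (e * x)) ^ a" using x by (intro power_mono)
    also have "\<dots> = (1 / e) ^ a * exp (a * (e * x))" by (simp add: power_mult_distrib exp_of_nat_mult power_divide)
    also have "\<dots> \<le> (1 / e) ^ a * exp (b * x)"
    proof -
      have "a * e \<le> b" using assms by (simp add: e_def field_simps)
      then have "a * (e * x) \<le> b * x" using x mult_right_mono[of "a * e" b x] by (simp add: mult.assoc)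
      then show ?thesis using e by (intro mult_left_mono) auto
    qed
    finally show ?thesis .
  qed
  then show thesis using that[of "(1 / e) ^ a"] e by simp
qed

abbreviation (in symmetric_heat_kernel) mass :: "real \<Rightarrow> 'a \<Rightarrow> 'a set \<Rightarrow> ennreal" where
  "mass t x A \<equiv> \<integral>\<^sup>+ y. ennreal (p t x y) * indicator A y \<partial>m"

text \<open>\<open>diam_pos\<close> sets the one-point space aside, where the final claim is
  vacuous, and guarantees that admissible radii exist.\<close>

locale hke_space = symmetric_heat_kernel m P p
  for m :: "'a::{metric_space, second_countable_topology} measure"
    and P :: "real \<Rightarrow> ('a \<Rightarrow> real) \<Rightarrow> 'a \<Rightarrow> real" and p :: "real \<Rightarrow> 'a \<Rightarrow> 'a \<Rightarrow> real" +
  fixes V \<Psi> :: "real \<Rightarrow> real" and diam :: ereal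
    and C0 C1 c1 c2 c3 C4 C5 :: real
  assumes V_doubling: "doubling_fun V" and scale: "scale_fun \<Psi>"
    and diam_def: "diam = ediam (UNIV :: 'a set)" and diam_pos: "0 < diam"
    and C0: "1 < C0"
    and ball_lower: "\<And>(x::'a) r. 0 < r \<Longrightarrow> ereal r < diam \<Longrightarrow>
      ennreal (inverse C0 * V r) \<le> emeasure m (ball x r)"
    and ball_upper_diam: "\<And>(x::'a) r. 0 < r \<Longrightarrow> ereal r < diam \<Longrightarrow>
      emeasure m (ball x r) \<le> ennreal (C0 * V r)"
    and const_pos: "0 < C1" "0 < c1" "0 < c2" "0 < c3" "0 < C4" "0 < C5"
    and hke: "\<And>t. 0 < t \<Longrightarrow> AE x in m. AE y in m.
      c3 / measure m (ball x (scale_inv \<Psi> t)) *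
        exp (- C4 * t * scale_conj \<Psi> (C5 * (dist x y / t))) \<le> p t x y \<and>
      p t x y \<le> C1 / measure m (ball x (scale_inv \<Psi> t)) *
        exp (- c1 * t * scale_conj \<Psi> (c2 * (dist x y / t)))"
begin

section \<open>Elementary properties of the volume and scale functions\<close>

lemma ball_sets [measurable, simp]: "ball (x::'a) r \<in> sets m"
  by (simp add: sets_m)

lemma V_homeo: "self_homeo V" and psi_homeo: "self_homeo \<Psi>"
  using V_doubling scale by (auto simp: doubling_fun_def scale_fun_def)

lemma V_mono: "0 \<le> x \<Longrightarrow> x \<le> y \<Longrightarrow> V x \<le> V y"
  using self_homeo_facts(2)[OF V_homeo, of x y] by (cases "x = y") auto

lemma V_pos: "0 < x \<Longrightarrow> 0 < V x"
  using self_homeo_facts(2)[OF V_homeo, of 0 x] self_homeo_facts(1)[OF V_homeo] by auto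

lemma psi_strict_mono: "0 \<le> x \<Longrightarrow> x < y \<Longrightarrow> \<Psi> x < \<Psi> y"
  by (rule self_homeo_facts(2)[OF psi_homeo])

lemma psi_mono: "0 \<le> x \<Longrightarrow> x \<le> y \<Longrightarrow> \<Psi> x \<le> \<Psi> y"
  using psi_strict_mono[of x y] by (cases "x = y") auto

lemma psi_pos: "0 < x \<Longrightarrow> 0 < \<Psi> x"
  using psi_strict_mono[of 0 x] self_homeo_facts(1)[OF psi_homeo] by auto

lemma psi_surj:
  assumes "0 < t" obtains r where "0 < r" "\<Psi> r = t"
proof -
  have "t \<in> \<Psi> ` {0..}" using assms self_homeo_facts(3)[OF psi_homeo] by auto
  then obtain r where "0 \<le> r" "\<Psi> r = t" by auto
  then show thesis using that[of r] assms self_homeo_facts(1)[OF psi_homeo] by (cases "r = 0") auto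
qed

lemma scale_inv_psi: "0 \<le> r \<Longrightarrow> scale_inv \<Psi> (\<Psi> r) = r"
proof -
  have "inj_on \<Psi> {0..}"
    by (rule linorder_inj_onI) (use psi_strict_mono in fastforce)+
  then show "0 \<le> r \<Longrightarrow> scale_inv \<Psi> (\<Psi> r) = r"
    unfolding scale_inv_def by (intro the_inv_into_f_f) auto
qed

section \<open>The conjugate of the scale function\<close>

lemma scale_bounds:
  obtains C \<beta>1 \<beta>2 where "1 < C" "1 < \<beta>1" "\<beta>1 < \<beta>2"
    "\<And>r R. 0 < r \<Longrightarrow> r \<le> R \<Longrightarrow> (R / r) powr \<beta>1 / C \<le> \<Psi> R / \<Psi> r"
    "\<And>r R. 0 < r \<Longrightarrow> r \<le> R \<Longrightarrow> \<Psi> R / \<Psi> r \<le> C * (R / r) powr \<beta>2"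
proof -
  obtain C \<beta>1 \<beta>2 where *: "1 < C" "1 < \<beta>1" "\<beta>1 < \<beta>2"
    "\<forall>r R. 0 < r \<and> r \<le> R \<longrightarrow> inverse C * (R / r) powr \<beta>1 \<le> \<Psi> R / \<Psi> r \<and>
          \<Psi> R / \<Psi> r \<le> C * (R / r) powr \<beta>2"
    using scale unfolding scale_fun_def by blast
  show thesis by (rule that[of C \<beta>1 \<beta>2]) (use * in \<open>auto simp: field_simps\<close>)
qed

text \<open>The left side is \<open>\<Psi> rho\<close> times a term of the supremum that defines
  \<open>scale_conj \<Psi> (A * rho / \<Psi> rho)\<close>. The bound therefore expresses finiteness
  of the conjugate uniformly over all scales. Beyond the ratio \<open>X\<close> the power with
  exponent \<open>\<beta>1 > 1\<close> beats the linear term.\<close>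

lemma legendre_bound:
  assumes A: "0 < A"
  obtains B where "0 < B" "\<And>rho r. 0 < rho \<Longrightarrow> 0 < r \<Longrightarrow> A * rho / r - \<Psi> rho / \<Psi> r \<le> B"
proof -
  obtain C \<beta>1 \<beta>2 where C: "1 < C" "1 < \<beta>1"
    "\<And>r R. 0 < r \<Longrightarrow> r \<le> R \<Longrightarrow> (R / r) powr \<beta>1 / C \<le> \<Psi> R / \<Psi> r"
    using scale_bounds by metis
  define X where "X = (A * C) powr (1 / (\<beta>1 - 1))"
  have "A * rho / r - \<Psi> rho / \<Psi> r \<le> A + A * X" if r: "0 < rho" "0 < r" for rho r
  proof (cases "rho \<le> r")
    case True
    have "A * rho / r \<le> A" using True r A by (simp add: field_simps)
    moreover have "0 \<le> \<Psi> rho / \<Psi> r" using psi_pos r by (simp add: less_imp_le)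
    moreover have "0 \<le> A * X" using A by (simp add: X_def)
    ultimately show ?thesis by linarith
  next
    case False
    define x where "x = rho / r"
    have x: "1 \<le> x" using False r by (simp add: x_def field_simps)
    have low: "x powr \<beta>1 / C \<le> \<Psi> rho / \<Psi> r" unfolding x_def using False r by (intro C) auto
    have split: "x powr \<beta>1 = x * x powr (\<beta>1 - 1)" using x by (simp add: powr_mult_base)
    show ?thesis
    proof (cases "X \<le> x")
      case True
      have "A * C = X powr (\<beta>1 - 1)" using A C unfolding X_def by (simp add: powr_powr)
      also have "\<dots> \<le> x powr (\<beta>1 - 1)" using True C by (intro powr_mono2) (auto simp: X_def)
      finally have "A * x \<le> x powr \<beta>1 / C" using x C by (simp add: split field_simps)
      then show ?thesis using low A by (auto simp: x_def X_def intro: order_trans[OF _ add_nonneg_nonneg])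
    next
      case False
      then have "A * x \<le> A * X" using A by simp
      moreover have "0 \<le> \<Psi> rho / \<Psi> r" using psi_pos r by (simp add: less_imp_le)
      ultimately show ?thesis using A by (simp add: x_def)
    qed
  qed
  moreover have "0 < A + A * X" using A by (simp add: X_def add_pos_nonneg)
  ultimately show thesis using that by blast
qed

lemma conj_bdd: "bdd_above ((\<lambda>r. s / r - 1 / \<Psi> r) ` {0<..})"
proof -
  define A where "A = \<bar>s\<bar> * \<Psi> 1 + 1"
  have A: "0 < A" using psi_pos[of 1] by (simp add: A_def add_nonneg_pos)
  obtain B where B: "0 < B" "\<And>rho r. 0 < rho \<Longrightarrow> 0 < r \<Longrightarrow> A * rho / r - \<Psi> rho / \<Psi> r \<le> B"
    using legendre_bound[OF A] by blast
  have "s / r - 1 / \<Psi> r \<le> B / \<Psi> 1" if r: "0 < r" for r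
  proof -
    have "s * \<Psi> 1 \<le> \<bar>s\<bar> * \<Psi> 1" using psi_pos[of 1] by (intro mult_right_mono) auto
    then have "s * \<Psi> 1 \<le> A" by (simp add: A_def)
    then have "s * \<Psi> 1 / r \<le> A / r" using r by (simp add: divide_right_mono)
    then have "s * \<Psi> 1 / r - \<Psi> 1 / \<Psi> r \<le> B" using B(2)[of 1 r] r by simp
    then have "(s / r - 1 / \<Psi> r) * \<Psi> 1 \<le> B" by (simp add: left_diff_distrib)
    then show ?thesis using psi_pos[of 1] by (simp add: pos_le_divide_eq)
  qed
  then show ?thesis by (auto intro!: bdd_aboveI2)
qed

lemma conj_ge: "0 < r \<Longrightarrow> s / r - 1 / \<Psi> r \<le> scale_conj \<Psi> s"
  unfolding scale_conj_def by (rule cSUP_upper[OF _ conj_bdd]) simp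

text \<open>Time \<open>n * \<Psi> r\<close> and distance of order \<open>n * r\<close> multiply
  each term of the supremum by \<open>n\<close>. The exponent of the lower kernel bound is thus
  linear in \<open>n\<close>, the rate on which the chain argument rests.\<close>

lemma conj_le:
  assumes "0 < A"
  obtains B where "0 < B" "\<And>n r d. 1 \<le> n \<Longrightarrow> 0 < r \<Longrightarrow> d \<le> A * (real n * r) \<Longrightarrow>
    real n * \<Psi> r * scale_conj \<Psi> (C5 * (d / (real n * \<Psi> r))) \<le> B * real n"
proof -
  have "0 < C5 * A" using assms const_pos by simp
  from legendre_bound[OF this] obtain B where B: "0 < B"
    "\<And>rho r. 0 < rho \<Longrightarrow> 0 < r \<Longrightarrow> (C5 * A) * rho / r - \<Psi> rho / \<Psi> r \<le> B" by blast
  have "real n * \<Psi> r * scale_conj \<Psi> (C5 * (d / (real n * \<Psi> r))) \<le> B * real n"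
    if n: "1 \<le> n" and r: "0 < r" and d: "d \<le> A * (real n * r)" for n r d
  proof -
    define t where "t = real n * \<Psi> r"
    have t: "0 < t" using n psi_pos[OF r] by (simp add: t_def)
    have "scale_conj \<Psi> (C5 * (d / t)) \<le> B * real n / t"
      unfolding scale_conj_def
    proof (rule cSUP_least)
      fix q :: real assume "q \<in> {0<..}"
      then have q: "0 < q" by simp
      have "C5 * d / q \<le> real n * (C5 * A * r / q)"
        using mult_left_mono[OF d, of "C5 / q"] const_pos q by (simp add: algebra_simps)
      then have "C5 * d / q - t / \<Psi> q \<le> real n * (C5 * A * r / q - \<Psi> r / \<Psi> q)"
        by (simp add: t_def right_diff_distrib)
      also have "\<dots> \<le> real n * B" using B(2)[OF r q] by (intro mult_left_mono) auto
      also have "C5 * d / q - t / \<Psi> q = (C5 * (d / t) / q - 1 / \<Psi> q) * t"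
        using t q by (simp add: field_simps)
      finally have "(C5 * (d / t) / q - 1 / \<Psi> q) * t \<le> B * real n" by (simp add: mult.commute)
      then show "C5 * (d / t) / q - 1 / \<Psi> q \<le> B * real n / t" using t by (simp add: pos_le_divide_eq)
    qed simp
    then have "t * scale_conj \<Psi> (C5 * (d / t)) \<le> B * real n" using t by (simp only: pos_le_divide_eq mult.commute)
    then show ?thesis unfolding t_def .
  qed
  then show thesis using that B(1) by blast
qed

section \<open>Volumes of balls\<close>

lemma ball_pos: "0 < r \<Longrightarrow> 0 < emeasure m (ball x r)"
proof -
  assume r: "0 < r"
  obtain q where q: "0 < q" "ereal q < diam" "q \<le> r"
  proof -
    obtain z where z: "0 < ereal z" "ereal z < diam"
      using ereal_dense2[OF diam_pos] by auto
    have "ereal (min z r) \<le> ereal z" by simp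
    then have "ereal (min z r) < diam" using z(2) by (rule le_less_trans)
    then show thesis using that[of "min z r"] z r by (auto simp del: ereal_min)
  qed
  have "0 < ennreal (inverse C0 * V q)" using V_pos[OF q(1)] C0 by (simp add: ennreal_zero_less_mult_iff)
  also have "\<dots> \<le> emeasure m (ball x q)" using ball_lower q by simp
  also have "\<dots> \<le> emeasure m (ball x r)" using q by (intro emeasure_mono subset_ball) auto
  finally show ?thesis .
qed

lemma AE_ball_witness:
  assumes "AE x in m. Q x" "0 < r"
  obtains y where "dist x y < r" "Q y"
proof -
  have "\<exists>y. dist x y < r \<and> Q y"
  proof (rule ccontr)
    assume "\<not> ?thesis"
    then have "AE y in m. y \<notin> ball x r" using assms(1) by (auto elim!: eventually_mono)
    then have "emeasure m (ball x r) = 0" by (subst (asm) AE_iff_measurable[OF _ refl]) (auto simp: ball_def)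
    then show False using ball_pos[OF assms(2), of x] by simp
  qed
  then show thesis using that by blast
qed

text \<open>The given volume bounds stop at the diameter. If it is a finite \<open>D\<close>, then
  at time \<open>\<Psi> (D / 2)\<close> the kernel from a suitable point is bounded below on the
  whole space, all distances being at most \<open>2 * (D / 2)\<close>. Its integral is at most 1, so
  the total measure is finite and covers the remaining radii.\<close>

lemma ball_upper:
  obtains Cv where "0 < Cv" "\<And>(x::'a) r. 0 < r \<Longrightarrow> emeasure m (ball x r) \<le> ennreal (Cv * V r)"
proof (cases "diam = \<infinity>")
  case True
  then show ?thesis using ball_upper_diam C0 that[of C0] by auto
next
  case False
  then obtain D where D: "diam = ereal D" "0 < D"
    using diam_pos by (cases "diam") auto
  have dist_le: "dist x y \<le> D" for x y :: 'a
  proof -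
    have "ereal (dist x y) \<le> diam"
      unfolding diam_def ediam_def by (intro SUP_upper2[of x] SUP_upper2[of y]) auto
    then show ?thesis using D by simp
  qed
  define rho where "rho = D / 2"
  have rho: "0 < rho" "ereal rho < diam" using D by (auto simp: rho_def)
  obtain B where B: "0 < B" "\<And>n r d. 1 \<le> n \<Longrightarrow> 0 < r \<Longrightarrow> d \<le> 2 * (real n * r) \<Longrightarrow>
    real n * \<Psi> r * scale_conj \<Psi> (C5 * (d / (real n * \<Psi> r))) \<le> B * real n"
    using conj_le[of 2] by auto
  have t: "0 < \<Psi> rho" using psi_pos rho by simp
  obtain x where x: "K (\<Psi> rho) (\<lambda>_. 1) x \<le> 1" "AE y in m. c3 / measure m (ball x rho) *
        exp (- C4 * \<Psi> rho * scale_conj \<Psi> (C5 * (dist x y / \<Psi> rho))) \<le> p (\<Psi> rho) x y"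
  proof -
    have "AE x in m. K (\<Psi> rho) (\<lambda>_. 1) x \<le> 1 \<and> (AE y in m. c3 / measure m (ball x rho) *
        exp (- C4 * \<Psi> rho * scale_conj \<Psi> (C5 * (dist x y / \<Psi> rho))) \<le> p (\<Psi> rho) x y)"
      using K_one_le[OF t] hke[OF t]
      by eventually_elim (use rho in \<open>auto simp: scale_inv_psi elim!: eventually_mono\<close>)
    from AE_ball_witness[OF this zero_less_one] show thesis using that by blast
  qed
  define e where "e = c3 / (C0 * V rho) * exp (- C4 * B)"
  have e: "0 < e" using const_pos C0 V_pos rho by (simp add: e_def)
  have meas: "0 < measure m (ball x rho)" "measure m (ball x rho) \<le> C0 * V rho"
  proof -
    have u: "emeasure m (ball x rho) \<le> ennreal (C0 * V rho)" using rho by (intro ball_upper_diam)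
    then have "emeasure m (ball x rho) < \<infinity>" by (simp add: le_less_trans)
    then show "0 < measure m (ball x rho)" using ball_pos[OF rho(1), of x]
      by (simp add: measure_def enn2real_positive_iff)
    show "measure m (ball x rho) \<le> C0 * V rho"
      unfolding measure_def using u C0 V_pos[OF rho(1)] by (intro enn2real_leI) auto
  qed
  have "AE y in m. ennreal e \<le> ennreal (p (\<Psi> rho) x y) * 1"
    using x(2)
  proof eventually_elim
    case (elim y)
    have "\<Psi> rho * scale_conj \<Psi> (C5 * (dist x y / \<Psi> rho)) \<le> B"
      using B(2)[of 1 rho "dist x y"] rho dist_le[of x y] by (simp add: rho_def)
    then have "exp (- C4 * B) \<le> exp (- C4 * \<Psi> rho * scale_conj \<Psi> (C5 * (dist x y / \<Psi> rho)))"
      using const_pos by (simp add: mult.assoc)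
    moreover have "c3 / (C0 * V rho) \<le> c3 / measure m (ball x rho)"
      using meas const_pos by (intro divide_left_mono) auto
    ultimately have "e \<le> p (\<Psi> rho) x y"
      unfolding e_def using elim meas const_pos by (smt (verit) divide_pos_pos exp_gt_zero mult_mono)
    then show ?case by (simp add: ennreal_leI)
  qed
  then have "(\<integral>\<^sup>+ y. ennreal e \<partial>m) \<le> K (\<Psi> rho) (\<lambda>_. 1) x"
    unfolding K_def by (rule nn_integral_mono_AE)
  then have "ennreal e * emeasure m UNIV \<le> 1" using x(1) by (simp add: order_trans)
  then have tot: "emeasure m UNIV \<le> ennreal (1 / e)"
  proof -
    assume a: "ennreal e * emeasure m UNIV \<le> 1"
    have "emeasure m UNIV = ennreal (1 / e) * (ennreal e * emeasure m UNIV)"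
      using e by (simp add: mult.assoc[symmetric] ennreal_mult[symmetric])
    also have "\<dots> \<le> ennreal (1 / e) * 1" using a by (rule mult_left_mono) simp
    finally show ?thesis by simp
  qed
  define Cv where "Cv = C0 + 1 / (e * V rho)"
  have Cv: "C0 \<le> Cv" "1 / (e * V rho) \<le> Cv" using e C0 V_pos[OF rho(1)] by (simp_all add: Cv_def)
  have "emeasure m (ball x r) \<le> ennreal (Cv * V r)" if r: "0 < r" for x r
  proof (cases "ereal r < diam")
    case True
    have "emeasure m (ball x r) \<le> ennreal (C0 * V r)" using r True by (rule ball_upper_diam)
    also have "\<dots> \<le> ennreal (Cv * V r)" using Cv V_pos[OF r] by (intro ennreal_leI mult_right_mono) auto
    finally show ?thesis .
  next
    case False
    then have "rho \<le> r" using D rho_def by simp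
    have "emeasure m (ball x r) \<le> emeasure m UNIV" by (intro emeasure_mono) auto
    also have "\<dots> \<le> ennreal (1 / e)" by (rule tot)
    also have "1 / e = 1 / (e * V rho) * V rho" using V_pos[OF rho(1)] by simp
    also have "\<dots> \<le> Cv * V r" using Cv C0 V_mono[of rho r] V_pos[OF rho(1)] \<open>rho \<le> r\<close> rho(1)
      by (intro mult_mono) auto
    finally show ?thesis by (simp add: ennreal_leI)
  qed
  then show ?thesis using that[of Cv] Cv C0 by auto
qed

lemma ball_finite: "emeasure m (ball x r) < \<infinity>"
proof (cases "0 < r")
  case True
  then show ?thesis using ball_upper[of thesis] by (metis ennreal_less_top le_less_trans infinity_ennreal_def ball_upper)
qed (simp add: ball_empty)

lemma measure_ball_upper:
  obtains Cv where "0 < Cv" "\<And>(x::'a) r. 0 < r \<Longrightarrow> measure m (ball x r) \<le> Cv * V r"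
proof -
  obtain Cv where Cv: "0 < Cv" "\<And>(x::'a) r. 0 < r \<Longrightarrow> emeasure m (ball x r) \<le> ennreal (Cv * V r)"
    using ball_upper by blast
  have "measure m (ball x r) \<le> Cv * V r" if "0 < r" for x r
    unfolding measure_def using Cv V_pos[OF that] that by (intro enn2real_leI) auto
  then show thesis using that Cv(1) by blast
qed

lemma emeasure_ball: "emeasure m (ball x r) = ennreal (measure m (ball x r))"
  using ball_finite[of x r] by (simp add: emeasure_eq_ennreal_measure)

lemma measure_ball_pos: "0 < r \<Longrightarrow> 0 < measure m (ball x r)"
  using ball_pos[of r x] by (simp add: emeasure_ball)

lemma measure_ball_lower:
  assumes "0 < r" "ereal r < diam"
  shows "V r / C0 \<le> measure m (ball x r)"
  using ball_lower[OF assms, of x] by (simp add: emeasure_ball divide_inverse mult.commute)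

section \<open>Kernel bounds at the time \<open>\<Psi> r\<close> and at its multiples\<close>

lemma upper_bound:
  obtains C b where "0 < C" "0 < b" "\<And>r. 0 < r \<Longrightarrow> ereal r < diam \<Longrightarrow>
    AE x in m. AE y in m. p (\<Psi> r) x y \<le> C / V r * exp (- b * dist x y / r)"
proof -
  have "AE x in m. AE y in m. p (\<Psi> r) x y \<le> (C1 * C0 * exp c1) / V r * exp (- (c1 * c2) * dist x y / r)"
    if r: "0 < r" "ereal r < diam" for r
  proof -
    have t: "0 < \<Psi> r" using psi_pos r by simp
    have "C1 / measure m (ball x r) * exp (- c1 * \<Psi> r * scale_conj \<Psi> (c2 * (dist x y / \<Psi> r))) \<le>
        (C1 * C0 * exp c1) / V r * exp (- (c1 * c2) * dist x y / r)" for x y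
    proof -
      have "C1 / measure m (ball x r) \<le> C1 / (V r / C0)"
        using measure_ball_lower[OF r, of x] const_pos C0 V_pos[OF r(1)] measure_ball_pos[OF r(1), of x]
        by (intro divide_left_mono) auto
      also have "\<dots> = C1 * C0 / V r" by simp
      finally have 1: "C1 / measure m (ball x r) \<le> C1 * C0 / V r" .
      \<comment> \<open>Testing the supremum with the radius \<open>r\<close> itself weakens the
        sub-Gaussian decay to an exponential in \<open>dist x y / r\<close>, at the price of the
        factor \<open>exp c1\<close>.\<close>
      have "c2 * (dist x y / \<Psi> r) / r - 1 / \<Psi> r \<le> scale_conj \<Psi> (c2 * (dist x y / \<Psi> r))"
        by (rule conj_ge[OF r(1)])
      then have "c1 * \<Psi> r * (c2 * (dist x y / \<Psi> r) / r - 1 / \<Psi> r) \<le>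
          c1 * \<Psi> r * scale_conj \<Psi> (c2 * (dist x y / \<Psi> r))"
        using const_pos t by (intro mult_left_mono) auto
      moreover have "c1 * \<Psi> r * (c2 * (dist x y / \<Psi> r) / r - 1 / \<Psi> r) = (c1 * c2) * dist x y / r - c1"
        using t by (simp add: field_simps)
      ultimately have "exp (- c1 * \<Psi> r * scale_conj \<Psi> (c2 * (dist x y / \<Psi> r))) \<le>
          exp (c1 + - (c1 * c2) * dist x y / r)" by simp
      then have 2: "exp (- c1 * \<Psi> r * scale_conj \<Psi> (c2 * (dist x y / \<Psi> r))) \<le>
          exp c1 * exp (- (c1 * c2) * dist x y / r)" by (simp only: exp_add)
      have "C1 / measure m (ball x r) * exp (- c1 * \<Psi> r * scale_conj \<Psi> (c2 * (dist x y / \<Psi> r)))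
          \<le> C1 * C0 / V r * (exp c1 * exp (- (c1 * c2) * dist x y / r))"
        using 1 2 const_pos C0 V_pos[OF r(1)] by (intro mult_mono) auto
      then show ?thesis by (simp add: mult.assoc)
    qed
    note le = this
    from hke[OF t] show ?thesis
    proof eventually_elim
      case (elim x)
      then show ?case
        by eventually_elim (use le[of x] r(1) in \<open>auto simp only: scale_inv_psi intro: order_trans\<close>)
    qed
  qed
  then show thesis using that[of "C1 * C0 * exp c1" "c1 * c2"] const_pos C0 by simp
qed

text \<open>The estimate involves the ball of radius \<open>rho\<close> with
  \<open>\<Psi> rho = n * \<Psi> r\<close>. Because of \<open>\<beta>1 > 1\<close> this radius is at
  most of order \<open>n * r\<close>, so the volume exceeds \<open>V r\<close> by no more than a
  power of \<open>n\<close>, which the exponential swallows.\<close>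

lemma lower_bound:
  assumes A: "0 < A"
  obtains c B where "0 < c" "0 < B" "\<And>n r. 1 \<le> n \<Longrightarrow> 0 < r \<Longrightarrow>
    AE x in m. AE y in m. dist x y \<le> A * (real n * r) \<longrightarrow>
      c / V r * exp (- B * real n) \<le> p (real n * \<Psi> r) x y"
proof -
  obtain B where B: "0 < B" "\<And>n r d. 1 \<le> n \<Longrightarrow> 0 < r \<Longrightarrow> d \<le> A * (real n * r) \<Longrightarrow>
    real n * \<Psi> r * scale_conj \<Psi> (C5 * (d / (real n * \<Psi> r))) \<le> B * real n"
    using conj_le[OF A] by blast
  obtain Cv where Cv: "0 < Cv" "\<And>(x::'a) r. 0 < r \<Longrightarrow> measure m (ball x r) \<le> Cv * V r"
    using measure_ball_upper by blast
  obtain a where a: "\<And>l r. 1 \<le> l \<Longrightarrow> 0 < r \<Longrightarrow> V (l * r) \<le> (2 * l) ^ a * V r"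
    using doubling_fun_growth[OF V_doubling] by blast
  obtain L \<beta>1 \<beta>2 where L: "1 < L" "1 < \<beta>1"
    "\<And>r R. 0 < r \<Longrightarrow> r \<le> R \<Longrightarrow> (R / r) powr \<beta>1 / L \<le> \<Psi> R / \<Psi> r"
    using scale_bounds by metis
  define c where "c = c3 / (Cv * (2 * L) ^ a)"
  have c: "0 < c" using const_pos Cv L by (simp add: c_def)
  have "AE x in m. AE y in m. dist x y \<le> A * (real n * r) \<longrightarrow>
      c / V r * exp (- (C4 * B + a) * real n) \<le> p (real n * \<Psi> r) x y"
    if n: "1 \<le> n" and r: "0 < r" for n :: nat and r
  proof -
    define t where "t = real n * \<Psi> r"
    have t: "0 < t" using n psi_pos[OF r] by (simp add: t_def)
    obtain rho where rho: "0 < rho" "\<Psi> rho = t" using psi_surj[OF t] by blast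
    have rho_le: "rho \<le> L * real n * r"
    proof (rule ccontr)
      assume "\<not> rho \<le> L * real n * r"
      then have less: "\<Psi> (L * real n * r) < t" using psi_strict_mono[of "L * real n * r" rho] rho r L by auto
      have Ln: "1 \<le> L * real n" using L n mult_mono[of 1 L 1 "real n"] by simp
      have "L * real n \<le> (L * real n) powr \<beta>1" using Ln L powr_mono[of 1 \<beta>1 "L * real n"] by simp
      then have "real n \<le> (L * real n) powr \<beta>1 / L" using L by (simp add: field_simps)
      also have "\<dots> \<le> \<Psi> (L * real n * r) / \<Psi> r"
        using L(3)[of r "L * real n * r"] r mult_right_mono[OF Ln, of r] by simp
      finally have "t \<le> \<Psi> (L * real n * r)" using psi_pos[OF r] by (simp add: t_def pos_le_divide_eq)
      then show False using less by simp
    qed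
    have Vb: "measure m (ball x rho) \<le> (Cv * (2 * L) ^ a) * V r * exp (a * real n)" for x
    proof -
      have "measure m (ball x rho) \<le> Cv * V rho" using Cv rho by simp
      also have "V rho \<le> V (L * real n * r)" using rho rho_le by (intro V_mono) auto
      also have "\<dots> \<le> (2 * (L * real n)) ^ a * V r"
        using L n r mult_mono[of 1 L 1 "real n"] by (intro a) auto
      also have "(2 * (L * real n)) ^ a = (2 * L) ^ a * real n ^ a" by (simp add: power_mult_distrib)
      also have "real n ^ a \<le> exp (real n) ^ a"
      proof (rule power_mono)
        show "real n \<le> exp (real n)" using exp_ge_add_one_self[of "real n"] by linarith
      qed simp
      also have "\<dots> = exp (a * real n)" by (simp add: exp_of_nat_mult)
      finally show ?thesis using Cv L V_pos[OF r] by (simp add: mult_ac)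
    qed
    have "c / V r * exp (- (C4 * B + a) * real n) \<le>
      c3 / measure m (ball x rho) * exp (- C4 * t * scale_conj \<Psi> (C5 * (dist x y / t)))"
      if "dist x y \<le> A * (real n * r)" for x y
    proof -
      have "c / V r * exp (- (real a * real n)) = c3 / ((Cv * (2 * L) ^ a) * V r * exp (a * real n))"
        by (simp add: c_def exp_minus field_simps)
      also have "\<dots> \<le> c3 / measure m (ball x rho)"
        using Vb[of x] measure_ball_pos[OF rho(1), of x] const_pos Cv L V_pos[OF r]
        by (intro divide_left_mono) auto
      finally have 1: "c / V r * exp (- (real a * real n)) \<le> c3 / measure m (ball x rho)" .
      have "C4 * (t * scale_conj \<Psi> (C5 * (dist x y / t))) \<le> C4 * (B * real n)"
        using B(2)[OF n r that] const_pos unfolding t_def by (intro mult_left_mono) auto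
      then have 2: "exp (- (C4 * B * real n)) \<le> exp (- C4 * t * scale_conj \<Psi> (C5 * (dist x y / t)))"
        by (simp add: mult.assoc)
      have "exp (- (C4 * B + a) * real n) = exp (- (real a * real n)) * exp (- (C4 * B * real n))"
        by (simp add: exp_add[symmetric] algebra_simps)
      then have "c / V r * exp (- (C4 * B + a) * real n) =
          c / V r * exp (- (real a * real n)) * exp (- (C4 * B * real n))" by simp
      also have "\<dots> \<le> c3 / measure m (ball x rho) * exp (- C4 * t * scale_conj \<Psi> (C5 * (dist x y / t)))"
        using 1 2 const_pos measure_ball_pos[OF rho(1), of x] by (intro mult_mono) auto
      finally show ?thesis .
    qed
    note le = this
    have inv: "scale_inv \<Psi> t = rho" using scale_inv_psi[of rho] rho by simp
    from hke[OF t] show ?thesis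
      unfolding t_def[symmetric] inv
    proof eventually_elim
      case (elim x)
      then show ?case
        by eventually_elim (use le[of x] in \<open>auto intro: order_trans simp del: times_divide_eq_left times_divide_eq_right mult_minus_left minus_add_distrib\<close>)
    qed
  qed
  then show thesis using that[of c "C4 * B + a"] c B const_pos by (auto simp: add_pos_nonneg)
qed

text \<open>The space is cut into the annuli \<open>k \<le> dist x y / r < k + 1\<close>. Half of
  the rate \<open>b\<close> absorbs the polynomial volume growth; the other half is left as the
  ratio \<open>q\<close> of a geometric series.\<close>

lemma exp_dist_integral:
  assumes b: "0 < b"
  obtains M where "0 < M" "\<And>(x::'a) r. 0 < r \<Longrightarrow>
    (\<integral>\<^sup>+ y. ennreal (exp (- b * dist x y / r)) \<partial>m) \<le> ennreal (M * V r)"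
proof -
  obtain Cv where Cv: "0 < Cv" "\<And>(x::'a) r. 0 < r \<Longrightarrow> emeasure m (ball x r) \<le> ennreal (Cv * V r)"
    using ball_upper by blast
  obtain a where a: "\<And>l r. 1 \<le> l \<Longrightarrow> 0 < r \<Longrightarrow> V (l * r) \<le> (2 * l) ^ a * V r"
    using doubling_fun_growth[OF V_doubling] by blast
  obtain Q where Q: "0 < Q" "\<And>x. 0 \<le> x \<Longrightarrow> x ^ a \<le> Q * exp (b / 4 * x)"
    using poly_exp_bound[of "b / 4" a] b by auto
  define G where "G = Cv * Q * exp (b / 2)"
  define q where "q = exp (- b / 2)"
  have q: "0 < q" "q < 1" using b by (auto simp: q_def)
  have G: "0 < G" using Cv Q by (simp add: G_def)
  have "(\<integral>\<^sup>+ y. ennreal (exp (- b * dist x y / r)) \<partial>m) \<le> ennreal (G / (1 - q) * V r)"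
    if r: "0 < r" for x :: 'a and r
  proof -
    let ?g = "\<lambda>k y. ennreal (exp (- b * real k)) * indicator (ball x (real (Suc k) * r)) y"
    have pw: "ennreal (exp (- b * dist x y / r)) \<le> (\<Sum>k. ?g k y)" for y
    proof -
      define k where "k = nat \<lfloor>dist x y / r\<rfloor>"
      have "0 \<le> dist x y / r" using r by simp
      then have k: "real k \<le> dist x y / r" "dist x y / r < real (Suc k)"
        unfolding k_def by linarith+
      have "dist x y < real (Suc k) * r" using k(2) r by (simp only: pos_divide_less_eq)
      moreover have "exp (- b * dist x y / r) \<le> exp (- b * real k)"
        using mult_left_mono[OF k(1), of b] b by simp
      ultimately have "ennreal (exp (- b * dist x y / r)) \<le> ?g k y" by (auto simp: ennreal_leI)
      also have "\<dots> \<le> (\<Sum>k. ?g k y)"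
      proof -
        have "f k \<le> suminf f" for f :: "nat \<Rightarrow> ennreal"
          using sum_le_suminf[of f "{k}", OF summableI] by simp
        then show ?thesis .
      qed
      finally show ?thesis .
    qed
    have "(\<integral>\<^sup>+ y. ennreal (exp (- b * dist x y / r)) \<partial>m) \<le> (\<integral>\<^sup>+ y. (\<Sum>k. ?g k y) \<partial>m)"
      using pw by (rule nn_integral_mono)
    also have "\<dots> = (\<Sum>k. \<integral>\<^sup>+ y. ?g k y \<partial>m)" by (rule nn_integral_suminf) simp
    also have "\<dots> = (\<Sum>k. ennreal (exp (- b * real k)) * emeasure m (ball x (real (Suc k) * r)))"
      by (simp add: nn_integral_cmult_indicator del: of_nat_Suc)
    also have "\<dots> \<le> (\<Sum>k. ennreal (G * V r * q ^ k))"
    proof (rule suminf_le)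
      fix k
      have "emeasure m (ball x (real (Suc k) * r)) \<le> ennreal (Cv * V (real (Suc k) * r))"
        using r by (intro Cv) simp
      also have "\<dots> \<le> ennreal (Cv * (Q * exp (b / 4 * (2 * real (Suc k))) * V r))"
      proof (rule ennreal_leI, rule mult_left_mono)
        have "V (real (Suc k) * r) \<le> (2 * real (Suc k)) ^ a * V r" using r by (intro a) auto
        also have "\<dots> \<le> Q * exp (b / 4 * (2 * real (Suc k))) * V r"
          using Q(2)[of "2 * real (Suc k)"] V_pos[OF r] by (intro mult_right_mono) auto
        finally show "V (real (Suc k) * r) \<le> Q * exp (b / 4 * (2 * real (Suc k))) * V r" .
      qed (use Cv in simp)
      finally have "ennreal (exp (- b * real k)) * emeasure m (ball x (real (Suc k) * r)) \<le>
          ennreal (exp (- b * real k)) * ennreal (Cv * (Q * exp (b / 4 * (2 * real (Suc k))) * V r))"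
        by (rule mult_left_mono) simp
      also have "\<dots> = ennreal (G * V r * q ^ k)"
      proof -
        have "exp (- b * real k) * exp (b / 4 * (2 * real (Suc k))) = exp (b / 2) * q ^ k"
          unfolding q_def exp_of_nat_mult[symmetric] exp_add[symmetric] by (simp add: field_simps)
        note e = this
        have "exp (- b * real k) * (Cv * (Q * exp (b / 4 * (2 * real (Suc k))) * V r)) =
            Cv * Q * V r * (exp (- b * real k) * exp (b / 4 * (2 * real (Suc k))))" by (simp only: mult_ac)
        also have "\<dots> = Cv * Q * V r * (exp (b / 2) * q ^ k)" by (simp only: e)
        also have "\<dots> = G * V r * q ^ k" by (simp only: G_def mult_ac)
        finally show ?thesis by (simp only: ennreal_mult'[symmetric] exp_ge_zero)
      qed
      finally show "ennreal (exp (- b * real k)) * emeasure m (ball x (real (Suc k) * r)) \<le>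
          ennreal (G * V r * q ^ k)" .
    qed (auto intro: summableI)
    also have "\<dots> = ennreal (\<Sum>k. G * V r * q ^ k)"
      using q G V_pos[OF r] by (intro suminf_ennreal2 summable_mult summable_geometric) auto
    also have "(\<Sum>k. G * V r * q ^ k) = G / (1 - q) * V r"
      using q by (simp add: suminf_mult suminf_geometric summable_geometric)
    finally show ?thesis .
  qed
  then show thesis using that[of "G / (1 - q)"] G q by simp
qed

text \<open>Half of the exponential rate yields the decay in \<open>r\<close>, the other half keeps
  the integral of order \<open>V rho\<close>, which cancels the normalization of the kernel.\<close>

lemma tail_bound:
  obtains C b where "0 < C" "0 < b" "\<And>rho r. 0 < rho \<Longrightarrow> ereal rho < diam \<Longrightarrow>
    AE x in m. mass (\<Psi> rho) x {y. r \<le> dist x y} \<le> ennreal (C * exp (- b * r / rho))"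
proof -
  obtain C b where ub: "0 < C" "0 < b" "\<And>r. 0 < r \<Longrightarrow> ereal r < diam \<Longrightarrow>
    AE x in m. AE y in m. p (\<Psi> r) x y \<le> C / V r * exp (- b * dist x y / r)"
    using upper_bound by blast
  obtain M where M: "0 < M" "\<And>(x::'a) r. 0 < r \<Longrightarrow>
    (\<integral>\<^sup>+ y. ennreal (exp (- (b / 2) * dist x y / r)) \<partial>m) \<le> ennreal (M * V r)"
    using exp_dist_integral[of "b / 2"] ub(2) by auto
  have "AE x in m. mass (\<Psi> rho) x {y. r \<le> dist x y}
      \<le> ennreal (C * M * exp (- (b / 2) * r / rho))"
    if rho: "0 < rho" "ereal rho < diam" for rho r
    using ub(3)[OF rho]
  proof eventually_elim
    case (elim x)
    let ?c = "C / V rho * exp (- (b / 2) * r / rho)"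
    have c: "0 \<le> ?c" using ub V_pos[OF rho(1)] by simp
    have "AE y in m. ennreal (p (\<Psi> rho) x y) * indicator {y. r \<le> dist x y} y \<le>
        ennreal ?c * ennreal (exp (- (b / 2) * dist x y / rho))"
      using elim
    proof eventually_elim
      case (elim y)
      show ?case
      proof (cases "r \<le> dist x y")
        case True
        have "exp (- b * dist x y / rho) = exp (- (b / 2) * dist x y / rho) * exp (- (b / 2) * dist x y / rho)"
          by (simp add: exp_add[symmetric])
        also have "\<dots> \<le> exp (- (b / 2) * r / rho) * exp (- (b / 2) * dist x y / rho)"
          using True ub rho by (intro mult_right_mono) (auto simp: divide_right_mono)
        finally have "C / V rho * exp (- b * dist x y / rho) \<le>
            C / V rho * (exp (- (b / 2) * r / rho) * exp (- (b / 2) * dist x y / rho))"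
          using ub V_pos[OF rho(1)] by (intro mult_left_mono) auto
        with elim have "p (\<Psi> rho) x y \<le> ?c * exp (- (b / 2) * dist x y / rho)" by (simp add: mult.assoc)
        then show ?thesis using True c by (simp add: ennreal_mult[symmetric] ennreal_leI)
      qed simp
    qed
    then have "mass (\<Psi> rho) x {y. r \<le> dist x y} \<le>
        (\<integral>\<^sup>+ y. ennreal ?c * ennreal (exp (- (b / 2) * dist x y / rho)) \<partial>m)"
      by (rule nn_integral_mono_AE)
    also have "\<dots> = ennreal ?c * (\<integral>\<^sup>+ y. ennreal (exp (- (b / 2) * dist x y / rho)) \<partial>m)"
      by (rule nn_integral_cmult) simp
    also have "\<dots> \<le> ennreal ?c * ennreal (M * V rho)" by (rule mult_left_mono[OF M(2)[OF rho(1)]]) simp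
    also have "\<dots> = ennreal (C * M * exp (- (b / 2) * r / rho))"
      using c M V_pos[OF rho(1)] by (simp add: ennreal_mult[symmetric] mult_ac)
    finally show ?case .
  qed
  then show thesis using that[of "C * M" "b / 2"] ub M by simp
qed

text \<open>On \<open>ball x rho\<close> the kernel is at least a constant divided by the measure of
  that same ball, which cancels on integration. Hence radii beyond the diameter are covered
  too.\<close>

lemma local_mass:
  obtains c where "0 < c" "c \<le> 1" "\<And>rho. 0 < rho \<Longrightarrow>
    AE x in m. ennreal c \<le> mass (\<Psi> rho) x (ball x rho)"
proof -
  obtain B where B: "0 < B" "\<And>n r d. 1 \<le> n \<Longrightarrow> 0 < r \<Longrightarrow> d \<le> 1 * (real n * r) \<Longrightarrow>
    real n * \<Psi> r * scale_conj \<Psi> (C5 * (d / (real n * \<Psi> r))) \<le> B * real n"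
    using conj_le[of 1] by auto
  define c where "c = c3 * exp (- C4 * B)"
  have c: "0 < c" using const_pos by (simp add: c_def)
  have "AE x in m. ennreal (min c 1) \<le> mass (\<Psi> rho) x (ball x rho)"
    if rho: "0 < rho" for rho
    using hke[OF psi_pos[OF rho]]
  proof eventually_elim
    case (elim x)
    have "AE y in m. ennreal (c / measure m (ball x rho)) * indicator (ball x rho) y \<le>
        ennreal (p (\<Psi> rho) x y) * indicator (ball x rho) y"
      using elim
    proof eventually_elim
      case (elim y)
      show ?case
      proof (cases "y \<in> ball x rho")
        case True
        have "\<Psi> rho * scale_conj \<Psi> (C5 * (dist x y / \<Psi> rho)) \<le> B"
          using B(2)[of 1 rho "dist x y"] rho True by simp
        then have "exp (- C4 * B) \<le> exp (- C4 * \<Psi> rho * scale_conj \<Psi> (C5 * (dist x y / \<Psi> rho)))"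
          using const_pos by (simp add: mult.assoc)
        then have "c3 / measure m (ball x rho) * exp (- C4 * B) \<le>
            c3 / measure m (ball x rho) * exp (- C4 * \<Psi> rho * scale_conj \<Psi> (C5 * (dist x y / \<Psi> rho)))"
          using const_pos by (intro mult_left_mono) auto
        then have "c / measure m (ball x rho) \<le> p (\<Psi> rho) x y"
          using elim rho by (simp add: c_def scale_inv_psi)
        then show ?thesis using True by (simp add: ennreal_leI)
      qed simp
    qed
    then have "(\<integral>\<^sup>+ y. ennreal (c / measure m (ball x rho)) * indicator (ball x rho) y \<partial>m) \<le>
        mass (\<Psi> rho) x (ball x rho)"
      by (rule nn_integral_mono_AE)
    moreover have "(\<integral>\<^sup>+ y. ennreal (c / measure m (ball x rho)) * indicator (ball x rho) y \<partial>m) = ennreal c"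
      using measure_ball_pos[OF rho, of x] c
      by (simp add: nn_integral_cmult_indicator emeasure_ball ennreal_mult[symmetric])
    ultimately have "ennreal c \<le> mass (\<Psi> rho) x (ball x rho)"
      by simp
    then show ?case by (rule order_trans[rotated]) (simp add: ennreal_leI)
  qed
  then show thesis using that[of "min c 1"] c by simp
qed

end

section \<open>Chains\<close>

text \<open>For \<open>0 < r\<close> a step may stay in place, so the \<open>n\<close>-th set
  consists of the points at chain distance at most \<open>n\<close> from \<open>A\<close>.\<close>

fun chain_set :: "real \<Rightarrow> 'a::metric_space set \<Rightarrow> nat \<Rightarrow> 'a set" where
  "chain_set r A 0 = A"
| "chain_set r A (Suc n) = (\<Union>z\<in>chain_set r A n. ball z r)"

lemma chain_set_mono:
  assumes "0 < r" "k \<le> n"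
  shows "chain_set r A k \<subseteq> chain_set r A n"
  using assms(2)
proof (induction n rule: dec_induct)
  case (step n)
  have "chain_set r A n \<subseteq> chain_set r A (Suc n)" using assms(1) by auto
  then show ?case using step by blast
qed simp

lemma open_chain_set: "open A \<Longrightarrow> open (chain_set r A n)"
  by (induction n) auto

text \<open>The heat flow needs an open starting set, whereas the chains wanted start at a point;
  passing between the two costs one step.\<close>

lemma chain_set_ball: "chain_set r (ball x r) n = chain_set r {x} (Suc n)"
  by (induction n) auto

section \<open>Heat flow along chains\<close>

context hke_space
begin

text \<open>By the upper power bound on \<open>\<Psi>\<close>, a time at most
  \<open>\<delta> * \<Psi> r\<close> belongs to a radius \<open>rho \<le> \<eta> * r\<close>. At
  that time little heat travels as far as \<open>r / 2\<close>, and \<open>ball x rho\<close> lies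
  inside \<open>ball x (r / 2)\<close>.\<close>

lemma small_time_bounds:
  assumes \<epsilon>: "0 < \<epsilon>"
    and mass: "\<And>rho. 0 < rho \<Longrightarrow>
      AE x in m. ennreal c \<le> mass (\<Psi> rho) x (ball x rho)"
  obtains \<delta> where "0 < \<delta>"
    "\<And>r t. 0 < r \<Longrightarrow> ereal r < diam \<Longrightarrow> 0 < t \<Longrightarrow> t \<le> \<delta> * \<Psi> r \<Longrightarrow>
      AE x in m. mass t x {y. r / 2 \<le> dist x y} \<le> ennreal \<epsilon> \<and>
        ennreal c \<le> mass t x (ball x (r / 2))"
proof -
  obtain C b where tail: "0 < C" "0 < b" "\<And>rho r. 0 < rho \<Longrightarrow> ereal rho < diam \<Longrightarrow>
    AE x in m. mass (\<Psi> rho) x {y. r \<le> dist x y} \<le> ennreal (C * exp (- b * r / rho))"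
    using tail_bound by blast
  obtain L \<beta>1 \<beta>2 where L: "1 < L" "\<And>r R. 0 < r \<Longrightarrow> r \<le> R \<Longrightarrow> \<Psi> R / \<Psi> r \<le> L * (R / r) powr \<beta>2"
    using scale_bounds by metis
  \<comment> \<open>The second entry gives \<open>C \<le> \<epsilon> * X\<close> for the exponent
    \<open>X = b * (r / 2) / rho\<close> of the tail, which suffices since
    \<open>X \<le> exp X\<close>.\<close>
  define \<eta> where "\<eta> = min (1 / 2) (b * \<epsilon> / (2 * C))"
  have \<eta>: "0 < \<eta>" "\<eta> \<le> 1 / 2" "\<eta> \<le> b * \<epsilon> / (2 * C)" using tail \<epsilon> by (auto simp: \<eta>_def)
  define \<delta> where "\<delta> = 1 / (L * (1 / \<eta>) powr \<beta>2)"
  have "0 < \<delta>" using L \<eta> by (simp add: \<delta>_def)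
  moreover have "AE x in m. mass t x {y. r / 2 \<le> dist x y} \<le> ennreal \<epsilon> \<and>
        ennreal c \<le> mass t x (ball x (r / 2))"
    if r: "0 < r" "ereal r < diam" and t: "0 < t" "t \<le> \<delta> * \<Psi> r" for r t
  proof -
    obtain rho where rho: "0 < rho" "\<Psi> rho = t" using psi_surj[OF t(1)] by blast
    have "rho \<le> \<eta> * r"
    proof (rule ccontr)
      assume "\<not> rho \<le> \<eta> * r"
      then have less: "\<Psi> (\<eta> * r) < t" using psi_strict_mono[of "\<eta> * r" rho] rho r \<eta> by simp
      have "\<Psi> r / \<Psi> (\<eta> * r) \<le> L * (r / (\<eta> * r)) powr \<beta>2" using r \<eta> by (intro L) auto
      also have "\<dots> = 1 / \<delta>" using r by (simp add: \<delta>_def)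
      finally have "\<delta> * \<Psi> r \<le> \<Psi> (\<eta> * r)"
        using psi_pos[of "\<eta> * r"] \<open>0 < \<delta>\<close> r \<eta> by (simp add: field_simps)
      then show False using less t by simp
    qed
    have rho_r: "rho \<le> r / 2" using \<open>rho \<le> \<eta> * r\<close> mult_right_mono[OF \<eta>(2), of r] r by linarith
    have D: "ereal rho < diam"
    proof -
      have "ereal rho \<le> ereal r" using rho_r r by simp
      then show ?thesis using r(2) by (rule le_less_trans)
    qed
    have small: "C * exp (- b * (r / 2) / rho) \<le> \<epsilon>"
    proof -
      define X where "X = b * (r / 2) / rho"
      have X: "0 < X" using tail r rho by (simp add: X_def)
      have "rho * (2 * C) \<le> b * \<epsilon> * r"
      proof -
        have "rho \<le> b * \<epsilon> / (2 * C) * r"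
          using \<open>rho \<le> \<eta> * r\<close> mult_right_mono[OF \<eta>(3), of r] r by linarith
        then show ?thesis using tail by (simp add: field_simps)
      qed
      then have CX: "C \<le> \<epsilon> * X" using rho by (simp add: X_def field_simps)
      have "X \<le> exp X" using exp_ge_add_one_self[of X] by linarith
      then have "\<epsilon> * X \<le> \<epsilon> * exp X" using \<epsilon> by (intro mult_left_mono) auto
      then have "C \<le> \<epsilon> * exp X" using CX by linarith
      then have "C * exp (- X) \<le> \<epsilon>" by (simp add: exp_minus field_simps)
      then show ?thesis by (simp add: X_def)
    qed
    show ?thesis
      using tail(3)[OF rho(1) D, of "r / 2"] mass[OF rho(1)] unfolding rho(2)
    proof eventually_elim
      case (elim x)
      have "mass t x (ball x rho) \<le>
          mass t x (ball x (r / 2))"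
        using rho_r by (intro nn_integral_mono mult_left_mono) (auto simp: indicator_def)
      then show ?case
        using elim order_trans[OF elim(1) ennreal_leI[OF small]] by auto
    qed
  qed
  ultimately show thesis using that by blast
qed

text \<open>Letting the number of steps tend to infinity makes long jumps negligible; this replaces the
  continuity of sample paths.\<close>

lemma no_long_jumps:
  assumes r: "0 < r" and T: "0 < T" and \<epsilon>: "0 < \<epsilon>"
  obtains M0 where "\<And>M. M0 \<le> real M \<Longrightarrow> 0 < M \<Longrightarrow>
    AE x in m. mass (T / M) x {y. r \<le> dist x y} \<le> ennreal (\<epsilon> / M)"
proof -
  obtain C b where tail: "0 < C" "0 < b" "\<And>rho r. 0 < rho \<Longrightarrow> ereal rho < diam \<Longrightarrow>
    AE x in m. mass (\<Psi> rho) x {y. r \<le> dist x y} \<le> ennreal (C * exp (- b * r / rho))"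
    using tail_bound by blast
  obtain L \<beta>1 \<beta>2 where L: "1 < L" "\<And>r R. 0 < r \<Longrightarrow> r \<le> R \<Longrightarrow> \<Psi> R / \<Psi> r \<le> L * (R / r) powr \<beta>2"
    using scale_bounds by metis
  define k where "k = nat \<lceil>\<bar>\<beta>2\<bar>\<rceil>"
  have k: "\<beta>2 \<le> real k" unfolding k_def by linarith
  \<comment> \<open>With \<open>x = 1 / rho\<close> the number \<open>M\<close> of steps is at most
    of order \<open>x ^ k\<close>. The additional power leaves a factor \<open>rho\<close>, which
    \<open>rho0\<close> makes small against \<open>\<epsilon>\<close>.\<close>
  obtain Q where Q: "0 < Q" "\<And>x. 0 \<le> x \<Longrightarrow> x ^ (Suc k) \<le> Q * exp ((b * r) * x)"
    using poly_exp_bound[of "b * r" "Suc k"] tail(2) r by auto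
  obtain z where z: "0 < ereal z" "ereal z < diam"
    using ereal_dense2[OF diam_pos] by auto
  define G where "G = C * Q * T * L / \<Psi> 1"
  have G: "0 < G" using tail Q T L psi_pos[of 1] by (simp add: G_def)
  define rho0 where "rho0 = min (min z 1) (\<epsilon> / G)"
  have rho0: "0 < rho0" "rho0 \<le> z" "rho0 \<le> 1" "rho0 \<le> \<epsilon> / G" using z G \<epsilon> by (auto simp: rho0_def)
  have "AE x in m. mass (T / M) x {y. r \<le> dist x y} \<le> ennreal (\<epsilon> / M)"
    if M: "T / \<Psi> rho0 \<le> real M" "0 < M" for M
  proof -
    have "0 < T / M" using T M by simp
    then obtain rho where rho: "0 < rho" "\<Psi> rho = T / M" using psi_surj by blast
    have "\<Psi> rho \<le> \<Psi> rho0" using M psi_pos[OF rho0(1)] unfolding rho(2) by (simp add: field_simps)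
    then have rho_le: "rho \<le> rho0" using psi_strict_mono[of rho0 rho] rho0 by linarith
    have D: "ereal rho < diam"
    proof -
      have "ereal rho \<le> ereal z" using rho_le rho0 by simp
      then show ?thesis using z(2) by (rule le_less_trans)
    qed
    have "C * exp (- b * r / rho) \<le> \<epsilon> / M"
    proof -
      define x where "x = 1 / rho"
      have x: "1 \<le> x" using rho rho_le rho0 by (simp add: x_def)
      have "\<Psi> 1 / \<Psi> rho \<le> L * x powr \<beta>2"
        using L(2)[of rho 1] rho rho_le rho0 by (simp add: x_def)
      also have "x powr \<beta>2 \<le> x ^ k" using x k powr_mono[of \<beta>2 "real k" x] by (simp add: powr_realpow)
      finally have "\<Psi> 1 / (T / M) \<le> L * x ^ k" using L rho(2) by simp
      then have MT: "real M \<le> L * x ^ k * T / \<Psi> 1"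
        using T psi_pos[of 1] by (simp add: field_simps)
      have "x ^ k * x \<le> Q * exp (b * r * x)" using Q(2)[of x] x by (simp add: mult.commute)
      then have "x ^ k * exp (- (b * r * x)) \<le> Q * rho"
        using rho by (simp add: x_def exp_minus field_simps)
      then have "C * exp (- (b * r * x)) * real M \<le> C * (L * T / \<Psi> 1) * (Q * rho)"
      proof -
        assume a: "x ^ k * exp (- (b * r * x)) \<le> Q * rho"
        have "C * exp (- (b * r * x)) * real M \<le> C * exp (- (b * r * x)) * (L * x ^ k * T / \<Psi> 1)"
          using MT tail by (intro mult_left_mono) auto
        also have "\<dots> = C * (L * T / \<Psi> 1) * (x ^ k * exp (- (b * r * x)))" by simp
        also have "\<dots> \<le> C * (L * T / \<Psi> 1) * (Q * rho)"
          using a tail L T psi_pos[of 1] by (intro mult_left_mono) auto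
        finally show ?thesis .
      qed
      also have "\<dots> = G * rho" by (simp add: G_def)
      also have "\<dots> \<le> G * (\<epsilon> / G)" using G rho_le rho0 by (intro mult_left_mono) auto
      also have "\<dots> = \<epsilon>" using G by simp
      finally show ?thesis using M by (simp add: x_def field_simps)
    qed
    then show ?thesis
      using tail(3)[OF rho(1) D, of r] unfolding rho(2)
      by (auto elim!: eventually_mono intro: order_trans ennreal_leI)
  qed
  then show thesis using that by blast
qed

lemma sets_open: "open A \<Longrightarrow> (A :: 'a set) \<in> sets m"
  by (simp add: sets_m)

lemma K_indicator_le_one:
  assumes "0 < t" shows "AE x in m. K t (indicator A) x \<le> 1"
proof -
  have "K t (indicator A) x \<le> K t (\<lambda>_. 1) x" for x
    by (rule K_mono) (simp add: indicator_def)
  then show ?thesis using K_one_le[OF assms] by (auto elim!: eventually_mono intro: order_trans)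
qed

text \<open>The time averages of the semigroup applied to the indicator of a neighbourhood of
  the \<open>3j\<close>-th chain set are almost excessive, bounded below on that set and small off the next one.
  Scaled by \<open>2\<^sup>-\<^sup>j\<close> and glued together by taking minima they form a single almost
  excessive function that decays exponentially in the chain distance. Restricting the minimum at
  a point \<open>y\<close> to the \<open>j\<close> with \<open>y\<close> outside the \<open>(3j-2)\<close>-th chain set makes it large on \<open>A\<close>, and the
  minimizer at a point stays admissible at all points within distance \<open>r\<close>.\<close>

lemma chain_barrier:
  fixes A :: "'a set"
  assumes r: "0 < r" and A: "open A" and s: "0 < s" and I: "0 < I"
    and c: "0 < c" "c \<le> 1" and \<kappa>: "0 \<le> \<kappa>"
    and near: "\<And>i. 1 \<le> i \<Longrightarrow> i \<le> I \<Longrightarrow>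
      AE x in m. mass (real i * s) x {y. r / 2 \<le> dist x y} \<le> ennreal (c / 8) \<and>
        ennreal c \<le> mass (real i * s) x (ball x (r / 2))"
    and far: "AE x in m. mass s x {y. r \<le> dist x y} \<le> ennreal \<kappa>"
    and M: "0 < M"
  shows "AE y in m. y \<notin> chain_set r A (3 * J + 1) \<longrightarrow>
    ennreal c * K (real M * s) (indicator A) y \<le>
      ennreal ((1 + 8 / (c * I)) ^ M * (c / 4 * (1 / 2) ^ J + real M * (2 * \<kappa>)))"
proof -
  define U where "U n = chain_set r A n" for n
  \<comment> \<open>Half a step of room on either side: the ball of radius \<open>r / 2\<close>
    around a point of \<open>U (3 * j)\<close> lies in \<open>N j\<close>, and points outside
    \<open>U (3 * j + 1)\<close> keep at least the distance \<open>r / 2\<close> from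
    \<open>N j\<close>.\<close>
  define N where "N j = (\<Union>z\<in>U (3 * j). ball z (r / 2))" for j
  define \<epsilon> where "\<epsilon> = c / 8"
  \<comment> \<open>One time step shifts the window of the average \<open>w j\<close> and adds at
    most \<open>1 / I\<close>. Relative to the constant \<open>\<epsilon> = c / 8\<close> contained
    in \<open>a j\<close> this is \<open>8 / (c * I)\<close>.\<close>
  define q where "q = 1 + 8 / (c * I)"
  define w where "w j y = ennreal (1 / I) * (\<Sum>i\<in>{1..I}. K (real i * s) (indicator (N j)) y)" for j y
  define a where "a j y = ennreal ((1 / 2) ^ j) * (w j y + ennreal \<epsilon>)" for j y
  \<comment> \<open>The index 0 is always admissible, so the minimum \<open>W\<close> is finite
    almost everywhere, and on \<open>A\<close> it is the only admissible index.\<close>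
  define adm where "adm j y \<longleftrightarrow> j \<le> J \<and> (j = 0 \<or> y \<notin> U (3 * j - 2))" for j y
  define W where "W y = (INF j\<in>{..J}. if adm j y then a j y else \<infinity>)" for y
  have U_mono: "k \<le> n \<Longrightarrow> U k \<subseteq> U n" for k n using chain_set_mono[OF r] by (simp add: U_def)
  have U_step: "y \<in> U n \<Longrightarrow> dist y z < r \<Longrightarrow> z \<in> U (Suc n)" for y z n by (auto simp: U_def)
  have \<epsilon>: "0 < \<epsilon>" "\<epsilon> \<le> 1" using c by (auto simp: \<epsilon>_def)
  have q: "1 \<le> q" using c I by (simp add: q_def)
  have [measurable]: "U n \<in> sets m" for n unfolding U_def using A by (intro sets_open open_chain_set)
  have [measurable]: "N j \<in> sets m" for j unfolding N_def by (intro sets_open) auto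
  have step_pos: "1 \<le> i \<Longrightarrow> 0 < real i * s" for i using s by simp
  have w_meas [measurable]: "w j \<in> borel_measurable m" for j
    unfolding w_def using step_pos by measurable
  have a_meas [measurable]: "a j \<in> borel_measurable m" for j unfolding a_def by measurable
  have [measurable]: "Measurable.pred m (adm j)" for j
    unfolding adm_def by measurable
  have W_meas [measurable]: "W \<in> borel_measurable m" unfolding W_def by measurable
  have sumI: "ennreal (1 / I) * (\<Sum>i\<in>{1..I}. ennreal b) = ennreal b" if "0 \<le> b" for b
  proof -
    have "(\<Sum>i\<in>{1..I}. ennreal b) = ennreal (real I * b)"
      using that by (simp add: sum_ennreal ennreal_mult ennreal_of_nat_eq_real_of_nat)
    then show ?thesis using that I by (simp add: ennreal_mult[symmetric])
  qed
  have w_high: "AE y in m. \<forall>j. y \<in> U (3 * j) \<longrightarrow> ennreal c \<le> w j y"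
  proof -
    have "AE y in m. \<forall>i\<in>{1..I}. ennreal c \<le> mass (real i * s) y (ball y (r / 2))"
      using near by (intro AE_finite_allI) (auto elim!: eventually_mono)
    then show ?thesis
    proof eventually_elim
      case (elim y)
      show ?case
      proof (intro allI impI)
        fix j assume "y \<in> U (3 * j)"
        then have sub: "ball y (r / 2) \<subseteq> N j" unfolding N_def by blast
        have "ennreal c \<le> K (real i * s) (indicator (N j)) y" if "i \<in> {1..I}" for i
        proof -
          have "ennreal c \<le> mass (real i * s) y (ball y (r / 2))"
            using elim that by blast
          also have "\<dots> \<le> K (real i * s) (indicator (N j)) y"
            unfolding K_def using sub by (intro nn_integral_mono mult_left_mono) (auto simp: indicator_def)
          finally show ?thesis .
        qed
        then have "ennreal (1 / I) * (\<Sum>i\<in>{1..I}. ennreal c) \<le> w j y"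
          unfolding w_def by (intro mult_left_mono sum_mono) auto
        then show "ennreal c \<le> w j y" using c sumI[of c] by simp
      qed
    qed
  qed
  have w_low: "AE y in m. \<forall>j. y \<notin> U (3 * j + 1) \<longrightarrow> w j y \<le> ennreal \<epsilon>"
  proof -
    have "AE y in m. \<forall>i\<in>{1..I}. mass (real i * s) y {z. r / 2 \<le> dist y z} \<le> ennreal \<epsilon>"
      using near unfolding \<epsilon>_def by (intro AE_finite_allI) (auto elim!: eventually_mono)
    then show ?thesis
    proof eventually_elim
      case (elim y)
      show ?case
      proof (intro allI impI)
        fix j assume y: "y \<notin> U (3 * j + 1)"
        have sub: "r / 2 \<le> dist y z" if zN: "z \<in> N j" for z
        proof (rule ccontr)
          assume n: "\<not> r / 2 \<le> dist y z"
          obtain v where v: "v \<in> U (3 * j)" "dist v z < r / 2" using zN by (auto simp: N_def)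
          have "dist v y < r" using v(2) n dist_triangle[of v y z] by (simp add: dist_commute)
          then show False using U_step[OF v(1)] y by simp
        qed
        have "K (real i * s) (indicator (N j)) y \<le> ennreal \<epsilon>" if "i \<in> {1..I}" for i
        proof -
          have "K (real i * s) (indicator (N j)) y \<le>
              mass (real i * s) y {z. r / 2 \<le> dist y z}"
            unfolding K_def using sub by (intro nn_integral_mono mult_left_mono) (auto simp: indicator_def)
          also have "\<dots> \<le> ennreal \<epsilon>" using elim that by blast
          finally show ?thesis .
        qed
        then have "w j y \<le> ennreal (1 / I) * (\<Sum>i\<in>{1..I}. ennreal \<epsilon>)"
          unfolding w_def by (intro mult_left_mono sum_mono) auto
        then show "w j y \<le> ennreal \<epsilon>" using \<epsilon> sumI[of \<epsilon>] by simp
      qed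
    qed
  qed
  have K_le_1: "AE y in m. \<forall>j i. 1 \<le> i \<longrightarrow> K (real i * s) (indicator (N j)) y \<le> 1"
  proof -
    have "AE y in m. 1 \<le> i \<longrightarrow> K (real i * s) (indicator (N j)) y \<le> 1" for i j
      using K_indicator_le_one[OF step_pos, of i "N j"] by (cases "1 \<le> i") auto
    then show ?thesis by (simp add: AE_all_countable)
  qed
  have w_le_1: "AE y in m. w 0 y \<le> 1"
    using K_le_1
  proof eventually_elim
    case (elim y)
    then have "w 0 y \<le> ennreal (1 / I) * (\<Sum>i\<in>{1..I}. ennreal 1)"
      unfolding w_def by (intro mult_left_mono sum_mono) auto
    then show ?case using sumI[of 1] by simp
  qed
  have a_exc: "AE y in m. \<forall>j. K s (a j) y \<le> ennreal q * a j y"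
  proof -
    have semi: "AE y in m. \<forall>j i. 1 \<le> i \<longrightarrow>
        K s (K (real i * s) (indicator (N j))) y = K (real (Suc i) * s) (indicator (N j)) y"
    proof -
      have "AE y in m. 1 \<le> i \<longrightarrow>
          K s (K (real i * s) (indicator (N j))) y = K (real (Suc i) * s) (indicator (N j)) y" for i j
      proof (cases "1 \<le> i")
        case True
        have "s + real i * s = real (Suc i) * s" by (simp add: algebra_simps)
        then show ?thesis using K_semigroup[OF _ s step_pos[OF True], of "indicator (N j)"] by simp
      qed simp
      then show ?thesis by (simp add: AE_all_countable)
    qed
    show ?thesis using semi K_le_1 K_one_le[OF s]
    proof eventually_elim
      case (elim y)
      show ?case
      proof
        fix j
        let ?f = "\<lambda>i. K (real i * s) (indicator (N j)) y"
        have "K s (w j) y = ennreal (1 / I) * (\<Sum>i\<in>{1..I}. K s (K (real i * s) (indicator (N j))) y)"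
          unfolding w_def using s step_pos by (subst K_cmult K_sum; measurable?)+
        also have "(\<Sum>i\<in>{1..I}. K s (K (real i * s) (indicator (N j))) y) = (\<Sum>i\<in>{1..I}. ?f (Suc i))"
          using elim(1) by (intro sum.cong) auto
        also have "\<dots> \<le> (\<Sum>i\<in>{1..I}. ?f i) + ?f (Suc I)"
        proof -
          have "(\<Sum>i\<in>{1..I}. ?f (Suc i)) = (\<Sum>i\<in>Suc ` {1..I}. ?f i)"
            by (subst sum.reindex) auto
          also have "\<dots> \<le> (\<Sum>i\<in>insert (Suc I) {1..I}. ?f i)"
            by (intro sum_mono2) (auto simp: image_iff)
          also have "\<dots> = (\<Sum>i\<in>{1..I}. ?f i) + ?f (Suc I)" by (simp add: add.commute)
          finally show ?thesis .
        qed
        also have "?f (Suc I) \<le> 1" using elim(2)[rule_format, of "Suc I" j] by simp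
        finally have Kw: "K s (w j) y \<le> w j y + ennreal (1 / I)"
          unfolding w_def by (simp add: distrib_left mult_left_mono)
        have "K s (a j) y = ennreal ((1 / 2) ^ j) * (K s (w j) y + ennreal \<epsilon> * K s (\<lambda>_. 1) y)"
        proof -
          have "K s (a j) y = ennreal ((1 / 2) ^ j) * K s (\<lambda>y. w j y + ennreal \<epsilon>) y"
            unfolding a_def using s by (intro K_cmult) measurable
          also have "K s (\<lambda>y. w j y + ennreal \<epsilon>) y = K s (w j) y + K s (\<lambda>_. ennreal \<epsilon>) y"
            using s by (intro K_add) measurable
          also have "K s (\<lambda>_. ennreal \<epsilon>) y = ennreal \<epsilon> * K s (\<lambda>_. 1) y"
            using K_cmult[of "\<lambda>_. 1" s "ennreal \<epsilon>" y] s by simp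
          finally show ?thesis .
        qed
        also have "\<dots> \<le> ennreal ((1 / 2) ^ j) * (w j y + ennreal (1 / I) + ennreal \<epsilon> * 1)"
          using Kw elim(3) by (intro mult_left_mono add_mono) auto
        also have "w j y + ennreal (1 / I) + ennreal \<epsilon> * 1 \<le> ennreal q * (w j y + ennreal \<epsilon>)"
        proof -
          have "q * \<epsilon> = \<epsilon> + 1 / I" using c by (simp add: q_def \<epsilon>_def field_simps)
          then have "ennreal q * ennreal \<epsilon> = ennreal \<epsilon> + ennreal (1 / I)"
            using q \<epsilon> by (simp add: ennreal_mult[symmetric] ennreal_plus[symmetric] del: ennreal_plus)
          moreover have "w j y \<le> ennreal q * w j y"
            using mult_right_mono[of 1 "ennreal q" "w j y"] q by simp
          ultimately show ?thesis by (simp add: distrib_left add.assoc add.commute add_mono)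
        qed
        finally show "K s (a j) y \<le> ennreal q * a j y"
          unfolding a_def by (simp add: mult_left_mono mult.left_commute)
      qed
    qed
  qed
  have W_le: "adm j y \<Longrightarrow> W y \<le> a j y" for j y
    unfolding W_def by (rule INF_lower2[of j]) (auto simp: adm_def)
  have W_attained: "\<exists>j. adm j y \<and> W y = a j y" for y
  proof -
    have fin: "finite {j. adm j y}" by (rule finite_subset[of _ "{..J}"]) (auto simp: adm_def)
    have ne: "{j. adm j y} \<noteq> {}" by (auto simp: adm_def intro!: exI[of _ 0])
    obtain j where j: "adm j y" "\<And>k. adm k y \<Longrightarrow> a j y \<le> a k y"
      using ex_min_if_finite[of "(\<lambda>j. a j y) ` {j. adm j y}"] fin ne by (auto simp: not_less)
    have "a j y \<le> W y" unfolding W_def using j by (intro INF_greatest) auto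
    then show ?thesis using j(1) W_le[OF j(1)] by (intro exI[of _ j]) auto
  qed
  have W_le_2: "AE y in m. W y \<le> 2"
    using w_le_1
  proof eventually_elim
    case (elim y)
    have "W y \<le> a 0 y" by (intro W_le) (simp add: adm_def)
    also have "\<dots> = w 0 y + ennreal \<epsilon>" by (simp add: a_def)
    also have "\<dots> \<le> 1 + 1" using elim \<epsilon> by (intro add_mono) simp_all
    finally show ?case by simp
  qed
  have W_step: "AE y in m. K s W y \<le> ennreal q * W y + ennreal (2 * \<kappa>)"
    using w_high w_low a_exc far
  proof eventually_elim
    case (elim y)
    obtain j where j: "adm j y" "W y = a j y" using W_attained by blast
    \<comment> \<open>If the minimizer \<open>j\<close> at \<open>y\<close> failed at
      \<open>z\<close>, then \<open>y\<close> would be one step away from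
      \<open>U (3 * j - 2)\<close>, hence in \<open>U (3 * j)\<close>, so that \<open>w j y\<close>
      is at least \<open>c\<close>. But \<open>y\<close> is outside \<open>U (3 * j - 2)\<close>,
      which is \<open>U (3 * (j - 1) + 1)\<close>, so \<open>w (j - 1) y\<close> is at most
      \<open>\<epsilon>\<close>. Since \<open>4 * \<epsilon> < c\<close>, the index
      \<open>j - 1\<close> would give a smaller value at \<open>y\<close>.\<close>
    have near_le: "W z \<le> a j z" if d: "dist y z < r" for z
    proof (rule ccontr)
      assume "\<not> W z \<le> a j z"
      then have "\<not> adm j z" using W_le by blast
      then have j1: "1 \<le> j" "z \<in> U (3 * j - 2)" using j(1) by (auto simp: adm_def)
      have y_out: "y \<notin> U (3 * j - 2)" using j(1) j1(1) by (auto simp: adm_def)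
      have "y \<in> U (Suc (3 * j - 2))" using U_step[OF j1(2), of y] d by (simp add: dist_commute)
      moreover have "Suc (3 * j - 2) \<le> 3 * j" using j1(1) by simp
      ultimately have "y \<in> U (3 * j)" using U_mono by blast
      then have hi: "ennreal c \<le> w j y" using elim(1) by blast
      have e: "3 * (j - 1) + 1 = 3 * j - 2" using j1(1) by simp
      have lo: "w (j - 1) y \<le> ennreal \<epsilon>" using elim(2) y_out e by metis
      have "adm (j - 1) y"
      proof -
        have "3 * (j - 1) - 2 \<le> 3 * j - 2" by simp
        then have "U (3 * (j - 1) - 2) \<subseteq> U (3 * j - 2)" by (rule U_mono)
        then show ?thesis using j(1) y_out unfolding adm_def by auto
      qed
      then have "a j y \<le> a (j - 1) y" using j(2) W_le by metis
      moreover have "a (j - 1) y < a j y"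
      proof -
        have "a (j - 1) y \<le> ennreal ((1 / 2) ^ (j - 1)) * (ennreal \<epsilon> + ennreal \<epsilon>)"
          unfolding a_def using lo by (intro mult_left_mono add_mono) auto
        also have "\<dots> = ennreal ((1 / 2) ^ (j - 1) * (2 * \<epsilon>))"
          using \<epsilon> by (simp add: ennreal_mult[symmetric] ennreal_plus[symmetric] del: ennreal_plus)
        also have "\<dots> < ennreal ((1 / 2) ^ j * c)"
        proof (rule ennreal_lessI)
          have "(1 / 2 :: real) ^ (j - 1) = 2 * (1 / 2) ^ j" using j1(1) by (cases j) auto
          then show "(1 / 2) ^ (j - 1) * (2 * \<epsilon>) < (1 / 2) ^ j * c" using c by (simp add: \<epsilon>_def)
        qed (use c in simp)
        also have "\<dots> = ennreal ((1 / 2) ^ j) * ennreal c" using c by (simp add: ennreal_mult)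
        also have "\<dots> \<le> a j y" unfolding a_def using hi by (intro mult_left_mono) (auto intro: add_increasing2)
        finally show ?thesis .
      qed
      ultimately show False by simp
    qed
    \<comment> \<open>Only a jump of length at least \<open>r\<close> can reach points where
      \<open>j\<close> is inadmissible. There the crude bound \<open>W \<le> 2\<close> is charged to
      \<open>\<kappa>\<close>.\<close>
    have "K s W y \<le> (\<integral>\<^sup>+ z. ennreal (p s y z) * a j z + 2 * (ennreal (p s y z) * indicator {z. r \<le> dist y z} z) \<partial>m)"
      unfolding K_def
    proof (rule nn_integral_mono_AE)
      show "AE z in m. ennreal (p s y z) * W z \<le>
          ennreal (p s y z) * a j z + 2 * (ennreal (p s y z) * indicator {z. r \<le> dist y z} z)"
        using W_le_2
      proof eventually_elim
        case (elim z)
        have "W z \<le> a j z + 2 * indicator {z. r \<le> dist y z} z"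
        proof (cases "r \<le> dist y z")
          case True
          then show ?thesis using elim by (simp add: add_increasing)
        qed (use near_le[of z] in simp)
        then have "ennreal (p s y z) * W z \<le> ennreal (p s y z) * (a j z + 2 * indicator {z. r \<le> dist y z} z)"
          by (rule mult_left_mono) simp
        then show ?case by (simp add: distrib_left mult.left_commute)
      qed
    qed
    also have "\<dots> = K s (a j) y + 2 * mass s y {z. r \<le> dist y z}"
    proof -
      have [measurable]: "{z. r \<le> dist y z} \<in> sets m"
        unfolding sets_m by (intro borel_closed closed_Collect_le continuous_intros)
      show ?thesis unfolding K_def using s by (subst nn_integral_add; measurable?) (auto simp: nn_integral_cmult)
    qed
    also have "\<dots> \<le> ennreal q * a j y + 2 * ennreal \<kappa>"
      using elim(3,4) by (intro add_mono mult_left_mono) auto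
    finally show ?case using j(2) \<kappa> by (simp add: ennreal_mult)
  qed
  \<comment> \<open>The induction starts at 1, as time 0 is outside the scope of the heat
    kernel.\<close>
  have iter: "AE y in m. K (real n * s) W y \<le> ennreal (q ^ n) * (W y + ennreal (real n * (2 * \<kappa>)))"
    if "1 \<le> n" for n
    using that
  proof (induction n rule: nat_induct_at_least)
    case base
    show ?case using W_step
    proof eventually_elim
      case (elim y)
      have "ennreal (2 * \<kappa>) \<le> ennreal q * ennreal (2 * \<kappa>)"
        using mult_right_mono[of 1 "ennreal q" "ennreal (2 * \<kappa>)"] q by simp
      then show ?case using elim by (simp add: distrib_left) (meson add_left_mono order_trans)
    qed
  next
    case (Suc n)
    have "s + real n * s = real (Suc n) * s" by (simp add: algebra_simps)
    then have "AE y in m. K s (K (real n * s) W) y = K (real (Suc n) * s) W y"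
      using K_semigroup[OF W_meas s step_pos[OF Suc(1)]] by simp
    then show ?case using W_step K_one_le[OF s]
    proof eventually_elim
      case (elim y)
      let ?e = "ennreal (real n * (2 * \<kappa>))"
      have "K (real (Suc n) * s) W y = K s (K (real n * s) W) y" using elim(1) by simp
      also have "\<dots> \<le> K s (\<lambda>y. ennreal (q ^ n) * (W y + ?e)) y" using Suc(2) by (rule K_mono_AE)
      also have "\<dots> = ennreal (q ^ n) * (K s W y + ?e * K s (\<lambda>_. 1) y)"
      proof -
        have "K s (\<lambda>y. ennreal (q ^ n) * (W y + ?e)) y = ennreal (q ^ n) * K s (\<lambda>y. W y + ?e) y"
          using s by (intro K_cmult) measurable
        also have "K s (\<lambda>y. W y + ?e) y = K s W y + K s (\<lambda>_. ?e) y"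
          using s by (intro K_add) measurable
        also have "K s (\<lambda>_. ?e) y = ?e * K s (\<lambda>_. 1) y"
          using K_cmult[of "\<lambda>_. 1" s ?e y] s by simp
        finally show ?thesis .
      qed
      also have "\<dots> \<le> ennreal (q ^ n) * ((ennreal q * W y + ennreal (2 * \<kappa>)) + ?e * 1)"
        using elim(2,3) by (intro mult_left_mono add_mono) auto
      also have "(ennreal q * W y + ennreal (2 * \<kappa>)) + ?e * 1 \<le> ennreal q * (W y + ennreal (real (Suc n) * (2 * \<kappa>)))"
      proof -
        have "ennreal (2 * \<kappa>) + ?e = ennreal (real (Suc n) * (2 * \<kappa>))"
          using \<kappa> by (subst ennreal_plus[symmetric]) (auto simp: algebra_simps)
        also have "\<dots> \<le> ennreal q * ennreal (real (Suc n) * (2 * \<kappa>))"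
          using mult_right_mono[of 1 "ennreal q" "ennreal (real (Suc n) * (2 * \<kappa>))"] q by simp
        finally have "ennreal q * W y + (ennreal (2 * \<kappa>) + ?e) \<le>
            ennreal q * W y + ennreal q * ennreal (real (Suc n) * (2 * \<kappa>))"
          by (rule add_left_mono)
        then show ?thesis by (simp only: distrib_left add.assoc mult_1_right)
      qed
      finally have "K (real (Suc n) * s) W y \<le>
          ennreal (q ^ n) * (ennreal q * (W y + ennreal (real (Suc n) * (2 * \<kappa>))))"
        by (simp add: mult_left_mono del: of_nat_Suc)
      also have "\<dots> = ennreal (q ^ n) * ennreal q * (W y + ennreal (real (Suc n) * (2 * \<kappa>)))"
        by (simp only: mult.assoc)
      also have "ennreal (q ^ n) * ennreal q = ennreal (q ^ Suc n)"
        using q by (simp add: ennreal_mult'[symmetric] mult.commute)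
      finally show ?case .
    qed
  qed
  have A_le: "AE y in m. ennreal c * indicator A y \<le> W y"
    using w_high
  proof eventually_elim
    case (elim y)
    show ?case
    proof (cases "y \<in> A")
      case True
      obtain j where j: "adm j y" "W y = a j y" using W_attained by blast
      have "y \<in> U 0" using True by (simp add: U_def)
      then have "y \<in> U n" for n using U_mono[of 0 n] by auto
      then have "j = 0" using j(1) by (auto simp: adm_def)
      have "ennreal c \<le> w 0 y" using elim \<open>y \<in> U 0\<close> by (metis mult_0_right)
      then show ?thesis using j True \<open>j = 0\<close> by (simp add: a_def add_increasing2)
    qed simp
  qed
  have Ms: "0 < real M * s" using M s by simp
  have KW: "ennreal c * K (real M * s) (indicator A) y \<le> K (real M * s) W y" for y
  proof -
    have "indicator A \<in> borel_measurable m" using A by (intro borel_measurable_indicator sets_open)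
    then have "ennreal c * K (real M * s) (indicator A) y = K (real M * s) (\<lambda>y. ennreal c * indicator A y) y"
      using Ms by (intro K_cmult[symmetric])
    also have "\<dots> \<le> K (real M * s) W y" using A_le by (rule K_mono_AE)
    finally show ?thesis .
  qed
  have "AE y in m. K (real M * s) W y \<le> ennreal (q ^ M) * (W y + ennreal (real M * (2 * \<kappa>)))"
    using M by (intro iter) simp
  then show ?thesis using w_low
    unfolding q_def[symmetric]
  proof (elim AE_mp, intro AE_I2 impI)
    fix y assume y: "y \<notin> chain_set r A (3 * J + 1)"
      and 1: "\<forall>j. y \<notin> U (3 * j + 1) \<longrightarrow> w j y \<le> ennreal \<epsilon>"
      and 2: "K (real M * s) W y \<le> ennreal (q ^ M) * (W y + ennreal (real M * (2 * \<kappa>)))"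
    have yU: "y \<notin> U (3 * J + 1)" using y by (simp add: U_def)
    moreover have "3 * J - 2 \<le> 3 * J + 1" by simp
    then have "U (3 * J - 2) \<subseteq> U (3 * J + 1)" by (rule U_mono)
    ultimately have "adm J y" unfolding adm_def by auto
    then have "W y \<le> a J y" by (rule W_le)
    also have "\<dots> \<le> ennreal ((1 / 2) ^ J) * (ennreal \<epsilon> + ennreal \<epsilon>)"
      unfolding a_def using 1 yU by (intro mult_left_mono add_mono) auto
    also have "\<dots> = ennreal (c / 4 * (1 / 2) ^ J)"
      using \<epsilon> by (simp add: ennreal_mult[symmetric] ennreal_plus[symmetric] \<epsilon>_def mult.commute del: ennreal_plus)
    finally have "W y + ennreal (real M * (2 * \<kappa>)) \<le> ennreal (c / 4 * (1 / 2) ^ J + real M * (2 * \<kappa>))"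
      using c \<kappa> by (simp add: add_right_mono)
    then have "ennreal (q ^ M) * (W y + ennreal (real M * (2 * \<kappa>))) \<le>
        ennreal (q ^ M * (c / 4 * (1 / 2) ^ J + real M * (2 * \<kappa>)))"
      using q by (simp add: ennreal_mult' mult_left_mono)
    then show "ennreal c * K (real M * s) (indicator A) y \<le>
        ennreal (q ^ M * (c / 4 * (1 / 2) ^ J + real M * (2 * \<kappa>)))"
      by (rule order_trans[OF order_trans[OF KW 2]])
  qed
qed

text \<open>The order of choices matters. \<open>J\<close> is determined by \<open>n\<close>; only
  then is the number \<open>M\<close> of time steps taken as large as \<open>no_long_jumps\<close>
  demands for an error proportional to \<open>(1 / 2) ^ J\<close>. The growth factor of the barrier
  nevertheless stays exponential in \<open>n\<close>, because the window \<open>I\<close> grows in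
  proportion to \<open>M\<close>.\<close>

lemma chain_condition:
  obtains L :: nat where "\<And>(x::'a) y r n. 0 < r \<Longrightarrow> ereal r < diam \<Longrightarrow> 1 \<le> n \<Longrightarrow>
    dist x y \<le> real n * r \<Longrightarrow> y \<in> chain_set r {x} (L * n)"
proof -
  obtain c where c: "0 < c" "c \<le> 1" "\<And>rho. 0 < rho \<Longrightarrow>
    AE x in m. ennreal c \<le> mass (\<Psi> rho) x (ball x rho)"
    using local_mass by blast
  obtain \<delta> where \<delta>: "0 < \<delta>"
    "\<And>r t. 0 < r \<Longrightarrow> ereal r < diam \<Longrightarrow> 0 < t \<Longrightarrow> t \<le> \<delta> * \<Psi> r \<Longrightarrow>
      AE x in m. mass t x {y. r / 2 \<le> dist x y} \<le> ennreal (c / 8) \<and>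
        ennreal c \<le> mass t x (ball x (r / 2))"
    using small_time_bounds[of "c / 8" c] c by auto
  obtain c' B where lb: "0 < c'" "0 < B" "\<And>n r. 1 \<le> n \<Longrightarrow> 0 < r \<Longrightarrow>
    AE x in m. AE y in m. dist x y \<le> 3 * (real n * r) \<longrightarrow>
      c' / V r * exp (- B * real n) \<le> p (real n * \<Psi> r) x y"
    using lower_bound[of 3] by auto
  \<comment> \<open>The sum of the growth rate of the barrier and the rate lost in the lower kernel
    bound, both per unit of \<open>n\<close>. The former is \<open>8 * M / (c * I)\<close> with
    \<open>M / I\<close> at most \<open>2 * n / \<delta>\<close>.\<close>
  define B' where "B' = 16 / (c * \<delta>) + B"
  have B': "0 < B'" using c \<delta> lb by (simp add: B'_def add_pos_pos)
  \<comment> \<open>Because of \<open>max 1\<close> the prefactor may be raised to the power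
    \<open>n\<close>, so that one \<open>G\<close> with \<open>J = G * n\<close> serves all
    \<open>n\<close>.\<close>
  define H where "H = max 1 (C0 / (2 * c')) * exp B'"
  obtain G :: nat where G: "H < 2 ^ G" using real_arch_pow[of 2 H] by auto
  have chain: "y \<in> chain_set r {x} ((3 * G + 3) * n)"
    if r: "0 < r" "ereal r < diam" and n: "1 \<le> n" and xy: "dist x y \<le> real n * r"
    for x y :: 'a and r and n :: nat
  proof -
    define J where "J = G * n"
    define A where "A = ball x r"
    have A: "A \<in> sets m" "open A" by (simp_all add: A_def)
    have JH: "max 1 (C0 / (2 * c')) * exp (B' * n) < 2 ^ J"
    proof -
      have "max 1 (C0 / (2 * c')) \<le> max 1 (C0 / (2 * c')) ^ n" using n self_le_power[of "max 1 (C0 / (2 * c'))" n] by simp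
      then have "max 1 (C0 / (2 * c')) * exp (B' * n) \<le> max 1 (C0 / (2 * c')) ^ n * exp (B' * n)"
        by (intro mult_right_mono) auto
      also have "\<dots> = H ^ n" by (simp add: H_def power_mult_distrib exp_of_nat2_mult)
      also have "\<dots> < (2 ^ G) ^ n" using G n by (intro power_strict_mono) (auto simp: H_def)
      finally show ?thesis by (simp add: J_def power_mult)
    qed
    have meet: "chain_set r A (3 * J + 1) \<inter> ball y r \<noteq> {}"
    proof (rule ccontr)
      assume "\<not> ?thesis"
      then have disj: "z \<notin> chain_set r A (3 * J + 1)" if "dist y z < r" for z
        using that by (metis IntI empty_iff mem_ball)
      define t where "t = real n * \<Psi> r"
      have t: "0 < t" using n psi_pos[OF r(1)] by (simp add: t_def)
      \<comment> \<open>Over all \<open>M\<close> steps the long jumps then contribute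
        \<open>2 * e\<close>, as much as the term \<open>c / 4 * (1 / 2) ^ J\<close> of the
        barrier.\<close>
      define e where "e = c / 8 * (1 / 2) ^ J"
      have e: "0 < e" using c by (simp add: e_def)
      obtain M0 where M0: "\<And>M. M0 \<le> real M \<Longrightarrow> 0 < M \<Longrightarrow>
        AE x in m. mass (t / M) x {y. r \<le> dist x y} \<le> ennreal (e / M)"
        using no_long_jumps[OF r(1) t e] by blast
      define M where "M = nat \<lceil>max (max M0 1) (n / \<delta>)\<rceil>"
      have "max (max M0 1) (n / \<delta>) \<le> real M" unfolding M_def by linarith
      then have M: "M0 \<le> real M" "1 \<le> real M" "n / \<delta> \<le> real M" by auto
      define s where "s = t / M"
      have s: "0 < s" using t M by (simp add: s_def)
      \<comment> \<open>The longest window whose times \<open>i * s\<close> all stay below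
        \<open>\<delta> * \<Psi> r\<close>; the choice \<open>n / \<delta> \<le> M\<close> makes it
        nonempty.\<close>
      define I where "I = nat \<lfloor>\<delta> * M / n\<rfloor>"
      have dM: "1 \<le> \<delta> * M / n" using M(3) \<delta> n by (simp add: field_simps)
      then have I: "real I \<le> \<delta> * M / n" "\<delta> * M / n < real I + 1" "1 \<le> I" unfolding I_def by linarith+
      have I_half: "\<delta> * M / (2 * n) \<le> real I"
      proof -
        have "\<delta> * M / n \<le> 2 * real I" using I by linarith
        then show ?thesis by simp
      qed
      have near: "AE x in m. mass (real i * s) x {y. r / 2 \<le> dist x y} \<le> ennreal (c / 8) \<and>
        ennreal c \<le> mass (real i * s) x (ball x (r / 2))"
        if i: "1 \<le> i" "i \<le> I" for i
      proof (rule \<delta>(2)[OF r])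
        show "0 < real i * s" using s i by simp
        have "real i * s \<le> (\<delta> * M / n) * s" using i I s by (intro mult_right_mono) auto
        also have "\<dots> = \<delta> * \<Psi> r" using n M by (simp add: s_def t_def)
        finally show "real i * s \<le> \<delta> * \<Psi> r" .
      qed
      have "AE z in m. z \<notin> chain_set r A (3 * J + 1) \<longrightarrow> ennreal c * K (real M * s) (indicator A) z \<le>
          ennreal ((1 + 8 / (c * I)) ^ M * (c / 4 * (1 / 2) ^ J + real M * (2 * (e / M))))"
        using I e M c M0[OF M(1)] by (intro chain_barrier[OF r(1) A(2) s] near) (auto simp: s_def)
      moreover have "real M * s = t" using M by (simp add: s_def)
      ultimately have up: "AE z in m. z \<notin> chain_set r A (3 * J + 1) \<longrightarrow> ennreal c * K t (indicator A) z \<le>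
          ennreal ((1 + 8 / (c * I)) ^ M * (c / 4 * (1 / 2) ^ J + real M * (2 * (e / M))))" by simp
      obtain z where z: "dist y z < r"
        "z \<notin> chain_set r A (3 * J + 1) \<longrightarrow> ennreal c * K t (indicator A) z \<le>
          ennreal ((1 + 8 / (c * I)) ^ M * (c / 4 * (1 / 2) ^ J + real M * (2 * (e / M))))"
        "AE w in m. dist z w \<le> 3 * (real n * r) \<longrightarrow> c' / V r * exp (- B * real n) \<le> p t z w"
        using AE_ball_witness[OF AE_conjI[OF up lb(3)[OF n r(1)]] r(1), of y] unfolding t_def[symmetric] by blast
      have "ennreal (c' / V r * exp (- B * real n)) * emeasure m A \<le> K t (indicator A) z"
      proof -
        have "AE w in m. ennreal (c' / V r * exp (- B * real n)) * indicator A w \<le> ennreal (p t z w) * indicator A w"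
          using z(3)
        proof eventually_elim
          case (elim w)
          show ?case
          proof (cases "w \<in> A")
            case True
            have "dist z w \<le> dist z y + dist y x + dist x w"
              using dist_triangle[of z w y] dist_triangle[of y w x] by linarith
            also have "\<dots> \<le> r + real n * r + r" using True z(1) xy by (simp add: A_def dist_commute)
            also have "\<dots> \<le> 3 * (real n * r)" using n r mult_right_mono[of 1 "real n" r] by simp
            finally show ?thesis using elim by (simp add: ennreal_leI mult_right_mono)
          qed simp
        qed
        then have "(\<integral>\<^sup>+ w. ennreal (c' / V r * exp (- B * real n)) * indicator A w \<partial>m) \<le> K t (indicator A) z"
          unfolding K_def by (rule nn_integral_mono_AE)
        then show ?thesis using A by (simp add: nn_integral_cmult_indicator)
      qed
      moreover have "ennreal (c' / C0 * exp (- B * real n)) \<le> ennreal (c' / V r * exp (- B * real n)) * emeasure m A"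
      proof -
        have "c' / C0 * exp (- B * real n) = c' / V r * exp (- B * real n) * (V r / C0)"
          using V_pos[OF r(1)] by simp
        also have "\<dots> \<le> c' / V r * exp (- B * real n) * measure m A"
          unfolding A_def using measure_ball_lower[OF r, of x] lb V_pos[OF r(1)] by (intro mult_left_mono) auto
        finally show ?thesis unfolding A_def using lb V_pos[OF r(1)]
          by (simp add: emeasure_ball ennreal_mult[symmetric] ennreal_leI)
      qed
      ultimately have "ennreal (c' / C0 * exp (- B * real n)) \<le> K t (indicator A) z" by (rule order_trans[rotated])
      then have "ennreal c * ennreal (c' / C0 * exp (- B * real n)) \<le> ennreal c * K t (indicator A) z"
        by (rule mult_left_mono) simp
      also have "\<dots> \<le> ennreal ((1 + 8 / (c * I)) ^ M * (c / 4 * (1 / 2) ^ J + real M * (2 * (e / M))))"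
        using z(2) disj[OF z(1)] by blast
      finally have ineq: "c * (c' / C0 * exp (- B * real n)) \<le> (1 + 8 / (c * I)) ^ M * (c / 4 * (1 / 2) ^ J + real M * (2 * (e / M)))"
        using c lb C0 e I by (simp add: ennreal_mult'[symmetric])
      have "c / 4 * (1 / 2) ^ J + real M * (2 * (e / M)) = c / 2 * (1 / 2) ^ J"
        using M by (simp add: e_def)
      moreover have "(1 + 8 / (c * I)) ^ M \<le> exp (16 / (c * \<delta>) * n)"
      proof -
        have "(1 + 8 / (c * I)) ^ M \<le> exp (8 / (c * I)) ^ M"
          using c I by (intro power_mono exp_ge_add_one_self) auto
        also have "\<dots> = exp (M * (8 / (c * I)))" by (rule exp_of_nat_mult[symmetric])
        also have "\<dots> \<le> exp (16 / (c * \<delta>) * n)"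
        proof -
          have "real M \<le> 2 * n / \<delta> * I" using I_half \<delta> n by (simp add: field_simps)
          then have "real M * (8 / (c * I)) \<le> 2 * n / \<delta> * I * (8 / (c * I))"
            using c I by (intro mult_right_mono) auto
          also have "\<dots> = 16 / (c * \<delta>) * n" using I by simp
          finally show ?thesis by simp
        qed
        finally show ?thesis .
      qed
      ultimately have "c * (c' / C0 * exp (- B * real n)) \<le> exp (16 / (c * \<delta>) * n) * (c / 2 * (1 / 2) ^ J)"
        using ineq c by (smt (verit) mult_right_mono divide_nonneg_nonneg mult_nonneg_nonneg zero_le_power)
      then have "2 ^ J \<le> C0 / (2 * c') * (exp (16 / (c * \<delta>) * n) * exp (B * n))"
        using c lb C0 by (simp add: exp_minus power_one_over field_simps)
      also have "exp (16 / (c * \<delta>) * n) * exp (B * n) = exp (B' * n)"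
        by (simp add: exp_add[symmetric] B'_def algebra_simps)
      also have "C0 / (2 * c') * exp (B' * n) \<le> max 1 (C0 / (2 * c')) * exp (B' * n)"
        by (intro mult_right_mono) auto
      finally show False using JH by simp
    qed
    then obtain z where z: "z \<in> chain_set r A (3 * J + 1)" "dist y z < r" by (metis IntE equals0I mem_ball)
    \<comment> \<open>One more step leads from \<open>z\<close> to \<open>y\<close>, and another
      replaces \<open>ball x r\<close> by \<open>{x}\<close>.\<close>
    have "y \<in> chain_set r A (Suc (3 * J + 1))" unfolding chain_set.simps
      using z by (intro UN_I[of z]) (simp_all add: dist_commute)
    then have "y \<in> chain_set r {x} (Suc (Suc (3 * J + 1)))" by (simp only: A_def chain_set_ball)
    moreover have "Suc (Suc (3 * J + 1)) = 3 * J + 3" by simp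
    ultimately have "y \<in> chain_set r {x} (3 * J + 3)" by (simp only:)
    moreover have "3 * J + 3 \<le> (3 * G + 3) * n" using n by (simp add: J_def algebra_simps)
    ultimately show ?thesis using chain_set_mono[OF r(1)] by blast
  qed
  then show thesis by (intro that[of "3 * G + 3"])
qed

end

section \<open>The two inequalities\<close>

text \<open>Where the chain leaves the ball of radius \<open>r\<close>, it overshoots by less than
  one step.\<close>

lemma chain_set_crosses_sphere:
  assumes "0 < r" "y \<in> chain_set r {x} n" "r \<le> dist x y"
  obtains z where "r \<le> dist x z" "dist x z < 2 * r"
proof -
  have "\<exists>z. r \<le> dist x z \<and> dist x z < 2 * r"
    using assms(2,3)
  proof (induction n arbitrary: y)
    case 0
    then show ?case using assms(1) by simp
  next
    case (Suc n)
    then obtain v where v: "v \<in> chain_set r {x} n" "dist v y < r" by auto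
    show ?case
    proof (cases "r \<le> dist x v")
      case True
      then show ?thesis using Suc.IH v(1) by blast
    next
      case False
      then show ?thesis using Suc.prems(2) v(2) dist_triangle[of x y v] by (intro exI[of _ y]) auto
    qed
  qed
  then show thesis using that by blast
qed

text \<open>Minimality of the length passes to the initial segments: each \<open>f i\<close> has
  chain distance exactly \<open>i\<close> from \<open>x\<close>. The overlap bound depends on
  this.\<close>

lemma minimal_chain:
  assumes "z \<in> chain_set r {x} n" "\<And>j. j < n \<Longrightarrow> z \<notin> chain_set r {x} j"
  obtains f where "f n = z" "\<And>i. i \<le> n \<Longrightarrow> f i \<in> chain_set r {x} i"
    "\<And>i j. i \<le> n \<Longrightarrow> j < i \<Longrightarrow> f i \<notin> chain_set r {x} j"
    "\<And>i. i < n \<Longrightarrow> dist (f i) (f (Suc i)) < r"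
proof -
  have "\<exists>f. f n = z \<and> (\<forall>i\<le>n. f i \<in> chain_set r {x} i \<and> (\<forall>j<i. f i \<notin> chain_set r {x} j)) \<and>
      (\<forall>i<n. dist (f i) (f (Suc i)) < r)"
    using assms
  proof (induction n arbitrary: z)
    case 0
    then show ?case by (intro exI[of _ "\<lambda>_. z"]) auto
  next
    case (Suc n)
    then obtain v where v: "v \<in> chain_set r {x} n" "dist v z < r" by auto
    have "v \<notin> chain_set r {x} j" if "j < n" for j
    proof
      assume "v \<in> chain_set r {x} j"
      then have "z \<in> chain_set r {x} (Suc j)" using v(2) by auto
      then show False using Suc.prems(2)[of "Suc j"] that by auto
    qed
    from Suc.IH[OF v(1) this] obtain f where f: "f n = v"
      "\<forall>i\<le>n. f i \<in> chain_set r {x} i \<and> (\<forall>j<i. f i \<notin> chain_set r {x} j)"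
      "\<forall>i<n. dist (f i) (f (Suc i)) < r" by blast
    show ?case
    proof (intro exI[of _ "f(Suc n := z)"] conjI allI impI)
      fix i assume "i < Suc n"
      then show "dist ((f(Suc n := z)) i) ((f(Suc n := z)) (Suc i)) < r"
        using f v(2) by (cases "i = n") auto
    next
      fix i assume "i \<le> Suc n"
      then show "(f(Suc n := z)) i \<in> chain_set r {x} i"
        using f Suc.prems by (cases "i = Suc n") auto
    next
      fix i j assume "i \<le> Suc n" "j < i"
      then show "(f(Suc n := z)) i \<notin> chain_set r {x} j"
        using f Suc.prems by (cases "i = Suc n") auto
    qed simp
  qed
  then obtain f where f: "f n = z \<and> (\<forall>i\<le>n. f i \<in> chain_set r {x} i \<and> (\<forall>j<i. f i \<notin> chain_set r {x} j)) \<and>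
      (\<forall>i<n. dist (f i) (f (Suc i)) < r)" by blast
  show thesis by (rule that[of f]) (use f in auto)
qed

text \<open>A point common to two of the balls links their centres by two steps, so the two indices
  differ by at most 2.\<close>

lemma minimal_chain_overlap:
  assumes "\<And>i. i \<le> n \<Longrightarrow> f i \<in> chain_set r {x} i"
    "\<And>i j. i \<le> n \<Longrightarrow> j < i \<Longrightarrow> f i \<notin> chain_set r {x} j"
  shows "(\<Sum>i<n. indicator (ball (f i) r) u) \<le> (3::real)"
proof -
  define S where "S = {i. i < n \<and> u \<in> ball (f i) r}"
  have close: "i \<le> k + 2" if "i \<in> S" "k \<in> S" for i k
  proof (rule ccontr)
    assume ik: "\<not> i \<le> k + 2"
    have "u \<in> chain_set r {x} (Suc k)"
      using assms(1)[of k] that by (auto simp: S_def)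
    then have "f i \<in> chain_set r {x} (Suc (Suc k))"
      unfolding chain_set.simps(2)[of r "{x}" "Suc k"] using that
      by (intro UN_I[of u]) (auto simp: S_def dist_commute)
    then show False using assms(2)[of i "Suc (Suc k)"] ik that by (auto simp: S_def)
  qed
  have fin: "finite S" by (simp add: S_def)
  have "card S \<le> 3"
  proof (cases "S = {}")
    case False
    have "S \<subseteq> {Min S..Min S + 2}" using close Min_in[OF fin False] fin by auto
    then have "card S \<le> card {Min S..Min S + 2}" by (intro card_mono) auto
    then show ?thesis by simp
  qed simp
  moreover have "(\<Sum>i<n. indicator (ball (f i) r) u :: real) = real (card S)"
    by (simp add: S_def indicator_def sum.If_cases Int_def)
  ultimately show ?thesis by simp
qed

section \<open>Dissipation of classes of functions and means over sets\<close>

context symmetric_heat_kernel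
begin

lemma dissip_cong_AE:
  assumes "0 < t" "f \<in> L2 m" "g \<in> L2 m" "AE x in m. f x = g x"
  shows "dissip t f = dissip t g"
proof -
  have "L2_inner m f f = L2_inner m g g"
    using L2_inner_cong_AE[OF assms(4,2,3,2)] L2_inner_cong_AE[OF assms(4,2,3,3)]
    by (simp add: L2_inner_commute)
  moreover have "L2_inner m (P t f) f = L2_inner m (P t g) g"
  proof -
    have "L2_inner m (P t f) f = L2_inner m (P t g) f"
      using assms by (intro L2_inner_cong_AE P_cong P_L2)
    also have "\<dots> = L2_inner m f (P t g)" by (rule L2_inner_commute)
    also have "\<dots> = L2_inner m g (P t g)" using assms by (intro L2_inner_cong_AE P_L2)
    finally show ?thesis by (simp add: L2_inner_commute)
  qed
  ultimately show ?thesis by (simp add: dissip_def)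
qed

text \<open>The squared distance from \<open>k\<close> exceeds that from the mean by exactly the
  left side, once integrated over \<open>B\<close>. Used in both variables it bounds differences of
  means by double integrals.\<close>

lemma mean_square_deviation:
  assumes f: "f \<in> L2 m" and B [measurable]: "B \<in> sets m" and fin: "emeasure m B < \<infinity>"
    and pos: "0 < measure m B"
  shows "ennreal (measure m B * (k - (\<integral>x. indicator B x * f x \<partial>m) / measure m B)\<^sup>2) \<le>
    (\<integral>\<^sup>+ x. indicator B x * ennreal ((k - f x)\<^sup>2) \<partial>m)"
proof -
  define \<mu> where "\<mu> = measure m B"
  define a where "a = (\<integral>x. indicator B x * f x \<partial>m) / \<mu>"
  have [measurable]: "f \<in> borel_measurable m" using f by (simp add: L2_def)
  have ind: "(indicator B :: 'a \<Rightarrow> real) \<in> L2 m"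
    by (rule L2_bounded[where A=B and B=1]) (use fin in \<open>auto simp: indicator_def\<close>)
  have i1: "integrable m (\<lambda>x. indicator B x * f x)" using L2_integrable_mult[OF ind f] .
  have i0: "integrable m (indicator B :: 'a \<Rightarrow> real)" using fin by (intro integrable_real_indicator) auto
  have i2: "integrable m (\<lambda>x. indicator B x * (f x)\<^sup>2)"
  proof (rule Bochner_Integration.integrable_bound)
    show "integrable m (\<lambda>x. (f x)\<^sup>2)" using f by (simp add: L2_def)
  qed (auto simp: indicator_def)
  have int: "(\<integral>x. indicator B x * (s - f x)\<^sup>2 \<partial>m) = s\<^sup>2 * \<mu> - 2 * s * (\<mu> * a) + (\<integral>x. indicator B x * (f x)\<^sup>2 \<partial>m)"
    and intb: "integrable m (\<lambda>x. indicator B x * (s - f x)\<^sup>2)" for s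
  proof -
    have eq: "(\<lambda>x. indicator B x * (s - f x)\<^sup>2) =
        (\<lambda>x. s\<^sup>2 * indicator B x - 2 * s * (indicator B x * f x) + indicator B x * (f x)\<^sup>2)"
      by (auto simp: power2_diff algebra_simps)
    have "\<mu> * a = (\<integral>x. indicator B x * f x \<partial>m)" using pos by (simp add: a_def \<mu>_def)
    then show "(\<integral>x. indicator B x * (s - f x)\<^sup>2 \<partial>m) = s\<^sup>2 * \<mu> - 2 * s * (\<mu> * a) + (\<integral>x. indicator B x * (f x)\<^sup>2 \<partial>m)"
      unfolding eq using i0 i1 i2 by (simp add: \<mu>_def)
    show "integrable m (\<lambda>x. indicator B x * (s - f x)\<^sup>2)" unfolding eq using i0 i1 i2 by simp
  qed
  have "0 \<le> (\<integral>x. indicator B x * (a - f x)\<^sup>2 \<partial>m)" by simp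
  then have "\<mu> * a\<^sup>2 \<le> (\<integral>x. indicator B x * (f x)\<^sup>2 \<partial>m)"
    unfolding int by (simp add: power2_eq_square algebra_simps)
  then have "\<mu> * (k - a)\<^sup>2 \<le> (\<integral>x. indicator B x * (k - f x)\<^sup>2 \<partial>m)"
    unfolding int by (simp add: power2_eq_square algebra_simps)
  moreover have "(\<integral>\<^sup>+ x. indicator B x * ennreal ((k - f x)\<^sup>2) \<partial>m) = ennreal (\<integral>x. indicator B x * (k - f x)\<^sup>2 \<partial>m)"
    by (subst nn_integral_eq_integral[symmetric, OF intb]) (auto intro!: nn_integral_cong simp: indicator_def)
  ultimately show ?thesis by (simp add: a_def \<mu>_def ennreal_leI)
qed

lemma mean_difference_square:
  assumes f: "f \<in> L2 m" and [measurable]: "A \<in> sets m" "B \<in> sets m"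
    and fin: "emeasure m A < \<infinity>" "emeasure m B < \<infinity>"
    and pos: "0 < measure m A" "0 < measure m B"
  shows "ennreal (measure m A * measure m B *
      ((\<integral>x. indicator A x * f x \<partial>m) / measure m A - (\<integral>x. indicator B x * f x \<partial>m) / measure m B)\<^sup>2) \<le>
    (\<integral>\<^sup>+ y. \<integral>\<^sup>+ w. indicator A y * indicator B w * ennreal ((f y - f w)\<^sup>2) \<partial>m \<partial>m)"
proof -
  have [measurable]: "f \<in> borel_measurable m" using f by (simp add: L2_def)
  define a where "a = (\<integral>x. indicator A x * f x \<partial>m) / measure m A"
  define b where "b = (\<integral>x. indicator B x * f x \<partial>m) / measure m B"
  have "ennreal (measure m A * measure m B * (a - b)\<^sup>2) = ennreal (measure m B) * ennreal (measure m A * (b - a)\<^sup>2)"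
    by (simp add: ennreal_mult'[symmetric] power2_commute mult_ac)
  also have "\<dots> \<le> ennreal (measure m B) * (\<integral>\<^sup>+ y. indicator A y * ennreal ((b - f y)\<^sup>2) \<partial>m)"
    unfolding a_def using assms by (intro mult_left_mono mean_square_deviation) auto
  also have "\<dots> = (\<integral>\<^sup>+ y. indicator A y * ennreal (measure m B * (f y - b)\<^sup>2) \<partial>m)"
    by (subst nn_integral_cmult[symmetric]) (auto simp: ennreal_mult power2_commute mult_ac)
  also have "\<dots> \<le> (\<integral>\<^sup>+ y. indicator A y * (\<integral>\<^sup>+ w. indicator B w * ennreal ((f y - f w)\<^sup>2) \<partial>m) \<partial>m)"
    unfolding b_def using assms by (intro nn_integral_mono mult_left_mono mean_square_deviation) auto
  also have "\<dots> = (\<integral>\<^sup>+ y. \<integral>\<^sup>+ w. indicator A y * indicator B w * ennreal ((f y - f w)\<^sup>2) \<partial>m \<partial>m)"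
    by (subst nn_integral_cmult[symmetric]) (auto simp: mult.assoc)
  finally show ?thesis by (simp add: a_def b_def)
qed

end

section \<open>The quadratic lower bound on the scale function\<close>

context hke_space
begin

lemma diam_antimono: "ereal R < diam \<Longrightarrow> r \<le> R \<Longrightarrow> ereal r < diam"
  by (metis ereal_less_eq(3) le_less_trans)

text \<open>\<open>R < diam\<close> alone gives a pair at distance more than \<open>R\<close>,
  possibly much more. A chain with steps shorter than \<open>R\<close> between them supplies a point
  at comparable distance.\<close>

lemma annulus_point:
  assumes "0 < R" "ereal R < diam"
  obtains x z :: 'a where "R \<le> dist x z" "dist x z < 2 * R"
proof -
  obtain L :: nat where L: "\<And>(x::'a) y r n. 0 < r \<Longrightarrow> ereal r < diam \<Longrightarrow> 1 \<le> n \<Longrightarrow>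
    dist x y \<le> real n * r \<Longrightarrow> y \<in> chain_set r {x} (L * n)"
    using chain_condition by blast
  obtain x y :: 'a where xy: "R < dist x y"
    using assms(2) unfolding diam_def ediam_def by (auto simp: less_SUP_iff)
  define n where "n = nat \<lceil>dist x y / R\<rceil>"
  have "1 < dist x y / R" using xy assms by simp
  then have n: "dist x y / R \<le> real n" "1 \<le> n" unfolding n_def by linarith+
  then have "dist x y \<le> real n * R" using assms by (simp add: field_simps)
  from L[OF assms n(2) this] show thesis
    using chain_set_crosses_sphere[OF assms(1), of y x "L * n"] xy that by (metis less_imp_le)
qed

lemma measure_ball_upper_diam:
  assumes "0 < r" "ereal r < diam"
  shows "measure m (ball x r) \<le> C0 * V r"
  unfolding measure_def using ball_upper_diam[OF assms] C0 V_pos[OF assms(1)]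
  by (intro enn2real_leI) auto

text \<open>Every positive time is a value of \<open>\<Psi>\<close>, so \<open>local_mass\<close>
  bounds \<open>K t (\<lambda>_. 1)\<close> below uniformly in \<open>t\<close>, and
  \<open>h\<close> inherits the bound.\<close>

lemma conservative_density:
  obtains h :: "'a \<Rightarrow> real" and c where "h \<in> borel_measurable m" "\<And>x. 0 \<le> h x" "\<And>x. h x \<le> 1" "0 < c"
    "\<And>t. 0 < t \<Longrightarrow> AE x in m. K t (\<lambda>x. ennreal (h x)) x = ennreal (h x)" "AE x in m. c \<le> h x"
proof -
  obtain c where c: "0 < c" "c \<le> 1" "\<And>rho. 0 < rho \<Longrightarrow>
    AE x in m. ennreal c \<le> mass (\<Psi> rho) x (ball x rho)"
    using local_mass by blast
  have low: "AE x in m. ennreal c \<le> K t (\<lambda>_. 1) x" if "0 < t" for t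
  proof -
    obtain rho where rho: "0 < rho" "\<Psi> rho = t" using psi_surj[OF \<open>0 < t\<close>] by blast
    have "mass t x (ball x rho) \<le> K t (\<lambda>_. 1) x" for x
      unfolding K_def by (intro nn_integral_mono mult_left_mono) (auto simp: indicator_def)
    then show ?thesis using c(3)[OF rho(1)] unfolding rho(2) by (auto elim!: eventually_mono intro: order_trans)
  qed
  show thesis by (rule invariant_density) (use low c(1) in \<open>blast intro: that\<close>)
qed

text \<open>The squared difference is at most \<open>(r / R)^2 * (dist y w / r)^2\<close>, and half
  of the exponential decay absorbs the last factor. Only pairs with a point in
  \<open>ball x R\<close> contribute, and Fubini exchanges the two cases.\<close>

lemma energy_lipschitz_upper:
  obtains C where "0 < C" "\<And>(x::'a) r R u. 0 < r \<Longrightarrow> r \<le> R \<Longrightarrow> ereal R < diam \<Longrightarrow>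
    (\<And>y. R \<le> dist x y \<Longrightarrow> u y = 0) \<Longrightarrow> (\<And>y w. \<bar>u y - u w\<bar> \<le> dist y w / R) \<Longrightarrow>
    (\<integral>\<^sup>+ y. \<integral>\<^sup>+ w. ennreal (p (\<Psi> r) y w * (u y - u w)\<^sup>2) \<partial>m \<partial>m) \<le> ennreal (C * (r / R)\<^sup>2 * V R)"
proof -
  obtain C b where ub: "0 < C" "0 < b" "\<And>r. 0 < r \<Longrightarrow> ereal r < diam \<Longrightarrow>
    AE x in m. AE y in m. p (\<Psi> r) x y \<le> C / V r * exp (- b * dist x y / r)"
    using upper_bound by blast
  obtain Q where Q: "0 < Q" "\<And>x. 0 \<le> x \<Longrightarrow> x ^ 2 \<le> Q * exp (b / 2 * x)"
    using poly_exp_bound[of "b / 2" 2] ub(2) by auto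
  obtain M where M: "0 < M" "\<And>(x::'a) r. 0 < r \<Longrightarrow>
    (\<integral>\<^sup>+ y. ennreal (exp (- (b / 2) * dist x y / r)) \<partial>m) \<le> ennreal (M * V r)"
    using exp_dist_integral[of "b / 2"] ub(2) by auto
  interpret pair_sigma_finite m m ..
  have main: "(\<integral>\<^sup>+ y. \<integral>\<^sup>+ w. ennreal (p (\<Psi> r) y w * (u y - u w)\<^sup>2) \<partial>m \<partial>m) \<le>
      ennreal ((2 * C * Q * M * C0) * (r / R)\<^sup>2 * V R)"
    if r: "0 < r" "r \<le> R" and R: "ereal R < diam"
      and u0: "\<And>y. R \<le> dist x y \<Longrightarrow> u y = 0" and lip: "\<And>y w. \<bar>u y - u w\<bar> \<le> dist y w / R"
    for x :: 'a and r R u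
  proof -
    have R0: "0 < R" using r by simp
    let ?B = "ball x R"
    define G where "G = C / V r * Q * (r / R)\<^sup>2"
    have G: "0 \<le> G" using ub Q V_pos[OF r(1)] by (simp add: G_def)
    define e where "e y w = ennreal (exp (- (b / 2) * dist y w / r))" for y w :: 'a
    have e_meas [measurable]: "(\<lambda>(y, w). e y w) \<in> borel_measurable (m \<Otimes>\<^sub>M m)"
      unfolding e_def by measurable
    have e_meas1 [measurable]: "e y \<in> borel_measurable m" for y
      unfolding e_def[abs_def] by measurable
    have e_sym: "e y w = e w y" for y w by (simp add: e_def dist_commute)
    have eM: "(\<integral>\<^sup>+ w. e y w \<partial>m) \<le> ennreal (M * V r)" for y
      unfolding e_def using M r by simp
    have bound: "AE y in m. AE w in m. ennreal (p (\<Psi> r) y w * (u y - u w)\<^sup>2) \<le>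
        ennreal G * (e y w * indicator ?B y + e y w * indicator ?B w)"
      using ub(3)[OF r(1) diam_antimono[OF R r(2)]]
    proof eventually_elim
      case (elim y)
      then show ?case
      proof eventually_elim
        case (elim w)
        show ?case
        proof (cases "y \<in> ?B \<or> w \<in> ?B")
          case True
          have "(u y - u w)\<^sup>2 \<le> (dist y w / R)\<^sup>2"
            using lip[of y w] R0 by (simp add: abs_le_square_iff[symmetric])
          then have "p (\<Psi> r) y w * (u y - u w)\<^sup>2 \<le> C / V r * exp (- b * dist y w / r) * (dist y w / R)\<^sup>2"
            using elim ub V_pos[OF r(1)] p_nonneg[OF psi_pos[OF r(1)]] by (intro mult_mono) auto
          also have "(dist y w / R)\<^sup>2 = (r / R)\<^sup>2 * (dist y w / r)\<^sup>2" using r by (simp add: power_divide)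
          also have "C / V r * exp (- b * dist y w / r) * ((r / R)\<^sup>2 * (dist y w / r)\<^sup>2) \<le>
              C / V r * exp (- b * dist y w / r) * ((r / R)\<^sup>2 * (Q * exp (b / 2 * (dist y w / r))))"
            using Q(2)[of "dist y w / r"] ub V_pos[OF r(1)] r by (intro mult_left_mono) auto
          also have "\<dots> = G * (exp (- b * dist y w / r) * exp (b / 2 * (dist y w / r)))"
            by (simp add: G_def)
          also have "exp (- b * dist y w / r) * exp (b / 2 * (dist y w / r)) = exp (- (b / 2) * dist y w / r)"
            by (simp add: exp_add[symmetric])
          finally have "ennreal (p (\<Psi> r) y w * (u y - u w)\<^sup>2) \<le> ennreal G * e y w"
            using G by (simp add: e_def ennreal_mult[symmetric] ennreal_leI)
          also have "\<dots> \<le> ennreal G * (e y w * indicator ?B y + e y w * indicator ?B w)"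
            using True by (intro mult_left_mono) (auto simp: indicator_def)
          finally show ?thesis .
        next
          case False
          then show ?thesis using u0[of y] u0[of w] by simp
        qed
      qed
    qed
    have "(\<integral>\<^sup>+ y. \<integral>\<^sup>+ w. ennreal (p (\<Psi> r) y w * (u y - u w)\<^sup>2) \<partial>m \<partial>m) \<le>
        (\<integral>\<^sup>+ y. \<integral>\<^sup>+ w. ennreal G * (e y w * indicator ?B y + e y w * indicator ?B w) \<partial>m \<partial>m)"
      using bound by (intro nn_integral_mono_AE) (auto elim!: eventually_mono intro: nn_integral_mono_AE)
    also have "\<dots> = ennreal G * ((\<integral>\<^sup>+ y. \<integral>\<^sup>+ w. e y w * indicator ?B y \<partial>m \<partial>m) +
        (\<integral>\<^sup>+ y. \<integral>\<^sup>+ w. e y w * indicator ?B w \<partial>m \<partial>m))"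
      by (simp add: nn_integral_cmult nn_integral_add)
    also have "(\<integral>\<^sup>+ y. \<integral>\<^sup>+ w. e y w * indicator ?B w \<partial>m \<partial>m) = (\<integral>\<^sup>+ w. \<integral>\<^sup>+ y. e y w * indicator ?B w \<partial>m \<partial>m)"
      by (rule Fubini'[symmetric]) measurable
    also have "\<dots> = (\<integral>\<^sup>+ y. \<integral>\<^sup>+ w. e y w * indicator ?B y \<partial>m \<partial>m)"
      by (simp add: e_sym)
    also have "(\<integral>\<^sup>+ y. \<integral>\<^sup>+ w. e y w * indicator ?B y \<partial>m \<partial>m) \<le> (\<integral>\<^sup>+ y. ennreal (M * V r) * indicator ?B y \<partial>m)"
      using eM by (intro nn_integral_mono) (simp add: nn_integral_multc mult_right_mono)
    also have "\<dots> = ennreal (M * V r) * emeasure m ?B" by (simp add: nn_integral_cmult_indicator)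
    also have "\<dots> \<le> ennreal (M * V r) * ennreal (C0 * V R)"
      using ball_upper_diam[OF R0 R] by (intro mult_left_mono) auto
    also have "ennreal G * (ennreal (M * V r) * ennreal (C0 * V R) + ennreal (M * V r) * ennreal (C0 * V R)) =
        ennreal (G * (2 * (M * V r * (C0 * V R))))"
      using G M C0 V_pos[OF r(1)] V_pos[OF R0]
      by (simp add: ennreal_mult'[symmetric] ennreal_plus[symmetric] del: ennreal_plus)
    also have "G * (2 * (M * V r * (C0 * V R))) = (2 * C * Q * M * C0) * (r / R)\<^sup>2 * V R"
      using V_pos[OF r(1)] by (simp add: G_def)
    finally show ?thesis by (simp add: add_mono mult_left_mono)
  qed
  have "0 < 2 * C * Q * M * C0" using ub Q M C0 by simp
  then show thesis by (rule that) (rule main)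
qed

theorem scale_at_least_quadratic:
  obtains C where "0 < C" "\<And>r R. 0 < r \<Longrightarrow> r \<le> R \<Longrightarrow> ereal R < diam \<Longrightarrow>
    R\<^sup>2 / r\<^sup>2 \<le> C * (\<Psi> R / \<Psi> r)"
proof -
  obtain Cu where Cu: "0 < Cu" "\<And>(x::'a) r R u. 0 < r \<Longrightarrow> r \<le> R \<Longrightarrow> ereal R < diam \<Longrightarrow>
    (\<And>y. R \<le> dist x y \<Longrightarrow> u y = 0) \<Longrightarrow> (\<And>y w. \<bar>u y - u w\<bar> \<le> dist y w / R) \<Longrightarrow>
    (\<integral>\<^sup>+ y. \<integral>\<^sup>+ w. ennreal (p (\<Psi> r) y w * (u y - u w)\<^sup>2) \<partial>m \<partial>m) \<le> ennreal (Cu * (r / R)\<^sup>2 * V R)"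
    using energy_lipschitz_upper by blast
  obtain L \<beta>1 \<beta>2 where L: "1 < L" "1 < \<beta>1"
    "\<And>r R. 0 < r \<Longrightarrow> r \<le> R \<Longrightarrow> (R / r) powr \<beta>1 / L \<le> \<Psi> R / \<Psi> r"
    using scale_bounds by metis
  obtain c B where lb: "0 < c" "0 < B" "\<And>n r. 1 \<le> n \<Longrightarrow> 0 < r \<Longrightarrow>
    AE x in m. AE y in m. dist x y \<le> (6 * L) * (real n * r) \<longrightarrow>
      c / V r * exp (- B * real n) \<le> p (real n * \<Psi> r) x y"
    using lower_bound[of "6 * L"] L by auto
  obtain h :: "'a \<Rightarrow> real" and ch where h: "h \<in> borel_measurable m" "\<And>x. 0 \<le> h x" "\<And>x. h x \<le> 1" "0 < ch"
    "\<And>t. 0 < t \<Longrightarrow> AE x in m. K t (\<lambda>x. ennreal (h x)) x = ennreal (h x)" "AE x in m. ch \<le> h x"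
    using conservative_density by blast
  have [measurable]: "h \<in> borel_measurable m" by fact
  obtain a where a: "\<And>l r. 1 \<le> l \<Longrightarrow> 0 < r \<Longrightarrow> V (l * r) \<le> (2 * l) ^ a * V r"
    using doubling_fun_growth[OF V_doubling] by blast
  \<comment> \<open>\<open>c * exp (- B)\<close> comes from the kernel, \<open>ch\<close> twice from
    \<open>h\<close>, the 4 from a variation of \<open>u\<close> by at least \<open>1 / 2\<close>,
    and each \<open>C0 * 8 ^ a\<close> from a ball of radius \<open>R / 4\<close>.\<close>
  define k1 where "k1 = c * exp (- B) * ch\<^sup>2 / 4 / (C0 * 8 ^ a)\<^sup>2"
  have k1: "0 < k1" using lb h(4) C0 by (simp add: k1_def)
  have main: "R\<^sup>2 / r\<^sup>2 \<le> Cu / k1 * (\<Psi> R / \<Psi> r)"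
    if r: "0 < r" "r \<le> R" and R: "ereal R < diam" for r R
  proof -
    have R0: "0 < R" using r by simp
    have pr: "0 < \<Psi> r" and pR: "0 < \<Psi> R" using psi_pos r R0 by auto
    obtain x z :: 'a where xz: "R \<le> dist x z" "dist x z < 2 * R" using annulus_point[OF R0 R] by blast
    \<comment> \<open>\<open>dissip_mult\<close> compares a time with its integer multiples, hence
      \<open>T\<close> instead of \<open>\<Psi> R\<close>. They agree up to a factor 2, and so the
      radius \<open>rho\<close> of \<open>T\<close> is comparable to \<open>R\<close>.\<close>
    define n where "n = nat \<lfloor>\<Psi> R / \<Psi> r\<rfloor>"
    have "1 \<le> \<Psi> R / \<Psi> r" using psi_mono[of r R] r pr by simp
    then have n: "1 \<le> n" "real n \<le> \<Psi> R / \<Psi> r" "\<Psi> R / \<Psi> r < real n + 1" unfolding n_def by linarith+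
    define T where "T = real n * \<Psi> r"
    have T: "0 < T" "T \<le> \<Psi> R" "\<Psi> R \<le> 2 * T"
    proof -
      show "0 < T" using n pr by (simp add: T_def)
      show "T \<le> \<Psi> R" using n(2) pr by (simp add: T_def field_simps)
      have "\<Psi> R / \<Psi> r \<le> 2 * real n" using n by linarith
      then show "\<Psi> R \<le> 2 * T" using pr by (simp add: T_def field_simps)
    qed
    obtain rho where rho: "0 < rho" "\<Psi> rho = T" using psi_surj[OF T(1)] by blast
    have rhoR: "rho \<le> R" using psi_strict_mono[of R rho] T rho R0 by (metis less_imp_le not_le)
    have Rrho: "R \<le> 2 * L * rho"
    proof (rule ccontr)
      assume "\<not> R \<le> 2 * L * rho"
      then have big: "2 * L < R / rho" using rho by (simp add: field_simps)
      then have "R / rho \<le> (R / rho) powr \<beta>1" using L powr_mono[of 1 \<beta>1 "R / rho"] R0 rho(1) rhoR by simp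
      also have "\<dots> \<le> L * (\<Psi> R / \<Psi> rho)" using L(3)[OF rho(1) rhoR] L(1) by (simp add: field_simps)
      also have "\<dots> \<le> L * 2" using T rho L by (intro mult_left_mono) (auto simp: field_simps)
      finally show False using big by simp
    qed
    define u where "u y = max 0 (1 - dist x y / R)" for y
    have u: "0 \<le> u y" "u y \<le> 1" for y using R0 by (auto simp: u_def)
    have u0: "u y = 0" if "R \<le> dist x y" for y using that R0 by (simp add: u_def)
    have lip: "\<bar>u y - u w\<bar> \<le> dist y w / R" for y w
    proof -
      have "\<bar>dist x y / R - dist x w / R\<bar> \<le> dist y w / R"
        using dist_triangle[of x y w] dist_triangle[of x w y] R0
        by (simp add: diff_divide_distrib[symmetric] abs_divide divide_right_mono dist_commute abs_le_iff)
      then show ?thesis unfolding u_def by linarith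
    qed
    have [measurable]: "u \<in> borel_measurable m" unfolding u_def[abs_def] by measurable
    let ?f = "\<lambda>y. h y * u y"
    have L2: "?f \<in> L2 m"
    proof (rule L2_bounded[where A="ball x R" and B=1])
      show "emeasure m (ball x R) < \<infinity>" by (rule ball_finite)
      show "\<bar>h y * u y\<bar> \<le> 1" for y
        using mult_mono[OF h(3)[of y] u(2)[of y]] h(2)[of y] u[of y] by simp
    qed (auto simp: u0)
    have energy: "(\<integral>\<^sup>+ y. \<integral>\<^sup>+ w. ennreal (p t y w * (h y * h w * (u y - u w)\<^sup>2)) \<partial>m \<partial>m) =
        ennreal (2 * dissip t ?f)" if "0 < t" for t
      by (rule energy_eq_dissip[OF that _ _ h(2) u(1) L2 h(5)[OF that]]) measurable
    have upper: "2 * dissip (\<Psi> r) ?f \<le> Cu * (r / R)\<^sup>2 * V R"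
    proof -
      have "ennreal (2 * dissip (\<Psi> r) ?f) \<le>
          (\<integral>\<^sup>+ y. \<integral>\<^sup>+ w. ennreal (p (\<Psi> r) y w * (u y - u w)\<^sup>2) \<partial>m \<partial>m)"
        unfolding energy[OF pr, symmetric]
      proof (intro nn_integral_mono ennreal_leI mult_left_mono)
        fix y w
        show "h y * h w * (u y - u w)\<^sup>2 \<le> (u y - u w)\<^sup>2"
          using mult_mono[OF h(3)[of y] h(3)[of w]] h(2)[of y] h(2)[of w]
            mult_right_mono[of "h y * h w" 1 "(u y - u w)\<^sup>2"] by simp
      qed (use p_nonneg pr in auto)
      also have "\<dots> \<le> ennreal (Cu * (r / R)\<^sup>2 * V R)" by (rule Cu(2)[OF r R u0 lip])
      finally show ?thesis using Cu V_pos[OF R0] by (simp add: ennreal_le_iff)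
    qed
    let ?A = "ball x (R / 4)" and ?B = "ball z (R / 4)"
    define k where "k = c / V rho * exp (- B) * (ch\<^sup>2 / 4)"
    have k: "0 < k" using lb h(4) V_pos[OF rho(1)] by (simp add: k_def)
    have lower: "k * (measure m ?A * measure m ?B) \<le> 2 * dissip T ?f"
    proof -
      have "AE y in m. AE w in m. ennreal k * (indicator ?A y * indicator ?B w) \<le>
          ennreal (p T y w * (h y * h w * (u y - u w)\<^sup>2))"
        using lb(3)[OF order_refl rho(1)] h(6)
      proof eventually_elim
        case (elim y)
        note hy = elim(2)
        from elim(1) h(6) show ?case
        proof eventually_elim
          case (elim w)
          show ?case
          proof (cases "y \<in> ?A \<and> w \<in> ?B")
            case True
            then have d: "dist x y < R / 4" "dist z w < R / 4" by auto
            have "dist y w \<le> 3 * R"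
              using dist_triangle[of y w x] dist_triangle[of x w z] xz d by (simp add: dist_commute)
            also have "\<dots> \<le> (6 * L) * (real 1 * rho)" using Rrho by simp
            finally have p_low: "c / V rho * exp (- B) \<le> p T y w" using elim(1) rho by simp
            have "3 / 4 \<le> u y" using d R0 by (simp add: u_def field_simps)
            moreover have "3 / 4 * R \<le> dist x w" using dist_triangle[of x z w] xz d by (simp add: dist_commute)
            then have "3 / 4 \<le> dist x w / R" using R0 by (simp add: field_simps)
            then have "u w \<le> 1 / 4" unfolding u_def by linarith
            ultimately have "1 / 2 \<le> u y - u w" by simp
            then have "(1 / 2)\<^sup>2 \<le> (u y - u w)\<^sup>2" by (rule power_mono) simp
            moreover have "ch * ch \<le> h y * h w" using hy elim(2) h(4) h(2)[of y] by (intro mult_mono) auto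
            ultimately have "ch * ch * (1 / 2)\<^sup>2 \<le> h y * h w * (u y - u w)\<^sup>2"
              using h(2)[of y] h(2)[of w] by (intro mult_mono[of "ch * ch"]) auto
            then have "c / V rho * exp (- B) * (ch * ch * (1 / 2)\<^sup>2) \<le> p T y w * (h y * h w * (u y - u w)\<^sup>2)"
              using p_low p_nonneg[OF T(1), of y w] by (rule_tac mult_mono) auto
            then have "k \<le> p T y w * (h y * h w * (u y - u w)\<^sup>2)"
              by (simp add: k_def power2_eq_square)
            then show ?thesis using True by (simp add: ennreal_leI)
          next
            case False
            then show ?thesis by (auto simp: indicator_def)
          qed
        qed
      qed
      then have "(\<integral>\<^sup>+ y. \<integral>\<^sup>+ w. ennreal k * (indicator ?A y * indicator ?B w) \<partial>m \<partial>m) \<le>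
          (\<integral>\<^sup>+ y. \<integral>\<^sup>+ w. ennreal (p T y w * (h y * h w * (u y - u w)\<^sup>2)) \<partial>m \<partial>m)"
        by (intro nn_integral_mono_AE) (auto elim!: eventually_mono intro: nn_integral_mono_AE)
      also have "\<dots> = ennreal (2 * dissip T ?f)" by (rule energy[OF T(1)])
      finally have "ennreal (k * (measure m ?A * measure m ?B)) \<le> ennreal (2 * dissip T ?f)"
        using k by (simp add: nn_integral_cmult nn_integral_multc emeasure_ball ennreal_mult'[symmetric] mult_ac)
      moreover have "0 < k * (measure m ?A * measure m ?B)"
        using k measure_ball_pos[of "R / 4"] R0 by simp
      ultimately show ?thesis by (metis ennreal_le_iff2 not_le)
    qed
    have mb: "V R / (C0 * 8 ^ a) \<le> measure m (ball y (R / 4))" for y :: 'a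
    proof -
      have "V R \<le> 8 ^ a * V (R / 4)" using a[of 4 "R / 4"] R0 by simp
      then have "V R / (C0 * 8 ^ a) \<le> V (R / 4) / C0" using C0 by (simp add: field_simps)
      also have "\<dots> \<le> measure m (ball y (R / 4))"
        using R0 by (intro measure_ball_lower diam_antimono[OF R]) auto
      finally show ?thesis .
    qed
    have "k1 * V R \<le> k * (measure m ?A * measure m ?B)"
    proof -
      have "k1 * V R = c / V R * exp (- B) * (ch\<^sup>2 / 4) * (V R / (C0 * 8 ^ a) * (V R / (C0 * 8 ^ a)))"
        using V_pos[OF R0] by (simp add: k1_def power2_eq_square)
      also have "\<dots> \<le> k * (measure m ?A * measure m ?B)"
      proof (rule mult_mono)
        have "V rho \<le> V R" using rho rhoR by (intro V_mono) auto
        then have "c / V R \<le> c / V rho" using lb V_pos[OF rho(1)] by (intro divide_left_mono) auto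
        then show "c / V R * exp (- B) * (ch\<^sup>2 / 4) \<le> k" unfolding k_def by (intro mult_right_mono) auto
        show "V R / (C0 * 8 ^ a) * (V R / (C0 * 8 ^ a)) \<le> measure m ?A * measure m ?B"
          using mb V_pos[OF R0] C0 by (intro mult_mono) auto
      qed (use k V_pos[OF R0] C0 in auto)
      finally show ?thesis .
    qed
    also note lower
    also have "2 * dissip T ?f \<le> real n * (2 * dissip (\<Psi> r) ?f)"
      using dissip_mult[OF pr _ L2, of n] n unfolding T_def by simp
    also have "\<dots> \<le> real n * (Cu * (r / R)\<^sup>2 * V R)" using upper by (intro mult_left_mono) auto
    also have "\<dots> \<le> \<Psi> R / \<Psi> r * (Cu * (r / R)\<^sup>2 * V R)"
      using n Cu V_pos[OF R0] by (intro mult_right_mono) auto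
    finally have "k1 * V R \<le> (\<Psi> R / \<Psi> r * Cu * (r / R)\<^sup>2) * V R" by (simp add: mult.assoc)
    then have "k1 \<le> \<Psi> R / \<Psi> r * Cu * (r / R)\<^sup>2" by (rule mult_right_le_imp_le) (rule V_pos[OF R0])
    moreover have "R\<^sup>2 / r\<^sup>2 \<le> Cu / k1 * X" if "k1 \<le> X * Cu * (r / R)\<^sup>2" for X
      using that k1 r R0 by (simp add: power_divide field_simps)
    ultimately show ?thesis by blast
  qed
  have "0 < Cu / k1" using Cu k1 by simp
  then show thesis by (rule that) (rule main)
qed

section \<open>The upper bound by the volume\<close>

lemma separating_function:
  obtains \<kappa> c C where "0 < \<kappa>" "\<kappa> \<le> 1 / 4" "0 < c" "0 < C"
    "\<And>(x::'a) z r R. 0 < r \<Longrightarrow> r \<le> R \<Longrightarrow> ereal R < diam \<Longrightarrow> R \<le> dist x z \<Longrightarrow>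
      \<exists>f. f \<in> L2 m \<and> (\<forall>y. 0 \<le> f y) \<and>
        (AE y in m. y \<in> ball x (\<kappa> * R) \<longrightarrow> c \<le> f y) \<and>
        (AE y in m. y \<in> ball z (\<kappa> * R) \<longrightarrow> f y \<le> c / 2) \<and>
        2 * dissip (\<Psi> (\<kappa> * r)) f \<le> C * (\<Psi> (\<kappa> * r) / \<Psi> (\<kappa> * R)) * V R"
proof -
  obtain c where c: "0 < c" "c \<le> 1" "\<And>rho. 0 < rho \<Longrightarrow>
    AE x in m. ennreal c \<le> mass (\<Psi> rho) x (ball x rho)"
    using local_mass by blast
  obtain Ct b where tail: "0 < Ct" "0 < b" "\<And>rho r. 0 < rho \<Longrightarrow> ereal rho < diam \<Longrightarrow>
    AE x in m. mass (\<Psi> rho) x {y. r \<le> dist x y} \<le> ennreal (Ct * exp (- b * r / rho))"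
    using tail_bound by blast
  \<comment> \<open>The second entry makes the tail at distance \<open>R / 4\<close> and time
    \<open>\<Psi> (\<kappa> * R)\<close> at most \<open>c / 2\<close>, half of the value guaranteed
    near \<open>x\<close>.\<close>
  define \<kappa> where "\<kappa> = min (1 / 4) (b * c / (8 * Ct))"
  have \<kappa>: "0 < \<kappa>" "\<kappa> \<le> 1 / 4" "\<kappa> \<le> b * c / (8 * Ct)" using tail c by (auto simp: \<kappa>_def)
  have small: "Ct * exp (- (b / (4 * \<kappa>))) \<le> c / 2"
  proof -
    define X where "X = b / (4 * \<kappa>)"
    have "\<kappa> * (8 * Ct) \<le> b * c" using \<kappa>(3) tail by (simp add: field_simps)
    then have "Ct \<le> c / 2 * X" using \<kappa>(1) by (simp add: X_def field_simps)
    also have "\<dots> \<le> c / 2 * exp X"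
      using exp_ge_add_one_self[of X] c by (intro mult_left_mono) linarith+
    finally have "Ct * exp (- X) \<le> c / 2" by (simp add: exp_minus field_simps)
    then show ?thesis by (simp add: X_def)
  qed
  have main: "\<exists>f. f \<in> L2 m \<and> (\<forall>y. 0 \<le> f y) \<and>
        (AE y in m. y \<in> ball x (\<kappa> * R) \<longrightarrow> c \<le> f y) \<and>
        (AE y in m. y \<in> ball z (\<kappa> * R) \<longrightarrow> f y \<le> c / 2) \<and>
        2 * dissip (\<Psi> (\<kappa> * r)) f \<le> 2 * C0 * (\<Psi> (\<kappa> * r) / \<Psi> (\<kappa> * R)) * V R"
    if r: "0 < r" "r \<le> R" and R: "ereal R < diam" and xz: "R \<le> dist x z"
    for x z :: 'a and r R
  proof -
    have R0: "0 < R" using r by simp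
    define S where "S = \<kappa> * R"
    have S: "0 < S" "S \<le> R / 4" "ereal S < diam"
    proof -
      show "0 < S" using \<kappa> R0 by (simp add: S_def)
      show "S \<le> R / 4" using mult_right_mono[OF \<kappa>(2), of R] R0 by (simp add: S_def)
      then show "ereal S < diam" using diam_antimono[OF R, of S] R0 by simp
    qed
    define s where "s = \<kappa> * r"
    have s: "0 < s" "s \<le> S" using \<kappa> r by (auto simp: s_def S_def)
    define T where "T = \<Psi> S"
    have T: "0 < T" "\<Psi> s \<le> T" "0 < \<Psi> s" using psi_pos S s psi_mono by (auto simp: T_def)
    \<comment> \<open>With radius \<open>2 * S\<close> the set contains the ball of radius
      \<open>S\<close> around each point of \<open>ball x S\<close>. As
      \<open>S \<le> R / 4\<close>, it still keeps at least the distance \<open>R / 4\<close> from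
      \<open>ball z S\<close>.\<close>
    let ?D = "ball x (2 * S)"
    let ?g = "indicator ?D :: 'a \<Rightarrow> real"
    have g: "?g \<in> L2 m"
      by (rule L2_bounded[where A="?D" and B=1]) (auto simp: indicator_def ball_finite[unfolded infinity_ennreal_def])
    \<comment> \<open>The positive part is a representative that is nonnegative everywhere, as
      \<open>energy_le_dissip\<close> requires.\<close>
    define f where "f y = max 0 (P T ?g y)" for y
    have PT: "P T ?g \<in> L2 m" using T g by (intro P_L2)
    then have [measurable]: "P T ?g \<in> borel_measurable m" by (simp add: L2_def)
    have Kf: "AE y in m. K T (indicator ?D) y = ennreal (P T ?g y) \<and> 0 \<le> P T ?g y"
    proof -
      have "AE y in m. K T (\<lambda>y. ennreal (?g y)) y = ennreal (P T ?g y)"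
        using T g by (intro K_eq_P) auto
      moreover have "(\<lambda>y. ennreal (?g y)) = indicator ?D" by (auto simp: indicator_def)
      moreover have "AE y in m. 0 \<le> P T ?g y \<and> P T ?g y \<le> 1"
        using T g by (intro P_markov) (auto simp: indicator_def)
      ultimately show ?thesis by auto
    qed
    have fP: "AE y in m. f y = P T ?g y" using Kf by eventually_elim (auto simp: f_def)
    have f: "f \<in> L2 m"
    proof -
      have "integrable m (\<lambda>y. (f y)\<^sup>2)"
        by (rule Bochner_Integration.integrable_bound[of m "\<lambda>x. (P T ?g x)\<^sup>2"])
          (use PT in \<open>auto simp: L2_def f_def max_def\<close>)
      moreover have "f \<in> borel_measurable m" unfolding f_def[abs_def] by measurable
      ultimately show ?thesis by (simp add: L2_def)
    qed
    have high: "AE y in m. y \<in> ball x S \<longrightarrow> c \<le> f y"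
      using c(3)[OF S(1)] Kf unfolding T_def[symmetric]
    proof eventually_elim
      case (elim y)
      show ?case
      proof
        assume y: "y \<in> ball x S"
        have "ball y S \<subseteq> ?D"
        proof
          fix w assume "w \<in> ball y S"
          then show "w \<in> ?D" using y dist_triangle[of x w y] by simp
        qed
        then have "mass T y (ball y S) \<le> K T (indicator ?D) y"
          unfolding K_def by (intro nn_integral_mono mult_left_mono) (auto simp: indicator_def)
        with elim(1) have "ennreal c \<le> K T (indicator ?D) y" by (rule order_trans)
        then have "ennreal c \<le> ennreal (P T ?g y)" using elim(2) by simp
        then have "c \<le> P T ?g y" using elim(2) by (simp add: ennreal_le_iff)
        then show "c \<le> f y" by (simp add: f_def)
      qed
    qed
    have low: "AE y in m. y \<in> ball z S \<longrightarrow> f y \<le> c / 2"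
      using tail(3)[OF S(1) S(3), of "R / 4"] Kf unfolding T_def[symmetric]
    proof eventually_elim
      case (elim y)
      show ?case
      proof
        assume y: "y \<in> ball z S"
        have sub: "R / 4 \<le> dist y w" if "w \<in> ?D" for w
        proof -
          have "dist x z \<le> dist x w + dist y w + dist z y"
            using dist_triangle[of x z w] dist_triangle[of w z y] by (simp add: dist_commute)
          then show ?thesis using that y xz S by simp
        qed
        have "K T (indicator ?D) y \<le> mass T y {w. R / 4 \<le> dist y w}"
          unfolding K_def
        proof (intro nn_integral_mono mult_left_mono)
          fix w show "indicator ?D w \<le> (indicator {w. R / 4 \<le> dist y w} w :: ennreal)"
            using sub[of w] by (auto simp: indicator_def)
        qed simp
        also have "\<dots> \<le> ennreal (Ct * exp (- b * (R / 4) / S))" using elim by blast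
        also have "- b * (R / 4) / S = - (b / (4 * \<kappa>))" using R0 \<kappa> by (simp add: S_def)
        also have "ennreal (Ct * exp (- (b / (4 * \<kappa>)))) \<le> ennreal (c / 2)" using small by (rule ennreal_leI)
        finally have "ennreal (P T ?g y) \<le> ennreal (c / 2)" using elim by simp
        then show "f y \<le> c / 2" using elim c by (simp add: f_def)
      qed
    qed
    have "L2_inner m ?g ?g = measure m ?D"
    proof -
      have "(\<lambda>y. ?g y * ?g y) = ?g" by (auto simp: indicator_def)
      then show ?thesis by (simp add: L2_inner_def)
    qed
    moreover have "measure m ?D \<le> C0 * V R"
    proof -
      have "2 * S \<le> R" using S R0 by simp
      have "measure m ?D \<le> C0 * V (2 * S)"
        using S diam_antimono[OF R \<open>2 * S \<le> R\<close>] by (intro measure_ball_upper_diam) auto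
      also have "\<dots> \<le> C0 * V R" using C0 S \<open>2 * S \<le> R\<close> by (intro mult_left_mono V_mono) auto
      finally show ?thesis .
    qed
    ultimately have "\<Psi> s / T * L2_inner m ?g ?g \<le> \<Psi> s / T * (C0 * V R)"
      using T by (intro mult_left_mono) auto
    moreover have "dissip (\<Psi> s) f = dissip (\<Psi> s) (P T ?g)" by (rule dissip_cong_AE[OF T(3) f PT fP])
    ultimately have "dissip (\<Psi> s) f \<le> \<Psi> s / T * (C0 * V R)"
      using dissip_smoothing[OF T(3) T(2) g] by linarith
    moreover have "2 * C0 * (\<Psi> s / T) * V R = 2 * (\<Psi> s / T * (C0 * V R))" by simp
    ultimately have "2 * dissip (\<Psi> s) f \<le> 2 * C0 * (\<Psi> s / T) * V R" by linarith
    moreover have "0 \<le> f y" for y by (simp add: f_def)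
    ultimately show ?thesis using f high low unfolding s_def T_def S_def by blast
  qed
  have "0 < 2 * C0" using C0 by simp
  show thesis by (rule that[OF \<kappa>(1,2) c(1) \<open>0 < 2 * C0\<close>]) (rule main)
qed

theorem scale_at_most_linear_volume:
  obtains C where "0 < C" "\<And>r R. 0 < r \<Longrightarrow> r \<le> R \<Longrightarrow> ereal R < diam \<Longrightarrow>
    \<Psi> R / \<Psi> r \<le> C * ((R * V R) / (r * V r))"
proof -
  obtain \<kappa> c Cs where sep: "0 < \<kappa>" "\<kappa> \<le> 1 / 4" "0 < c" "0 < Cs"
    "\<And>(x::'a) z r R. 0 < r \<Longrightarrow> r \<le> R \<Longrightarrow> ereal R < diam \<Longrightarrow> R \<le> dist x z \<Longrightarrow>
      \<exists>f. f \<in> L2 m \<and> (\<forall>y. 0 \<le> f y) \<and>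
        (AE y in m. y \<in> ball x (\<kappa> * R) \<longrightarrow> c \<le> f y) \<and>
        (AE y in m. y \<in> ball z (\<kappa> * R) \<longrightarrow> f y \<le> c / 2) \<and>
        2 * dissip (\<Psi> (\<kappa> * r)) f \<le> Cs * (\<Psi> (\<kappa> * r) / \<Psi> (\<kappa> * R)) * V R"
    by (rule separating_function) blast
  obtain L :: nat where chain: "\<And>(x::'a) y r n. 0 < r \<Longrightarrow> ereal r < diam \<Longrightarrow> 1 \<le> n \<Longrightarrow>
    dist x y \<le> real n * r \<Longrightarrow> y \<in> chain_set r {x} (L * n)"
    using chain_condition by blast
  obtain c' B where lb: "0 < c'" "0 < B" "\<And>n r. 1 \<le> n \<Longrightarrow> 0 < r \<Longrightarrow>
    AE x in m. AE y in m. dist x y \<le> 3 * (real n * r) \<longrightarrow>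
      c' / V r * exp (- B * real n) \<le> p (real n * \<Psi> r) x y"
    using lower_bound[of 3] by auto
  obtain H \<beta>1 \<beta>2 where H: "1 < H" "\<And>r R. 0 < r \<Longrightarrow> r \<le> R \<Longrightarrow> \<Psi> R / \<Psi> r \<le> H * (R / r) powr \<beta>2"
    using scale_bounds by metis
  obtain a where a: "\<And>l r. 1 \<le> l \<Longrightarrow> 0 < r \<Longrightarrow> V (l * r) \<le> (2 * l) ^ a * V r"
    using doubling_fun_growth[OF V_doubling] by blast
  define k where "k = c' * exp (- B)"
  have k: "0 < k" using lb by (simp add: k_def)
  \<comment> \<open>9 is the overlap 3 times the 3 in \<open>n \<le> 3 * (R / s)\<close>, and
    \<open>C0\<close> enters squared through the measures of two consecutive balls. The factor
    \<open>1 / \<kappa>\<close> and the last power return from \<open>s = \<kappa> * r\<close> to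
    \<open>r\<close>.\<close>
  define G where "G = 9 * C0\<^sup>2 * Cs * (real L + 1) / (k * \<kappa>) * (2 * (1 / \<kappa>)) ^ a"
  have G: "0 < G" using C0 sep k by (simp add: G_def)
  define C where "C = H * (1 / \<kappa>) powr \<beta>2 * (4 / c\<^sup>2 * G)"
  have main: "\<Psi> R / \<Psi> r \<le> C * ((R * V R) / (r * V r))"
    if r: "0 < r" "r \<le> R" and R: "ereal R < diam" for r R
  proof -
    have R0: "0 < R" using r by simp
    obtain x z :: 'a where xz: "R \<le> dist x z" "dist x z < 2 * R" using annulus_point[OF R0 R] by blast
    obtain f where f: "f \<in> L2 m" "\<forall>y. 0 \<le> f y"
      "AE y in m. y \<in> ball x (\<kappa> * R) \<longrightarrow> c \<le> f y" "AE y in m. y \<in> ball z (\<kappa> * R) \<longrightarrow> f y \<le> c / 2"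
      "2 * dissip (\<Psi> (\<kappa> * r)) f \<le> Cs * (\<Psi> (\<kappa> * r) / \<Psi> (\<kappa> * R)) * V R"
      using sep(5)[OF r R xz(1)] by blast
    have [measurable]: "f \<in> borel_measurable m" using f(1) by (simp add: L2_def)
    define s where "s = \<kappa> * r"
    have s: "0 < s" "s \<le> \<kappa> * R" "s \<le> R" "s \<le> r"
    proof -
      show "0 < s" "s \<le> \<kappa> * R" using sep r by (auto simp: s_def)
      show "s \<le> r" using sep r mult_right_mono[of \<kappa> 1 r] by (simp add: s_def)
      then show "s \<le> R" using r by simp
    qed
    have sD: "ereal s < diam" using diam_antimono[OF R s(3)] .
    have Vs: "0 < V s" by (rule V_pos[OF s(1)])
    have ps: "0 < \<Psi> s" by (rule psi_pos[OF s(1)])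
    define n where "n = nat \<lceil>2 * R / s\<rceil>"
    have "1 \<le> R / s" using s by simp
    then have n: "2 * R / s \<le> real n" "real n \<le> 3 * (R / s)" "1 \<le> n" unfolding n_def by linarith+
    have "dist x z \<le> real n * s" using n(1) xz s by (simp add: field_simps)
    then have zin: "z \<in> chain_set s {x} (L * n)" using chain[OF s(1) sD n(3)] by blast
    define l where "l = (LEAST j. z \<in> chain_set s {x} j)"
    have l: "z \<in> chain_set s {x} l" "\<And>j. j < l \<Longrightarrow> z \<notin> chain_set s {x} j" "l \<le> L * n"
      unfolding l_def using zin by (auto intro: LeastI Least_le dest: not_less_Least)
    obtain w where w: "w l = z" "\<And>i. i \<le> l \<Longrightarrow> w i \<in> chain_set s {x} i"
      "\<And>i j. i \<le> l \<Longrightarrow> j < i \<Longrightarrow> w i \<notin> chain_set s {x} j"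
      "\<And>i. i < l \<Longrightarrow> dist (w i) (w (Suc i)) < s"
      using minimal_chain[OF l(1,2)] by blast
    have w0: "w 0 = x" using w(2)[of 0] by simp
    define \<mu> where "\<mu> i = measure m (ball (w i) s)" for i
    define A where "A i = (\<integral>y. indicator (ball (w i) s) y * f y \<partial>m) / \<mu> i" for i
    have \<mu>: "0 < \<mu> i" "V s / C0 \<le> \<mu> i" for i
      unfolding \<mu>_def using measure_ball_pos[OF s(1)] measure_ball_lower[OF s(1) sD] by auto
    have intf: "integrable m (\<lambda>y. indicator (ball v s) y * f y)" for v
    proof -
      have "(indicator (ball v s) :: 'a \<Rightarrow> real) \<in> L2 m"
        by (rule L2_bounded[where A="ball v s" and B=1]) (auto simp: indicator_def ball_finite[unfolded infinity_ennreal_def])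
      then show ?thesis using f(1) by (rule L2_integrable_mult)
    qed
    have intc: "integrable m (\<lambda>y. b * indicator (ball v s) y)" for b :: real and v
      by (intro integrable_mult_right integrable_real_indicator ball_finite ball_sets)
    have valc: "(\<integral>y. b * indicator (ball v s) y \<partial>m) = b * measure m (ball v s)" for b :: real and v
      by simp
    have A0: "c \<le> A 0"
    proof -
      have "(\<integral>y. c * indicator (ball (w 0) s) y \<partial>m) \<le> (\<integral>y. indicator (ball (w 0) s) y * f y \<partial>m)"
      proof (rule integral_mono_AE[OF intc intf])
        show "AE y in m. c * indicator (ball (w 0) s) y \<le> indicator (ball (w 0) s) y * f y"
          using f(3) by eventually_elim (use s(2) in \<open>auto simp: w0 indicator_def\<close>)
      qed
      then have "c * \<mu> 0 \<le> (\<integral>y. indicator (ball (w 0) s) y * f y \<partial>m)" by (simp add: valc \<mu>_def)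
      then show ?thesis using \<mu>(1)[of 0] by (simp add: A_def pos_le_divide_eq)
    qed
    have Al: "A l \<le> c / 2"
    proof -
      have "(\<integral>y. indicator (ball (w l) s) y * f y \<partial>m) \<le> (\<integral>y. c / 2 * indicator (ball (w l) s) y \<partial>m)"
      proof (rule integral_mono_AE[OF intf intc])
        show "AE y in m. indicator (ball (w l) s) y * f y \<le> c / 2 * indicator (ball (w l) s) y"
          using f(4) by eventually_elim (use s(2) in \<open>auto simp: w(1) indicator_def\<close>)
      qed
      then have "(\<integral>y. indicator (ball (w l) s) y * f y \<partial>m) \<le> c / 2 * \<mu> l" by (simp only: valc \<mu>_def)
      then show ?thesis using \<mu>(1)[of l] by (simp add: A_def pos_divide_le_eq)
    qed
    let ?e = "\<lambda>i y v. indicator (ball (w i) s) y * indicator (ball (w (Suc i)) s) v * ennreal ((f y - f v)\<^sup>2)"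
    \<comment> \<open>Each squared difference of means is bounded by a double integral over two
      consecutive balls. Their points are at distance at most \<open>3 * s\<close>, where the kernel
      is at least \<open>k / V s\<close>. The balls of the first variable cover no point more than
      three times, so the sum is controlled by three times one energy integral.\<close>
    have sum_energy: "(\<Sum>i<l. (A i - A (Suc i))\<^sup>2) * (V s / C0)\<^sup>2 \<le>
        3 * V s / k * (Cs * (\<Psi> s / \<Psi> (\<kappa> * R)) * V R)"
    proof -
      have "ennreal ((\<Sum>i<l. (A i - A (Suc i))\<^sup>2) * (V s / C0)\<^sup>2) \<le>
          ennreal (\<Sum>i<l. \<mu> i * \<mu> (Suc i) * (A i - A (Suc i))\<^sup>2)"
        unfolding sum_distrib_right
      proof (intro ennreal_leI sum_mono)
        fix i
        have "V s / C0 * (V s / C0) \<le> \<mu> i * \<mu> (Suc i)"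
          using \<mu>(2)[of i] \<mu>(2)[of "Suc i"] Vs C0 less_imp_le[OF \<mu>(1)] by (intro mult_mono) auto
        then have "(V s / C0)\<^sup>2 * (A i - A (Suc i))\<^sup>2 \<le> \<mu> i * \<mu> (Suc i) * (A i - A (Suc i))\<^sup>2"
          unfolding power2_eq_square[of "V s / C0"] by (rule mult_right_mono) simp
        then show "(A i - A (Suc i))\<^sup>2 * (V s / C0)\<^sup>2 \<le> \<mu> i * \<mu> (Suc i) * (A i - A (Suc i))\<^sup>2"
          by (simp only: mult.commute)
      qed
      also have "\<dots> = (\<Sum>i<l. ennreal (\<mu> i * \<mu> (Suc i) * (A i - A (Suc i))\<^sup>2))"
        using less_imp_le[OF \<mu>(1)] by (subst sum_ennreal) auto
      also have "\<dots> \<le> (\<Sum>i<l. \<integral>\<^sup>+ y. \<integral>\<^sup>+ v. ?e i y v \<partial>m \<partial>m)"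
        unfolding A_def \<mu>_def using measure_ball_pos[OF s(1)] ball_finite
        by (intro sum_mono mean_difference_square f(1)) auto
      also have "\<dots> = (\<integral>\<^sup>+ y. \<integral>\<^sup>+ v. (\<Sum>i<l. ?e i y v) \<partial>m \<partial>m)"
        by (subst nn_integral_sum[symmetric], measurable) (simp add: nn_integral_sum)
      also have "\<dots> \<le> (\<integral>\<^sup>+ y. \<integral>\<^sup>+ v. ennreal (3 * V s / k) * ennreal (p (\<Psi> s) y v * (f y - f v)\<^sup>2) \<partial>m \<partial>m)"
      proof (rule nn_integral_mono_AE)
        have "AE y in m. AE v in m. dist y v \<le> 3 * s \<longrightarrow> k / V s \<le> p (\<Psi> s) y v"
          using lb(3)[OF order_refl s(1)] by (simp add: k_def)
        then show "AE y in m. (\<integral>\<^sup>+ v. (\<Sum>i<l. ?e i y v) \<partial>m) \<le>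
            (\<integral>\<^sup>+ v. ennreal (3 * V s / k) * ennreal (p (\<Psi> s) y v * (f y - f v)\<^sup>2) \<partial>m)"
        proof eventually_elim
          case (elim y)
          show ?case
          proof (rule nn_integral_mono_AE)
            show "AE v in m. (\<Sum>i<l. ?e i y v) \<le> ennreal (3 * V s / k) * ennreal (p (\<Psi> s) y v * (f y - f v)\<^sup>2)"
              using elim
            proof eventually_elim
              case (elim v)
              let ?q = "V s / k * (p (\<Psi> s) y v * (f y - f v)\<^sup>2)"
              have q: "0 \<le> ?q" using Vs k p_nonneg[OF ps] by simp
              have "?e i y v \<le> ennreal (indicator (ball (w i) s) y * ?q)" if "i < l" for i
              proof (cases "y \<in> ball (w i) s \<and> v \<in> ball (w (Suc i)) s")
                case True
                have "dist y v \<le> dist (w i) y + dist (w i) (w (Suc i)) + dist (w (Suc i)) v"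
                  using dist_triangle[of y v "w i"] dist_triangle[of "w i" v "w (Suc i)"]
                  by (simp add: dist_commute)
                then have "dist y v \<le> 3 * s" using True w(4)[OF \<open>i < l\<close>] by simp
                then have "1 \<le> V s / k * p (\<Psi> s) y v" using elim k Vs by (simp add: field_simps)
                then have "1 * (f y - f v)\<^sup>2 \<le> V s / k * p (\<Psi> s) y v * (f y - f v)\<^sup>2"
                  by (rule mult_right_mono) simp
                then show ?thesis using True by (simp add: ennreal_leI mult.assoc)
              next
                case False
                then show ?thesis by (auto simp: indicator_def)
              qed
              then have "(\<Sum>i<l. ?e i y v) \<le> (\<Sum>i<l. ennreal (indicator (ball (w i) s) y * ?q))"
                by (intro sum_mono) auto
              also have "\<dots> = ennreal ((\<Sum>i<l. indicator (ball (w i) s) y) * ?q)"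
              proof -
                have "0 \<le> indicator (ball (w i) s) y * ?q" for i using q by (rule_tac mult_nonneg_nonneg) auto
                then show ?thesis by (subst sum_ennreal) (auto simp only: sum_distrib_right)
              qed
              also have "\<dots> \<le> ennreal (3 * ?q)"
                using q minimal_chain_overlap[of l w s x y] w(2,3) by (intro ennreal_leI mult_right_mono) auto
              also have "\<dots> = ennreal (3 * V s / k) * ennreal (p (\<Psi> s) y v * (f y - f v)\<^sup>2)"
                using Vs k by (simp add: ennreal_mult'[symmetric] mult.assoc)
              finally show ?case .
            qed
          qed
        qed
      qed
      also have "\<dots> = ennreal (3 * V s / k) * (\<integral>\<^sup>+ y. \<integral>\<^sup>+ v. ennreal (p (\<Psi> s) y v * (f y - f v)\<^sup>2) \<partial>m \<partial>m)"
        using ps by (simp add: nn_integral_cmult)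
      also have "\<dots> \<le> ennreal (3 * V s / k) * ennreal (Cs * (\<Psi> s / \<Psi> (\<kappa> * R)) * V R)"
        using energy_le_dissip[OF ps f(1)] f(2) f(5)[folded s_def]
        by (intro mult_left_mono) (auto intro: order_trans ennreal_leI)
      also have "\<dots> = ennreal (3 * V s / k * (Cs * (\<Psi> s / \<Psi> (\<kappa> * R)) * V R))"
        using Vs k by (simp add: ennreal_mult'[symmetric])
      finally show ?thesis
        using Vs k sep ps psi_pos[of "\<kappa> * R"] V_pos[OF R0] R0 by (subst (asm) ennreal_le_iff) auto
    qed
    define X where "X = \<Psi> s / \<Psi> (\<kappa> * R)"
    have X: "0 < X" using ps psi_pos[of "\<kappa> * R"] sep R0 by (simp add: X_def)
    \<comment> \<open>The means fall from at least \<open>c\<close> to at most \<open>c / 2\<close>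
      along the chain; telescoping and Cauchy-Schwarz over its \<open>l\<close> links set this
      against the sum of squares.\<close>
    have "(c / 2)\<^sup>2 \<le> (A 0 - A l)\<^sup>2" using A0 Al sep(3) by (intro power_mono) auto
    also have "A 0 - A l = (\<Sum>i<l. A i - A (Suc i))" by (simp add: sum_lessThan_telescope')
    also have "(\<Sum>i<l. A i - A (Suc i))\<^sup>2 \<le> (\<Sum>i<l. (A i - A (Suc i))\<^sup>2) * real l"
      using Cauchy_Schwarz_ineq_sum[of "\<lambda>i. A i - A (Suc i)" "\<lambda>_. 1" "{..<l}"] by simp
    also have "\<dots> \<le> (3 * C0\<^sup>2 * Cs * X * V R / (k * V s)) * real l"
    proof (rule mult_right_mono)
      have "(\<Sum>i<l. (A i - A (Suc i))\<^sup>2) * (V s)\<^sup>2 \<le> 3 * V s / k * (Cs * X * V R) * C0\<^sup>2"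
        using sum_energy C0 by (simp add: X_def power_divide field_simps)
      then show "(\<Sum>i<l. (A i - A (Suc i))\<^sup>2) \<le> 3 * C0\<^sup>2 * Cs * X * V R / (k * V s)"
        using Vs k by (simp add: power2_eq_square field_simps)
    qed simp
    also have "\<dots> \<le> (3 * C0\<^sup>2 * Cs * X * V R / (k * V s)) * ((real L + 1) * (3 * (R / s)))"
    proof (rule mult_left_mono)
      have "real l \<le> real L * real n" using l(3) by (metis of_nat_le_iff of_nat_mult)
      also have "\<dots> \<le> (real L + 1) * (3 * (R / s))" using n by (intro mult_mono) auto
      finally show "real l \<le> (real L + 1) * (3 * (R / s))" .
    qed (use C0 sep X V_pos[OF R0] k Vs in auto)
    also have "\<dots> = 9 * C0\<^sup>2 * Cs * (real L + 1) / (k * \<kappa>) * X * (R * V R / (r * V s))"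
      using sep r by (simp add: s_def field_simps)
    also have "\<dots> \<le> 9 * C0\<^sup>2 * Cs * (real L + 1) / (k * \<kappa>) * X * (R * V R / (r * V r) * (2 * (1 / \<kappa>)) ^ a)"
    proof (rule mult_left_mono)
      have "V r \<le> (2 * (1 / \<kappa>)) ^ a * V s" using a[of "1 / \<kappa>" s] sep s(1) by (simp add: s_def)
      then have "R * V R / (r * V s) \<le> R * V R * ((2 * (1 / \<kappa>)) ^ a) / (r * V r)"
        using r Vs V_pos[OF r(1)] V_pos[OF R0] R0
        by (simp add: frac_le_eq divide_le_eq le_divide_eq)
      then show "R * V R / (r * V s) \<le> R * V R / (r * V r) * (2 * (1 / \<kappa>)) ^ a" by simp
    qed (use C0 sep X k in auto)
    finally have "(c / 2)\<^sup>2 \<le> X * G * (R * V R / (r * V r))"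
      by (simp add: G_def mult_ac)
    moreover have "1 / X \<le> 4 / c\<^sup>2 * G * Z" if "(c / 2)\<^sup>2 \<le> X * G * Z" for Z
      using that X sep(3) by (simp add: power_divide field_simps)
    ultimately have "1 / X \<le> 4 / c\<^sup>2 * G * (R * V R / (r * V r))" by blast
    \<comment> \<open>Back from the radii \<open>\<kappa> * R\<close> and \<open>s\<close> to
      \<open>R\<close> and \<open>r\<close>: the upper power bound serves the numerator,
      monotonicity the denominator.\<close>
    moreover have "\<Psi> R / \<Psi> r \<le> H * (1 / \<kappa>) powr \<beta>2 * (1 / X)"
    proof -
      have "\<Psi> R / \<Psi> (\<kappa> * R) \<le> H * (R / (\<kappa> * R)) powr \<beta>2"
        using sep R0 mult_right_mono[of \<kappa> 1 R] by (intro H) auto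
      then have "\<Psi> R \<le> H * (1 / \<kappa>) powr \<beta>2 * \<Psi> (\<kappa> * R)"
        using psi_pos[of "\<kappa> * R"] sep R0 by (simp add: field_simps)
      then have "\<Psi> R / \<Psi> r \<le> H * (1 / \<kappa>) powr \<beta>2 * \<Psi> (\<kappa> * R) / \<Psi> r"
        using psi_pos[OF r(1)] by (simp add: divide_right_mono)
      also have "\<dots> \<le> H * (1 / \<kappa>) powr \<beta>2 * \<Psi> (\<kappa> * R) / \<Psi> s"
        using H ps psi_mono[of s r] s psi_pos[of "\<kappa> * R"] psi_pos[OF r(1)] sep R0
        by (intro divide_left_mono mult_nonneg_nonneg mult_pos_pos) auto
      finally show ?thesis by (simp add: X_def)
    qed
    ultimately show ?thesis
      using mult_left_mono[of "1 / X" "4 / c\<^sup>2 * G * (R * V R / (r * V r))" "H * (1 / \<kappa>) powr \<beta>2"] H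
      by (simp add: C_def mult.assoc)
  qed
  have "0 < C" using H G sep(1,3) by (simp add: C_def)
  then show thesis by (rule that) (rule main)
qed

end

theorem theorem2p6:
  fixes V \<Psi> :: "real \<Rightarrow> real"
    and m :: "'a::{metric_space, second_countable_topology} measure"
    and E :: "('a \<Rightarrow> real) \<Rightarrow> ('a \<Rightarrow> real) \<Rightarrow> real"
    and F :: "('a \<Rightarrow> real) set"
  assumes "doubling_fun V"
    and "doubling_fun \<Psi>"
    and "scale_fun \<Psi>"
    and "MMD_space m E F"
    and "HKE_full \<Psi> m E F"
    and "\<exists>C1>1. \<forall>x::'a. \<forall>r. 0 < r \<and> ereal r < ediam (UNIV :: 'a set) \<longrightarrow>
           ennreal (inverse C1 * V r) \<le> emeasure m (ball x r) \<and>
           emeasure m (ball x r) \<le> ennreal (C1 * V r)"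
  shows "\<exists>C>1. \<forall>r R. 0 < r \<and> r \<le> R \<and> ereal R < ediam (UNIV :: 'a set) \<longrightarrow>
           inverse C * (R\<^sup>2 / r\<^sup>2) \<le> \<Psi> R / \<Psi> r \<and>
           \<Psi> R / \<Psi> r \<le> C * ((R * V R) / (r * V r))"
proof (cases "0 < ediam (UNIV :: 'a set)")
  \<comment> \<open>In a one-point space no radius is admissible, and any constant greater than 1
    will do.\<close>
  case False
  then have "\<not> (0 < r \<and> r \<le> R \<and> ereal R < ediam (UNIV :: 'a set))" for r R
    by (metis ereal_less(2) less_le_trans less_trans not_less)
  then show ?thesis by (intro exI[of _ 2]) auto
next
  case True
  obtain C0 where C0: "1 < C0" "\<And>(x::'a) r. 0 < r \<Longrightarrow> ereal r < ediam (UNIV :: 'a set) \<Longrightarrow>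
      ennreal (inverse C0 * V r) \<le> emeasure m (ball x r) \<and> emeasure m (ball x r) \<le> ennreal (C0 * V r)"
    using assms(6) by blast
  obtain P C1 c1 c2 c3 C4 C5 p where hke: "associated_semigroup m E F P"
    "0 < C1" "0 < c1" "0 < c2" "0 < c3" "0 < C4" "0 < C5" "heat_kernel m P p"
    "\<forall>t>0. AE x in m. AE y in m.
           c3 / measure m (ball x (scale_inv \<Psi> t)) *
             exp (- C4 * t * scale_conj \<Psi> (C5 * (dist x y / t))) \<le> p t x y \<and>
           p t x y \<le> C1 / measure m (ball x (scale_inv \<Psi> t)) *
             exp (- c1 * t * scale_conj \<Psi> (c2 * (dist x y / t)))"
    using assms(5) unfolding HKE_full_def by blast
  have sets: "sets m = sets borel"
    using assms(4) by (simp add: MMD_space_def radon_full_support_def)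
  \<comment> \<open>Balls of one fixed radius below the diameter around a countable dense set cover
    the space, and the volume bound makes them finite.\<close>
  interpret sigma_finite_measure m
  proof
    obtain r where r: "0 < ereal r" "ereal r < ediam (UNIV :: 'a set)" using ereal_dense2[OF True] by auto
    obtain D :: "'a set" where D: "countable D" "\<And>X. open X \<Longrightarrow> X \<noteq> {} \<Longrightarrow> \<exists>d\<in>D. d \<in> X"
      using countable_dense_exists by blast
    show "\<exists>A. countable A \<and> A \<subseteq> sets m \<and> \<Union>A = space m \<and> (\<forall>a\<in>A. emeasure m a \<noteq> \<infinity>)"
    proof (intro exI[of _ "(\<lambda>d. ball d r) ` D"] conjI ballI)
      show "countable ((\<lambda>d. ball d r) ` D)" using D by simp
      show "(\<lambda>d. ball d r) ` D \<subseteq> sets m" by (auto simp: sets)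
      have "x \<in> \<Union>((\<lambda>d. ball d r) ` D)" for x
        using D(2)[of "ball x r"] r by (auto simp: dist_commute)
      then show "\<Union>((\<lambda>d. ball d r) ` D) = space m" using sets_eq_imp_space_eq[OF sets] by auto
      have "emeasure m (ball d r) \<le> ennreal (C0 * V r)" for d using C0(2)[OF _ r(2)] r(1) by simp
      then have "emeasure m (ball d r) < top" for d by (rule le_less_trans) simp
      then show "emeasure m b \<noteq> \<infinity>" if "b \<in> (\<lambda>d. ball d r) ` D" for b
        using that by (auto simp: less_top)
    qed
  qed
  interpret hke_space m P p V \<Psi> "ediam (UNIV :: 'a set)" C0 C1 c1 c2 c3 C4 C5
    by unfold_locales (use assms(1,3) hke sets C0 True in \<open>auto simp: associated_semigroup_def\<close>)
  obtain Ca where Ca: "0 < Ca" "\<And>r R. 0 < r \<Longrightarrow> r \<le> R \<Longrightarrow> ereal R < ediam (UNIV :: 'a set) \<Longrightarrow>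
    R\<^sup>2 / r\<^sup>2 \<le> Ca * (\<Psi> R / \<Psi> r)"
    using scale_at_least_quadratic by blast
  obtain Cb where Cb: "0 < Cb" "\<And>r R. 0 < r \<Longrightarrow> r \<le> R \<Longrightarrow> ereal R < ediam (UNIV :: 'a set) \<Longrightarrow>
    \<Psi> R / \<Psi> r \<le> Cb * ((R * V R) / (r * V r))"
    using scale_at_most_linear_volume by blast
  show ?thesis
  proof (intro exI[of _ "max 2 (max Ca Cb)"] conjI allI impI)
    fix r R assume *: "0 < r \<and> r \<le> R \<and> ereal R < ediam (UNIV :: 'a set)"
    let ?C = "max 2 (max Ca Cb)"
    have pos: "0 < \<Psi> R / \<Psi> r" "0 < (R * V R) / (r * V r)"
      using * psi_pos[of R] psi_pos[of r] V_pos[of R] V_pos[of r] by auto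
    have "R\<^sup>2 / r\<^sup>2 \<le> ?C * (\<Psi> R / \<Psi> r)"
      using Ca(2)[of r R] * mult_right_mono[of Ca ?C "\<Psi> R / \<Psi> r"] pos by linarith
    moreover have "inverse k * a \<le> b" if "a \<le> k * b" "0 < k" for a b k :: real
      using that by (simp add: field_simps)
    moreover have "0 < ?C" by simp
    ultimately show "inverse ?C * (R\<^sup>2 / r\<^sup>2) \<le> \<Psi> R / \<Psi> r" by blast
    show "\<Psi> R / \<Psi> r \<le> ?C * ((R * V R) / (r * V r))"
      using Cb(2)[of r R] * mult_right_mono[of Cb ?C "(R * V R) / (r * V r)"] pos by linarith
  qed simp
qed

end
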